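(* Let $p:M\to B$ be a compact symplectic fibration with fibre $(F,\omega_0)$ and a presymplectic base $(B,\omega_B)$. For any class $u\in H^2(M,\mathbb{R})$ such that $i_b^*u=[\omega_b]$ for all $b\in B$, there exist $K>0$ and a presymplectic form $\omega$ on $M$ such that $i_b^*\omega=\omega_b$ for all $b\in B$ and $[\omega]=u+Kp^*[\omega_B]$.
   Context: A presymplectic form on a manifold of dimension $2m+1$ is a closed 2-form of rank $2m$ at every point; a presymplectic manifold is an oriented odd-dimensional manifold with such a form. A fibration (smooth fibre bundle) $p:M\to B$ with symplectic fibre $(F,\omega_0)$ is symplectic if its structure group is the group $Symp(F,\omega_0)$ of symplectomorphisms, and compact symplectic if moreover $B$ and $F$ are compact. On each fibre $F_b=p^{-1}(b)$ there is then a well-defined symplectic form $\omega_b$ given by $\omega_0$ and the local trivializations. The map $i_b:F_b\subset M$ is the inclusion. *)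

theory Defs
  imports "HOL-Analysis.Analysis"
begin

section \<open>Smooth manifolds\<close>

text \<open>On open subsets of finite-dimensional spaces (the only place it is used) \<open>smooth_on\<close> is
  \<open>C\<^sup>\<infinity>\<close>: all iterated directional derivatives exist and are Frechet differentiable.\<close>

primrec times_differentiable_on ::
  "nat \<Rightarrow> 'a::real_normed_vector set \<Rightarrow> ('a \<Rightarrow> 'b::real_normed_vector) \<Rightarrow> bool" where
  "times_differentiable_on 0 S f \<longleftrightarrow> continuous_on S f"
| "times_differentiable_on (Suc n) S f \<longleftrightarrow> (\<forall>x\<in>S. f differentiable (at x)) \<and>
     (\<forall>v. times_differentiable_on n S (\<lambda>x. frechet_derivative f (at x) v))"

definition smooth_on :: "'a::real_normed_vector set \<Rightarrow> ('a \<Rightarrow> 'b::real_normed_vector) \<Rightarrow> bool" where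
  "smooth_on S f \<longleftrightarrow> (\<forall>n. times_differentiable_on n S f)"

text \<open>A chart \<open>(U, \<phi>)\<close> consists of its domain and a coordinate map whose values outside \<open>U\<close> are
  irrelevant.\<close>

type_synonym ('a, 'e) chart = "'a set \<times> ('a \<Rightarrow> 'e)"

abbreviation chart_image :: "('a, 'e) chart \<Rightarrow> 'e set" where
  "chart_image c \<equiv> snd c ` fst c"

abbreviation chart_inv :: "('a, 'e) chart \<Rightarrow> 'e \<Rightarrow> 'a" where
  "chart_inv c \<equiv> inv_into (fst c) (snd c)"

text \<open>Coordinate expression of a map; for the identity map it is the transition map from \<open>c\<close>
  to \<open>d\<close>.\<close>

definition coord_expr :: "('a, 'e) chart \<Rightarrow> ('a \<Rightarrow> 'b) \<Rightarrow> ('b, 'f) chart \<Rightarrow> 'e \<Rightarrow> 'f" where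
  "coord_expr c f d = (\<lambda>x. snd d (f (chart_inv c x)))"

record ('a, 'e) manifold =
  mtop :: "'a topology"
  atlas :: "('a, 'e) chart set"

abbreviation points :: "('a, 'e, 'z) manifold_scheme \<Rightarrow> 'a set" where
  "points M \<equiv> topspace (mtop M)"

definition smooth_atlas :: "'a topology \<Rightarrow> ('a, 'e::real_normed_vector) chart set \<Rightarrow> bool" where
  "smooth_atlas X A \<longleftrightarrow>
     (\<forall>c\<in>A. openin X (fst c) \<and> open (chart_image c) \<and>
        homeomorphic_map (subtopology X (fst c)) (top_of_set (chart_image c)) (snd c)) \<and>
     (\<Union>c\<in>A. fst c) = topspace X \<and>
     (\<forall>c\<in>A. \<forall>d\<in>A. smooth_on (snd c ` (fst c \<inter> fst d)) (coord_expr c id d))"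

text \<open>The model space is any finite-dimensional space, the trivial one included. The atlas need not
  be maximal; all notions below depend only on the smooth structure it generates.\<close>

definition smooth_manifold :: "('a, 'e::real_normed_vector) manifold \<Rightarrow> bool" where
  "smooth_manifold M \<longleftrightarrow>
     (\<exists>S::'e set. finite S \<and> span S = UNIV) \<and>
     Hausdorff_space (mtop M) \<and> second_countable (mtop M) \<and> smooth_atlas (mtop M) (atlas M)"

definition compact_manifold :: "('a, 'e::real_normed_vector) manifold \<Rightarrow> bool" where
  "compact_manifold M \<longleftrightarrow> smooth_manifold M \<and> compact_space (mtop M)"

definition smooth_map ::
  "('a, 'e::real_normed_vector) manifold \<Rightarrow> ('b, 'f::real_normed_vector) manifold \<Rightarrow> ('a \<Rightarrow> 'b) \<Rightarrow> bool" where
  "smooth_map M N f \<longleftrightarrow> continuous_map (mtop M) (mtop N) f \<and>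
     (\<forall>c\<in>atlas M. \<forall>d\<in>atlas N. smooth_on (snd c ` (fst c \<inter> f -` fst d)) (coord_expr c f d))"

definition diffeomorphism ::
  "('a, 'e::real_normed_vector) manifold \<Rightarrow> ('b, 'f::real_normed_vector) manifold \<Rightarrow> ('a \<Rightarrow> 'b) \<Rightarrow> bool" where
  "diffeomorphism M N f \<longleftrightarrow> smooth_map M N f \<and>
     (\<exists>g. smooth_map N M g \<and> (\<forall>x\<in>points M. g (f x) = x) \<and> (\<forall>y\<in>points N. f (g y) = y))"

definition open_submanifold :: "('a, 'e) manifold \<Rightarrow> 'a set \<Rightarrow> ('a, 'e) manifold" where
  "open_submanifold M U =
     \<lparr>mtop = subtopology (mtop M) U, atlas = {(fst c \<inter> U, snd c) | c. c \<in> atlas M}\<rparr>"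

definition product_manifold :: "('a, 'e) manifold \<Rightarrow> ('b, 'f) manifold \<Rightarrow> ('a \<times> 'b, 'e \<times> 'f) manifold" where
  "product_manifold M N =
     \<lparr>mtop = prod_topology (mtop M) (mtop N),
      atlas = {(fst c \<times> fst d, map_prod (snd c) (snd d)) | c d. c \<in> atlas M \<and> d \<in> atlas N}\<rparr>"

text \<open>An orientation is given by an atlas of the same smooth structure whose transition maps have
  positive Jacobian determinant.\<close>

definition orientation_atlas :: "('a, real^'n) manifold \<Rightarrow> ('a, real^'n) chart set \<Rightarrow> bool" where
  "orientation_atlas M Or \<longleftrightarrow>
     smooth_atlas (mtop M) Or \<and> smooth_atlas (mtop M) (atlas M \<union> Or) \<and>
     (\<forall>c\<in>Or. \<forall>d\<in>Or. \<forall>x\<in>snd c ` (fst c \<inter> fst d). det (jacobian (coord_expr c id d) (at x)) > 0)"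


section \<open>Differential forms of degree one and two, and the second de Rham cohomology\<close>

text \<open>A form is the family of its coordinate representations, one for each chart of the atlas,
  related by the transition maps. Values of the family at charts outside the atlas or at points
  outside the chart image are irrelevant, so equality of forms is \<open>eq_form2\<close> rather than \<open>=\<close>.\<close>

type_synonym ('a, 'e) form1 = "('a, 'e) chart \<Rightarrow> 'e \<Rightarrow> 'e \<Rightarrow> real"
type_synonym ('a, 'e) form2 = "('a, 'e) chart \<Rightarrow> 'e \<Rightarrow> 'e \<Rightarrow> 'e \<Rightarrow> real"

definition one_form :: "('a, 'e::real_normed_vector) manifold \<Rightarrow> ('a, 'e) form1 \<Rightarrow> bool" where
  "one_form M \<alpha> \<longleftrightarrow>
     (\<forall>c\<in>atlas M. (\<forall>x\<in>chart_image c. linear (\<alpha> c x)) \<and>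
                  (\<forall>v. smooth_on (chart_image c) (\<lambda>x. \<alpha> c x v))) \<and>
     (\<forall>c\<in>atlas M. \<forall>d\<in>atlas M. \<forall>x\<in>snd c ` (fst c \<inter> fst d). \<forall>v.
        \<alpha> c x v = \<alpha> d (coord_expr c id d x) (frechet_derivative (coord_expr c id d) (at x) v))"

definition two_form :: "('a, 'e::real_normed_vector) manifold \<Rightarrow> ('a, 'e) form2 \<Rightarrow> bool" where
  "two_form M \<omega> \<longleftrightarrow>
     (\<forall>c\<in>atlas M. (\<forall>x\<in>chart_image c. bilinear (\<omega> c x) \<and> (\<forall>v. \<omega> c x v v = 0)) \<and>
                  (\<forall>v w. smooth_on (chart_image c) (\<lambda>x. \<omega> c x v w))) \<and>
     (\<forall>c\<in>atlas M. \<forall>d\<in>atlas M. \<forall>x\<in>snd c ` (fst c \<inter> fst d). \<forall>v w.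
        \<omega> c x v w = \<omega> d (coord_expr c id d x) (frechet_derivative (coord_expr c id d) (at x) v)
                                              (frechet_derivative (coord_expr c id d) (at x) w))"

definition eq_form2 :: "('a, 'e) manifold \<Rightarrow> ('a, 'e) form2 \<Rightarrow> ('a, 'e) form2 \<Rightarrow> bool" where
  "eq_form2 M \<omega> \<eta> \<longleftrightarrow> (\<forall>c\<in>atlas M. \<forall>x\<in>chart_image c. \<forall>v w. \<omega> c x v w = \<eta> c x v w)"

definition add_form2 :: "('a, 'e) form2 \<Rightarrow> ('a, 'e) form2 \<Rightarrow> ('a, 'e) form2" where
  "add_form2 \<omega> \<eta> = (\<lambda>c x v w. \<omega> c x v w + \<eta> c x v w)"

definition scale_form2 :: "real \<Rightarrow> ('a, 'e) form2 \<Rightarrow> ('a, 'e) form2" where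
  "scale_form2 K \<omega> = (\<lambda>c x v w. K * \<omega> c x v w)"

text \<open>Exterior derivatives in coordinates; the vectors are constant vector fields of the chart, so no
  Lie bracket terms occur.\<close>

definition ext_d1 :: "('a, 'e::real_normed_vector) form1 \<Rightarrow> ('a, 'e) form2" where
  "ext_d1 \<alpha> = (\<lambda>c x v w. frechet_derivative (\<lambda>y. \<alpha> c y w) (at x) v
                        - frechet_derivative (\<lambda>y. \<alpha> c y v) (at x) w)"

definition ext_d2 ::
  "('a, 'e::real_normed_vector) form2 \<Rightarrow> ('a, 'e) chart \<Rightarrow> 'e \<Rightarrow> 'e \<Rightarrow> 'e \<Rightarrow> 'e \<Rightarrow> real" where
  "ext_d2 \<omega> = (\<lambda>c x u v w. frechet_derivative (\<lambda>y. \<omega> c y v w) (at x) u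
                          - frechet_derivative (\<lambda>y. \<omega> c y u w) (at x) v
                          + frechet_derivative (\<lambda>y. \<omega> c y u v) (at x) w)"

definition closed_two_form :: "('a, 'e::real_normed_vector) manifold \<Rightarrow> ('a, 'e) form2 \<Rightarrow> bool" where
  "closed_two_form M \<omega> \<longleftrightarrow> two_form M \<omega> \<and>
     (\<forall>c\<in>atlas M. \<forall>x\<in>chart_image c. \<forall>u v w. ext_d2 \<omega> c x u v w = 0)"

text \<open>The result does not depend on the chart chosen around the image point.\<close>

definition pullback2 ::
  "('a, 'e::real_normed_vector) manifold \<Rightarrow> ('b, 'f::real_normed_vector) manifold \<Rightarrow>
   ('a \<Rightarrow> 'b) \<Rightarrow> ('b, 'f) form2 \<Rightarrow> ('a, 'e) form2" where
  "pullback2 M N f \<omega> = (\<lambda>c x v w.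
     let d = (SOME d. d \<in> atlas N \<and> f (chart_inv c x) \<in> fst d);
         D = frechet_derivative (coord_expr c f d) (at x)
     in \<omega> d (coord_expr c f d x) (D v) (D w))"

definition cohomologous :: "('a, 'e::real_normed_vector) manifold \<Rightarrow> ('a, 'e) form2 rel" where
  "cohomologous M = {(\<omega>, \<eta>). closed_two_form M \<omega> \<and> closed_two_form M \<eta> \<and>
     (\<exists>\<alpha>. one_form M \<alpha> \<and> eq_form2 M \<omega> (add_form2 \<eta> (ext_d1 \<alpha>)))}"

definition H2 :: "('a, 'e::real_normed_vector) manifold \<Rightarrow> ('a, 'e) form2 set set" where
  "H2 M = Collect (closed_two_form M) // cohomologous M"

definition coh_class :: "('a, 'e::real_normed_vector) manifold \<Rightarrow> ('a, 'e) form2 \<Rightarrow> ('a, 'e) form2 set" where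
  "coh_class M \<omega> = cohomologous M `` {\<omega>}"

text \<open>Operations on classes, by lifting the operations on representatives to the quotient.\<close>

definition add_class ::
  "('a, 'e::real_normed_vector) manifold \<Rightarrow> ('a, 'e) form2 set \<Rightarrow> ('a, 'e) form2 set \<Rightarrow> ('a, 'e) form2 set" where
  "add_class M u w = (\<Union>\<omega>\<in>u. \<Union>\<eta>\<in>w. coh_class M (add_form2 \<omega> \<eta>))"

definition scale_class ::
  "('a, 'e::real_normed_vector) manifold \<Rightarrow> real \<Rightarrow> ('a, 'e) form2 set \<Rightarrow> ('a, 'e) form2 set" where
  "scale_class M K u = (\<Union>\<omega>\<in>u. coh_class M (scale_form2 K \<omega>))"

definition pullback_class ::
  "('a, 'e::real_normed_vector) manifold \<Rightarrow> ('b, 'f::real_normed_vector) manifold \<Rightarrow>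
   ('a \<Rightarrow> 'b) \<Rightarrow> ('b, 'f) form2 set \<Rightarrow> ('a, 'e) form2 set" where
  "pullback_class M N f u = (\<Union>\<omega>\<in>u. coh_class M (pullback2 M N f \<omega>))"


section \<open>Symplectic and presymplectic forms\<close>

text \<open>The evenness of the dimension is automatic from nondegeneracy unless the manifold is empty.\<close>

definition symplectic_form :: "('a, 'e::real_normed_vector) manifold \<Rightarrow> ('a, 'e) form2 \<Rightarrow> bool" where
  "symplectic_form M \<omega> \<longleftrightarrow> even (dim (UNIV :: 'e set)) \<and> closed_two_form M \<omega> \<and>
     (\<forall>c\<in>atlas M. \<forall>x\<in>chart_image c. \<forall>v. (\<forall>w. \<omega> c x v w = 0) \<longrightarrow> v = 0)"

definition symplectomorphism ::
  "('a, 'e::real_normed_vector) manifold \<Rightarrow> ('a, 'e) form2 \<Rightarrow> ('a \<Rightarrow> 'a) \<Rightarrow> bool" where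
  "symplectomorphism M \<omega> f \<longleftrightarrow> diffeomorphism M M f \<and> eq_form2 M (pullback2 M M f \<omega>) \<omega>"

text \<open>The rank of a bilinear form is that of its Gram matrix.\<close>

definition presymplectic_form :: "('a, real^'n) manifold \<Rightarrow> ('a, real^'n) form2 \<Rightarrow> bool" where
  "presymplectic_form M \<omega> \<longleftrightarrow> closed_two_form M \<omega> \<and>
     (\<exists>m. CARD('n) = 2 * m + 1 \<and>
        (\<forall>c\<in>atlas M. \<forall>x\<in>chart_image c.
           rank (\<chi> i j. \<omega> c x (axis i 1) (axis j 1)) = 2 * m))"

definition presymplectic_manifold ::
  "('a, real^'n) manifold \<Rightarrow> ('a, real^'n) chart set \<Rightarrow> ('a, real^'n) form2 \<Rightarrow> bool" where
  "presymplectic_manifold M Or \<omega> \<longleftrightarrow>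
     smooth_manifold M \<and> orientation_atlas M Or \<and> presymplectic_form M \<omega>"


section \<open>Symplectic fibrations\<close>

text \<open>A local trivialization \<open>(U, \<psi>)\<close> is a diffeomorphism \<open>\<psi> : p\<^sup>-\<^sup>1(U) \<rightarrow> U \<times> F\<close> over \<open>U\<close>.\<close>

definition local_trivialization ::
  "('m, 'e::real_normed_vector) manifold \<Rightarrow> ('b, 'h::real_normed_vector) manifold \<Rightarrow>
   ('f, 'v::real_normed_vector) manifold \<Rightarrow> ('m \<Rightarrow> 'b) \<Rightarrow> 'b set \<times> ('m \<Rightarrow> 'b \<times> 'f) \<Rightarrow> bool" where
  "local_trivialization M B F p t \<longleftrightarrow> openin (mtop B) (fst t) \<and>
     diffeomorphism (open_submanifold M (points M \<inter> p -` fst t))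
                    (product_manifold (open_submanifold B (fst t)) F) (snd t) \<and>
     (\<forall>x\<in>points M \<inter> p -` fst t. fst (snd t x) = p x)"

text \<open>A symplectic fibration is a bundle with a trivializing family \<open>T\<close> all of whose transition
  maps are fibrewise in \<open>Symp(F, \<omega>\<^sub>0)\<close>. The equation between dimensions is automatic from
  local triviality unless the total space is empty.\<close>

definition symplectic_fibration ::
  "('m, 'e::real_normed_vector) manifold \<Rightarrow> ('b, 'h::real_normed_vector) manifold \<Rightarrow>
   ('f, 'v::real_normed_vector) manifold \<Rightarrow> ('f, 'v) form2 \<Rightarrow> ('m \<Rightarrow> 'b) \<Rightarrow>
   ('b set \<times> ('m \<Rightarrow> 'b \<times> 'f)) set \<Rightarrow> bool" where
  "symplectic_fibration M B F \<omega>\<^sub>0 p T \<longleftrightarrow>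
     smooth_manifold M \<and> smooth_manifold B \<and> smooth_manifold F \<and>
     dim (UNIV :: 'e set) = dim (UNIV :: 'h set) + dim (UNIV :: 'v set) \<and>
     symplectic_form F \<omega>\<^sub>0 \<and>
     smooth_map M B p \<and>
     (\<forall>t\<in>T. local_trivialization M B F p t) \<and>
     (\<Union>t\<in>T. fst t) = points B \<and>
     (\<forall>t\<in>T. \<forall>s\<in>T. \<forall>b\<in>fst t \<inter> fst s.
        symplectomorphism F \<omega>\<^sub>0
          (\<lambda>y. snd (snd s (inv_into (points M \<inter> p -` fst t) (snd t) (b, y)))))"

definition compact_symplectic_fibration ::
  "('m, 'e::real_normed_vector) manifold \<Rightarrow> ('b, 'h::real_normed_vector) manifold \<Rightarrow>
   ('f, 'v::real_normed_vector) manifold \<Rightarrow> ('f, 'v) form2 \<Rightarrow> ('m \<Rightarrow> 'b) \<Rightarrow>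
   ('b set \<times> ('m \<Rightarrow> 'b \<times> 'f)) set \<Rightarrow> bool" where
  "compact_symplectic_fibration M B F \<omega>\<^sub>0 p T \<longleftrightarrow>
     symplectic_fibration M B F \<omega>\<^sub>0 p T \<and> compact_manifold B \<and> compact_manifold F"

text \<open>The fibre \<open>F\<^sub>b\<close>, with the smooth structure for which the local trivializations restrict to
  diffeomorphisms \<open>F\<^sub>b \<rightarrow> F\<close>; it is the one \<open>F\<^sub>b\<close> has as an embedded submanifold.\<close>

definition fibre ::
  "('m, 'e) manifold \<Rightarrow> ('f, 'v) manifold \<Rightarrow> ('m \<Rightarrow> 'b) \<Rightarrow>
   ('b set \<times> ('m \<Rightarrow> 'b \<times> 'f)) set \<Rightarrow> 'b \<Rightarrow> ('m, 'v) manifold" where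
  "fibre M F p T b =
     \<lparr>mtop = subtopology (mtop M) (p -` {b}),
      atlas = {({x \<in> points M \<inter> p -` {b}. snd (snd t x) \<in> fst d}, \<lambda>x. snd d (snd (snd t x)))
               | t d. t \<in> T \<and> b \<in> fst t \<and> d \<in> atlas F}\<rparr>"

text \<open>The form \<open>\<omega>\<^sub>b\<close>, independent of the local trivialization chosen around \<open>b\<close>.\<close>

definition fibre_form ::
  "('m, 'e) manifold \<Rightarrow> ('f, 'v::real_normed_vector) manifold \<Rightarrow> ('f, 'v) form2 \<Rightarrow> ('m \<Rightarrow> 'b) \<Rightarrow>
   ('b set \<times> ('m \<Rightarrow> 'b \<times> 'f)) set \<Rightarrow> 'b \<Rightarrow> ('m, 'v) form2" where
  "fibre_form M F \<omega>\<^sub>0 p T b =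
     (let t = (SOME t. t \<in> T \<and> b \<in> fst t)
      in pullback2 (fibre M F p T b) F (snd \<circ> snd t) \<omega>\<^sub>0)"

end

theory Submission
  imports Defs
begin

text \<open>This is Thurston's construction. Since the class of \<open>u\<close> restricts to \<open>[\<omega>\<^sub>b]\<close>, a closed
  representative \<open>\<tau>\<close> of \<open>u\<close> differs from \<open>\<omega>\<^sub>b\<close> on each fibre by an exact form, and over a
  coordinate ball of the base the homotopy contracting the ball turns a primitive on the central fibre
  into a one-form \<open>\<alpha>\<close> on the total space that is a primitive on every fibre at once. Replacing \<open>\<tau>\<close> by
  \<open>\<tau> - d((\<chi> \<circ> p) \<alpha>)\<close> with a bump function \<open>\<chi>\<close> moves every fibre restriction towards \<open>\<omega>\<^sub>b\<close>, because
  \<open>\<chi> \<circ> p\<close> is constant on fibres; doing so successively over a finite cover yields a representative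
  that restricts to \<open>\<omega>\<^sub>b\<close> everywhere, with no partition of unity. Finally \<open>\<tau> + K p\<^sup>*\<omega>\<^sub>B\<close> has radical of
  dimension at most one for large \<open>K\<close>, by compactness of the total space, and at least one since the
  dimension is odd.\<close>

section \<open>Smooth calculus in finite-dimensional inner product spaces\<close>

text \<open>The hypothesis speaks of each fibre separately and gives no control over how primitives
  of \<tau> - \<omega>_b vary with b. Hence a primitive is chosen only on the central fibre of a
  ball, and the homotopy carries it to the neighbours. On the fibre over b a correction multiplies
  \<tau> - \<omega>_b by 1 - \<chi>(b): the difference vanishes where \<chi> = 1, and where it was
  zero it stays zero, so repaired fibres are never spoiled. The model space of the fibre may be the
  trivial space, which no instance of \<open>euclidean_space\<close> is. The calculus therefore
  takes place in inner product spaces with a finite spanning set, through expansions in an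
  orthonormal basis. Forms are coordinate families and \<open>pullback2\<close> selects a chart by
  choice, so independence of the chart has to be secured before any geometry. To this end all
  calculations run along parametrizations by open subsets of vector spaces. The bound on K comes
  from a limit of unit vectors in the model space of M, not from a determinant.\<close>

definition findim :: "'a::real_inner itself \<Rightarrow> bool" where
  "findim _ \<longleftrightarrow> (\<exists>S::'a set. finite S \<and> span S = UNIV)"

text \<open>Encoded by the expansion formula, on which every later use rests. Read literally it
  describes a finite Parseval frame; for the trivial space the empty set qualifies.\<close>

definition onb :: "'a::real_inner set \<Rightarrow> bool" where
  "onb E \<longleftrightarrow> finite E \<and> (\<forall>x. (\<Sum>e\<in>E. (x \<bullet> e) *\<^sub>R e) = x)"

lemma onb_exists:
  assumes "findim TYPE('a::real_inner)"
  obtains E :: "'a::real_inner set" where "onb E"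
proof -
  obtain S :: "'a set" where S: "finite S" "span S = UNIV" using assms unfolding findim_def by blast
  obtain C where C: "finite C" "span C = span S" "pairwise orthogonal C"
    using basis_orthogonal[OF S(1)] by blast
  \<comment> \<open>The orthogonal spanning set may contain 0, which has to go before
    normalizing.\<close>
  define E where "E = (\<lambda>c. c /\<^sub>R norm c) ` (C - {0})"
  have fE: "finite E" using C by (simp add: E_def)
  have orth: "x \<bullet> y = (if x = y then 1 else 0)" if xy: "x \<in> E" "y \<in> E" for x y
  proof -
    obtain a b where ab: "a \<in> C" "b \<in> C" "a \<noteq> 0" "b \<noteq> 0" "x = a /\<^sub>R norm a" "y = b /\<^sub>R norm b"
      using xy unfolding E_def by blast
    show ?thesis
    proof (cases "x = y")
      case True
      have "x \<bullet> x = 1" using ab by (simp add: dot_square_norm power2_eq_square)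
      then show ?thesis using True by simp
    next
      case False
      then have "a \<noteq> b" using ab by auto
      then have "a \<bullet> b = 0" using C(3) ab by (auto simp: pairwise_def orthogonal_def)
      then show ?thesis using False ab by simp
    qed
  qed
  have spE: "span E = UNIV"
  proof -
    have "c \<in> span E" if "c \<in> C" for c
    proof (cases "c = 0")
      case False
      then have "c /\<^sub>R norm c \<in> span E" using that by (auto simp: E_def intro: span_base)
      then have "norm c *\<^sub>R (c /\<^sub>R norm c) \<in> span E" by (rule span_scale)
      then show ?thesis using False by simp
    qed (simp add: span_zero)
    then have "span C \<subseteq> span E" by (intro span_minimal) auto
    then show ?thesis using C S by auto
  qed
  have "(\<Sum>e\<in>E. (x \<bullet> e) *\<^sub>R e) = x" for x
  proof -
    have "x \<in> span E" using spE by simp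
    then show ?thesis
    proof (induction rule: span_induct_alt)
      case base then show ?case by simp
    next
      case (step c x y)
      have "(\<Sum>e\<in>E. ((c *\<^sub>R x + y) \<bullet> e) *\<^sub>R e) = c *\<^sub>R (\<Sum>e\<in>E. (x \<bullet> e) *\<^sub>R e) + (\<Sum>e\<in>E. (y \<bullet> e) *\<^sub>R e)"
        by (simp add: inner_add_left scaleR_add_left sum.distrib scaleR_sum_right)
      also have "(\<Sum>e\<in>E. (x \<bullet> e) *\<^sub>R e) = (\<Sum>e\<in>E. if e = x then e else 0)"
        by (rule sum.cong) (use orth step in auto)
      also have "\<dots> = x" using fE step by simp
      finally show ?case using step by simp
    qed
  qed
  then show ?thesis using that fE unfolding onb_def by blast
qed

lemma linear_onb: "onb E \<Longrightarrow> linear f \<Longrightarrow> f x = (\<Sum>e\<in>E. (x \<bullet> e) *\<^sub>R f e)"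
proof -
  assume a: "onb E" "linear f"
  have "f x = f (\<Sum>e\<in>E. (x \<bullet> e) *\<^sub>R e)" using a by (simp add: onb_def)
  also have "\<dots> = (\<Sum>e\<in>E. (x \<bullet> e) *\<^sub>R f e)" using a(2) by (simp add: linear_sum linear_scale)
  finally show ?thesis .
qed

lemma linear_bounded_findim:
  fixes f :: "'a::real_inner \<Rightarrow> 'b::real_normed_vector"
  assumes "findim TYPE('a)" "linear f" shows "bounded_linear f"
proof -
  obtain E :: "'a set" where E: "onb E" using onb_exists[OF assms(1)] .
  have f: "f = (\<lambda>x. (\<Sum>e\<in>E. (x \<bullet> e) *\<^sub>R f e))" using linear_onb[OF E assms(2)] by blast
  show ?thesis
    by (subst f) (intro bounded_linear_sum bounded_linear_scaleR_const bounded_linear_inner_left)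
qed

lemma findim_euclidean: "findim TYPE('a::euclidean_space)"
  unfolding findim_def using finite_Basis span_Basis by blast

lemma findim_prod:
  assumes "findim TYPE('a::real_inner)" "findim TYPE('b::real_inner)"
  shows "findim TYPE('a \<times> 'b)"
proof -
  obtain S where S: "finite S" "span (S::'a set) = UNIV" using assms unfolding findim_def by blast
  obtain T where T: "finite T" "span (T::'b set) = UNIV" using assms unfolding findim_def by blast
  let ?U = "(\<lambda>x. (x,0::'b)) ` S \<union> (\<lambda>y. (0::'a,y)) ` T"
  have l1: "linear (\<lambda>x::'a. (x,0::'b))" and l2: "linear (\<lambda>y::'b. (0::'a,y))"
    by (auto intro!: linearI)
  have "(x,y) \<in> span ?U" for x y
  proof -
    have "(x,0) \<in> span ((\<lambda>x. (x,0::'b)) ` S)" using linear_span_image[OF l1, of S] S by auto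
    moreover have "(0,y) \<in> span ((\<lambda>y. (0::'a,y)) ` T)" using linear_span_image[OF l2, of T] T by auto
    ultimately have "(x,0) \<in> span ?U" "(0,y) \<in> span ?U" by (meson Un_upper1 Un_upper2 span_mono subsetD)+
    from span_add[OF this] show ?thesis by simp
  qed
  then have "span ?U = UNIV" by auto
  then show ?thesis unfolding findim_def using S T by (meson finite_Un finite_imageI)
qed

lemma bilinear_onb:
  fixes h :: "'a::real_inner \<Rightarrow> 'b::real_inner \<Rightarrow> real"
  assumes "onb E" "onb E'" "bilinear h"
  shows "h x y = (\<Sum>e\<in>E. \<Sum>e'\<in>E'. (x \<bullet> e) * (y \<bullet> e') * h e e')"
proof -
  have "linear (\<lambda>x. h x y)" "\<And>x. linear (h x)" using assms(3) by (auto simp: bilinear_def)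
  then have "h x y = (\<Sum>e\<in>E. (x \<bullet> e) *\<^sub>R h e y)" "\<And>e. h e y = (\<Sum>e'\<in>E'. (y \<bullet> e') *\<^sub>R h e e')"
    using linear_onb[OF assms(1), of "\<lambda>x. h x y"] linear_onb[OF assms(2)] by blast+
  then show ?thesis by (simp add: sum_distrib_left mult.assoc)
qed


section \<open>Closure properties of iterated differentiability and of smooth maps\<close>

lemma frechet_derivativeI: "(f has_derivative f') (at x) \<Longrightarrow> frechet_derivative f (at x) = f'"
  by (rule frechet_derivative_at[symmetric])

text \<open>Openness of S matters: derivatives are taken in the full space, so agreement on S
  transfers only where S is a neighbourhood.\<close>

lemma times_differentiable_on_cong:
  assumes "open S" "\<And>x. x \<in> S \<Longrightarrow> f x = g x" "times_differentiable_on n S f"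
  shows "times_differentiable_on n S g"
  using assms(2,3)
proof (induction n arbitrary: f g)
  case 0 then show ?case by (auto cong: continuous_on_cong)
next
  case (Suc n)
  have d: "frechet_derivative f (at x) = frechet_derivative g (at x)" "g differentiable (at x)" if "x \<in> S" for x
    using that Suc.prems assms(1)
    by (auto intro!: frechet_derivative_transform_within_open[of f x S]
         simp: differentiable_def dest!: bspec intro: has_derivative_transform_within_open)
  have "times_differentiable_on n S (\<lambda>x. frechet_derivative g (at x) v)" for v
    by (rule Suc.IH[of "\<lambda>x. frechet_derivative f (at x) v"]) (use Suc.prems d in auto)
  then show ?case using d by simp
qed

lemma times_differentiable_on_Suc:
  "times_differentiable_on (Suc n) S f \<Longrightarrow> times_differentiable_on n S f"
proof (induction n arbitrary: f)
  case 0 then show ?case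
    using continuous_at_imp_continuous_on differentiable_imp_continuous_within
    unfolding times_differentiable_on.simps by blast
next
  case (Suc n) then show ?case by auto
qed

lemma times_differentiable_on_subset:
  "times_differentiable_on n S f \<Longrightarrow> T \<subseteq> S \<Longrightarrow> times_differentiable_on n T f"
  by (induction n arbitrary: f) (auto intro: continuous_on_subset)

lemma times_differentiable_on_local:
  assumes "\<And>x. x \<in> S \<Longrightarrow> \<exists>U. open U \<and> x \<in> U \<and> times_differentiable_on n U f"
  shows "times_differentiable_on n S f"
  using assms
proof (induction n arbitrary: f)
  case 0
  then show ?case
    by (metis continuous_at_imp_continuous_on continuous_on_eq_continuous_at times_differentiable_on.simps(1))
next
  case (Suc n)
  then show ?case by simp meson
qed

lemma times_differentiable_on_const: "times_differentiable_on n S (\<lambda>x. c)"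
  by (induction n arbitrary: c) auto

lemma times_differentiable_on_bounded_linear_compose:
  assumes "open S" "bounded_linear L" "times_differentiable_on n S f"
  shows "times_differentiable_on n S (\<lambda>x. L (f x))"
  using assms(3)
proof (induction n arbitrary: f)
  case 0 then show ?case using assms(2) by (simp add: bounded_linear.continuous_on)
next
  case (Suc n)
  have d: "((\<lambda>x. L (f x)) has_derivative (\<lambda>v. L (frechet_derivative f (at x) v))) (at x)" if "x \<in> S" for x
    using that Suc.prems by (auto intro!: bounded_linear.has_derivative[OF assms(2)] simp: frechet_derivative_works)
  have "(\<lambda>x. L (f x)) differentiable (at x)" if "x \<in> S" for x using d[OF that] by (auto simp: differentiable_def)
  moreover have "times_differentiable_on n S (\<lambda>x. frechet_derivative (\<lambda>x. L (f x)) (at x) v)" for v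
  proof -
    have "times_differentiable_on n S (\<lambda>x. L (frechet_derivative f (at x) v))" using Suc by auto
    then show ?thesis
      by (rule times_differentiable_on_cong[OF assms(1), rotated]) (simp add: frechet_derivativeI[OF d])
  qed
  ultimately show ?case by simp
qed

lemma times_differentiable_on_add:
  assumes "open S" "times_differentiable_on n S f" "times_differentiable_on n S g"
  shows "times_differentiable_on n S (\<lambda>x. f x + g x)"
  using assms(2,3)
proof (induction n arbitrary: f g)
  case 0 then show ?case by (simp add: continuous_on_add)
next
  case (Suc n)
  have d: "((\<lambda>x. f x + g x) has_derivative (\<lambda>v. frechet_derivative f (at x) v + frechet_derivative g (at x) v)) (at x)"
    if "x \<in> S" for x
    using that Suc.prems by (auto intro!: has_derivative_add simp: frechet_derivative_works)
  have "(\<lambda>x. f x + g x) differentiable (at x)" if "x \<in> S" for x using d[OF that] by (auto simp: differentiable_def)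
  moreover have "times_differentiable_on n S (\<lambda>x. frechet_derivative (\<lambda>x. f x + g x) (at x) v)" for v
  proof -
    have "times_differentiable_on n S (\<lambda>x. frechet_derivative f (at x) v + frechet_derivative g (at x) v)"
      by (rule Suc.IH) (use Suc.prems in auto)
    then show ?thesis
      by (rule times_differentiable_on_cong[OF assms(1), rotated]) (simp add: frechet_derivativeI[OF d])
  qed
  ultimately show ?case by simp
qed

lemma times_differentiable_on_bilinear:
  assumes "open S" "bounded_bilinear h" "times_differentiable_on n S f" "times_differentiable_on n S g"
  shows "times_differentiable_on n S (\<lambda>x. h (f x) (g x))"
  using assms(3,4)
proof (induction n arbitrary: f g)
  case 0 then show ?case using assms(2) by (simp add: bounded_bilinear.continuous_on)
next
  case (Suc n)
  have d: "((\<lambda>x. h (f x) (g x)) has_derivative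
      (\<lambda>v. h (f x) (frechet_derivative g (at x) v) + h (frechet_derivative f (at x) v) (g x))) (at x)"
    if "x \<in> S" for x
    using that Suc.prems by (auto intro!: bounded_bilinear.FDERIV[OF assms(2)] simp: frechet_derivative_works)
  have "(\<lambda>x. h (f x) (g x)) differentiable (at x)" if "x \<in> S" for x using d[OF that] by (auto simp: differentiable_def)
  moreover have "times_differentiable_on n S (\<lambda>x. frechet_derivative (\<lambda>x. h (f x) (g x)) (at x) v)" for v
  proof -
    have "times_differentiable_on n S (\<lambda>x. h (f x) (frechet_derivative g (at x) v) + h (frechet_derivative f (at x) v) (g x))"
      by (intro times_differentiable_on_add assms(1) Suc.IH)
        (use Suc.prems times_differentiable_on_Suc in auto)
    then show ?thesis
      by (rule times_differentiable_on_cong[OF assms(1), rotated]) (simp add: frechet_derivativeI[OF d])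
  qed
  ultimately show ?case by simp
qed

lemma times_differentiable_on_sum:
  assumes "open S" "\<And>i. i \<in> I \<Longrightarrow> times_differentiable_on n S (f i)"
  shows "times_differentiable_on n S (\<lambda>x. \<Sum>i\<in>I. f i x)"
  using assms(2)
  by (induction I rule: infinite_finite_induct)
    (auto intro: times_differentiable_on_const times_differentiable_on_add[OF assms(1)])

text \<open>The difficulty in the induction is that the chain rule differentiates g in the direction
  of the derivative of f, which moves with x. Expanding this direction in an orthonormal basis of
  the middle space leaves derivatives of g in fixed directions, to which the induction hypothesis
  applies.\<close>

lemma times_differentiable_on_compose:
  fixes f :: "'a::real_normed_vector \<Rightarrow> 'b::real_inner" and g :: "'b \<Rightarrow> 'c::real_normed_vector"
  assumes fin: "findim TYPE('b)" and op: "open X" "open Y"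
    and "times_differentiable_on n X f" "times_differentiable_on n Y g" "f ` X \<subseteq> Y"
  shows "times_differentiable_on n X (\<lambda>x. g (f x))"
  using assms(4-6)
proof (induction n arbitrary: f g)
  case 0 then show ?case by (auto intro: continuous_on_compose2)
next
  case (Suc n)
  obtain E :: "'b set" where E: "onb E" using onb_exists[OF fin] .
  let ?D = "\<lambda>x v. frechet_derivative g (at (f x)) (frechet_derivative f (at x) v)"
  have d: "((\<lambda>x. g (f x)) has_derivative ?D x) (at x)" if "x \<in> X" for x
    using Suc.prems that
    by (intro has_derivative_compose[of f _ x UNIV g]) (auto simp: frechet_derivative_works)
  have e: "?D x v = (\<Sum>e\<in>E. (frechet_derivative f (at x) v \<bullet> e) *\<^sub>R frechet_derivative g (at (f x)) e)"
    if "x \<in> X" for x v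
    using Suc.prems that by (intro linear_onb[OF E] linear_frechet_derivative) auto
  have "(\<lambda>x. g (f x)) differentiable (at x)" if "x \<in> X" for x using d[OF that] by (auto simp: differentiable_def)
  moreover have "times_differentiable_on n X (\<lambda>x. frechet_derivative (\<lambda>x. g (f x)) (at x) v)" for v
  proof -
    have f: "times_differentiable_on n X (\<lambda>x. frechet_derivative f (at x) v)"
      "times_differentiable_on n X f"
      using Suc.prems times_differentiable_on_Suc[OF Suc.prems(1)] by auto
    have "times_differentiable_on n X (\<lambda>x. \<Sum>e\<in>E. (frechet_derivative f (at x) v \<bullet> e) *\<^sub>R frechet_derivative g (at (f x)) e)"
    proof (intro times_differentiable_on_sum op times_differentiable_on_bilinear[OF _ bounded_bilinear_scaleR])
      fix e
      show "times_differentiable_on n X (\<lambda>x. frechet_derivative f (at x) v \<bullet> e)"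
        by (rule times_differentiable_on_bounded_linear_compose[OF op(1) bounded_linear_inner_left f(1)])
      show "times_differentiable_on n X (\<lambda>x. frechet_derivative g (at (f x)) e)"
        using Suc.IH[of f "\<lambda>y. frechet_derivative g (at y) e"] f Suc.prems by auto
    qed
    then show ?thesis
      by (rule times_differentiable_on_cong[OF op(1), rotated]) (simp add: frechet_derivativeI[OF d] e)
  qed
  ultimately show ?case by simp
qed

lemma smooth_on_cong:
  "open S \<Longrightarrow> smooth_on S f \<Longrightarrow> (\<And>x. x \<in> S \<Longrightarrow> f x = g x) \<Longrightarrow> smooth_on S g"
  unfolding smooth_on_def using times_differentiable_on_cong by metis

lemma smooth_on_subset: "smooth_on S f \<Longrightarrow> T \<subseteq> S \<Longrightarrow> smooth_on T f"
  unfolding smooth_on_def using times_differentiable_on_subset by metis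

lemma smooth_on_local:
  assumes "\<And>x. x \<in> S \<Longrightarrow> \<exists>U. open U \<and> x \<in> U \<and> smooth_on U f"
  shows "smooth_on S f"
  unfolding smooth_on_def
  using assms by (intro allI times_differentiable_on_local) (meson smooth_on_def)

lemma smooth_on_const: "smooth_on S (\<lambda>x. c)"
  by (simp add: smooth_on_def times_differentiable_on_const)

lemma smooth_on_linear_compose:
  "open S \<Longrightarrow> bounded_linear L \<Longrightarrow> smooth_on S f \<Longrightarrow> smooth_on S (\<lambda>x. L (f x))"
  by (simp add: smooth_on_def times_differentiable_on_bounded_linear_compose)

lemma smooth_on_ident: "smooth_on S (\<lambda>x. x)"
proof -
  have "times_differentiable_on n S (\<lambda>x::'a. x)" for n
    by (cases n) (auto simp: times_differentiable_on_const)
  then show ?thesis by (simp add: smooth_on_def)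
qed

lemma smooth_on_bounded_linear: "bounded_linear L \<Longrightarrow> smooth_on S L"
  using smooth_on_linear_compose[OF open_UNIV _ smooth_on_ident] smooth_on_subset by blast

lemma smooth_on_add: "open S \<Longrightarrow> smooth_on S f \<Longrightarrow> smooth_on S g \<Longrightarrow> smooth_on S (\<lambda>x. f x + g x)"
  by (simp add: smooth_on_def times_differentiable_on_add)

lemma smooth_on_bilinear:
  "open S \<Longrightarrow> bounded_bilinear h \<Longrightarrow> smooth_on S f \<Longrightarrow> smooth_on S g \<Longrightarrow> smooth_on S (\<lambda>x. h (f x) (g x))"
  by (simp add: smooth_on_def times_differentiable_on_bilinear)

lemmas smooth_on_mult = smooth_on_bilinear[OF _ bounded_bilinear_mult]
lemmas smooth_on_scaleR = smooth_on_bilinear[OF _ bounded_bilinear_scaleR]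

lemma smooth_on_uminus: "open S \<Longrightarrow> smooth_on S f \<Longrightarrow> smooth_on S (\<lambda>x. - f x)"
  by (rule smooth_on_linear_compose[of S uminus f]) (auto intro: bounded_linear_minus bounded_linear_ident)

lemma smooth_on_diff: "open S \<Longrightarrow> smooth_on S f \<Longrightarrow> smooth_on S g \<Longrightarrow> smooth_on S (\<lambda>x. f x - g x)"
  using smooth_on_add[of S f "\<lambda>x. - g x"] smooth_on_uminus by auto

lemma smooth_on_sum:
  "open S \<Longrightarrow> (\<And>i. i \<in> I \<Longrightarrow> smooth_on S (f i)) \<Longrightarrow> smooth_on S (\<lambda>x. \<Sum>i\<in>I. f i x)"
  by (simp add: smooth_on_def times_differentiable_on_sum)

lemma smooth_on_compose:
  fixes f :: "'a::real_normed_vector \<Rightarrow> 'b::real_inner" and g :: "'b \<Rightarrow> 'c::real_normed_vector"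
  assumes "findim TYPE('b)" "open X" "open Y" "smooth_on X f" "smooth_on Y g" "f ` X \<subseteq> Y"
  shows "smooth_on X (\<lambda>x. g (f x))"
  using assms by (simp add: smooth_on_def times_differentiable_on_compose)

lemma smooth_on_Pair:
  assumes "open S" "smooth_on S f" "smooth_on S g" shows "smooth_on S (\<lambda>x. (f x, g x))"
proof -
  have "smooth_on S (\<lambda>x. (f x, 0) + (0, g x))"
    by (intro smooth_on_add smooth_on_linear_compose[OF _ _ assms(2)] smooth_on_linear_compose[OF _ _ assms(3)]
      assms bounded_linear_Pair bounded_linear_ident bounded_linear_zero)
  then show ?thesis by simp
qed

lemma smooth_on_differentiable: "smooth_on S f \<Longrightarrow> x \<in> S \<Longrightarrow> f differentiable (at x)"
  unfolding smooth_on_def by (metis times_differentiable_on.simps(2))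

lemma smooth_on_has_derivative:
  "smooth_on S f \<Longrightarrow> x \<in> S \<Longrightarrow> (f has_derivative frechet_derivative f (at x)) (at x)"
  using smooth_on_differentiable frechet_derivative_works by blast

lemma smooth_on_frechet_derivative: "smooth_on S f \<Longrightarrow> smooth_on S (\<lambda>x. frechet_derivative f (at x) v)"
  unfolding smooth_on_def by (metis times_differentiable_on.simps(2))

lemma smooth_on_continuous: "smooth_on S f \<Longrightarrow> continuous_on S f"
  unfolding smooth_on_def by (metis times_differentiable_on.simps(1))

section \<open>Symmetry of second derivatives and bump functions\<close>

lemma has_real_derivative_along_line:
  assumes "f differentiable (at (p + t *\<^sub>R v))"
  shows "((\<lambda>t. f (p + t *\<^sub>R v)) has_real_derivative (frechet_derivative f (at (p + t *\<^sub>R v)) v)) (at t)"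
proof -
  have f: "(f has_derivative frechet_derivative f (at (p + t *\<^sub>R v))) (at (p + t *\<^sub>R v))"
    using assms frechet_derivative_works by blast
  have "((\<lambda>t. p + t *\<^sub>R v) has_derivative (\<lambda>h. h *\<^sub>R v)) (at t)"
    by (auto intro!: derivative_eq_intros)
  from has_derivative_compose[OF this f]
  have "((\<lambda>t. f (p + t *\<^sub>R v)) has_derivative (\<lambda>h. frechet_derivative f (at (p + t *\<^sub>R v)) (h *\<^sub>R v))) (at t)" .
  moreover have "frechet_derivative f (at (p + t *\<^sub>R v)) (h *\<^sub>R v) = frechet_derivative f (at (p + t *\<^sub>R v)) v * h" for h
    using linear_frechet_derivative[OF assms] by (simp add: linear_scale)
  ultimately show ?thesis by (simp add: has_field_derivative_def)
qed

text \<open>The mean value theorem twice over the parallelogram spanned by s v and s w: first along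
  v, for the difference of f between the two sides parallel to v, then along w for the directional
  derivative.\<close>

lemma mixed_second_difference:
  fixes f :: "'a::real_normed_vector \<Rightarrow> real"
  assumes "smooth_on S f" "0 < s"
    and S: "\<And>\<xi> \<eta>. \<lbrakk>0 \<le> \<xi>; \<xi> \<le> s; 0 \<le> \<eta>; \<eta> \<le> s\<rbrakk> \<Longrightarrow> x + \<xi> *\<^sub>R v + \<eta> *\<^sub>R w \<in> S"
  shows "\<exists>\<xi> \<eta>. 0 < \<xi> \<and> \<xi> < s \<and> 0 < \<eta> \<and> \<eta> < s \<and>
    f (x + s *\<^sub>R v + s *\<^sub>R w) - f (x + s *\<^sub>R v) - f (x + s *\<^sub>R w) + f x =
    s * (s * frechet_derivative (\<lambda>y. frechet_derivative f (at y) v) (at (x + \<xi> *\<^sub>R v + \<eta> *\<^sub>R w)) w)"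
proof -
  let ?g = "\<lambda>y. frechet_derivative f (at y) v"
  let ?\<phi> = "\<lambda>\<xi>. f (x + s *\<^sub>R w + \<xi> *\<^sub>R v) - f (x + \<xi> *\<^sub>R v)"
  have sw: "x + \<eta> *\<^sub>R w + \<xi> *\<^sub>R v = x + \<xi> *\<^sub>R v + \<eta> *\<^sub>R w" for \<xi> \<eta> by simp
  have d: "(?\<phi> has_real_derivative (?g (x + s *\<^sub>R w + \<xi> *\<^sub>R v) - ?g (x + \<xi> *\<^sub>R v))) (at \<xi>)"
    if "0 \<le> \<xi>" "\<xi> \<le> s" for \<xi>
    using S[OF that, of s] S[OF that, of 0] assms(2)
    by (intro DERIV_diff has_real_derivative_along_line smooth_on_differentiable[OF assms(1)])
       (auto simp: sw)
  obtain \<xi> where \<xi>: "0 < \<xi>" "\<xi> < s" "?\<phi> s - ?\<phi> 0 = (s - 0) * (?g (x + s *\<^sub>R w + \<xi> *\<^sub>R v) - ?g (x + \<xi> *\<^sub>R v))"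
    using MVT2[OF assms(2) d] by blast
  have d2: "((\<lambda>\<eta>. ?g (x + \<xi> *\<^sub>R v + \<eta> *\<^sub>R w)) has_real_derivative frechet_derivative ?g (at (x + \<xi> *\<^sub>R v + \<eta> *\<^sub>R w)) w) (at \<eta>)"
    if "0 \<le> \<eta>" "\<eta> \<le> s" for \<eta>
    using S[OF _ _ that, of \<xi>] \<xi>
    by (intro has_real_derivative_along_line smooth_on_differentiable[OF smooth_on_frechet_derivative[OF assms(1)]])
       auto
  obtain \<eta> where \<eta>: "0 < \<eta>" "\<eta> < s"
     "?g (x + \<xi> *\<^sub>R v + s *\<^sub>R w) - ?g (x + \<xi> *\<^sub>R v + 0 *\<^sub>R w) = (s - 0) * frechet_derivative ?g (at (x + \<xi> *\<^sub>R v + \<eta> *\<^sub>R w)) w"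
    using MVT2[OF assms(2) d2] by blast
  show ?thesis
    using \<xi> \<eta> by (intro exI[of _ \<xi>] exI[of _ \<eta>]) (simp add: sw add.commute[of "s *\<^sub>R w" ] algebra_simps)
qed

text \<open>Schwarz's theorem. The second difference is symmetric in v and w, so the two mixed
  derivatives take a common value at points arbitrarily close to x; their continuity at x does the
  rest.\<close>

lemma second_derivative_symmetric_real:
  fixes f :: "'a::real_normed_vector \<Rightarrow> real"
  assumes "smooth_on S f" "open S" "x \<in> S"
  shows "frechet_derivative (\<lambda>y. frechet_derivative f (at y) v) (at x) w =
         frechet_derivative (\<lambda>y. frechet_derivative f (at y) w) (at x) v"
proof -
  define A where "A = (\<lambda>v w x. frechet_derivative (\<lambda>y. frechet_derivative f (at y) v) (at x) w)"
  have cont: "isCont (A v w) x" for v w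
  proof -
    have "smooth_on S (A v w)" unfolding A_def by (intro smooth_on_frechet_derivative assms)
    then show ?thesis using assms smooth_on_continuous continuous_on_eq_continuous_at by blast
  qed
  have "\<bar>A v w x - A w v x\<bar> < 2 * e" if e: "e > 0" for e
  proof -
    obtain d0 where d0: "d0 > 0" "ball x d0 \<subseteq> S" by (rule openE[OF assms(2,3)])
    obtain d1 where d1: "d1 > 0" "\<And>y. dist y x < d1 \<Longrightarrow> \<bar>A v w y - A v w x\<bar> < e"
      using cont[of v w, unfolded continuous_at_eps_delta dist_real_def, rule_format, OF e] by blast
    obtain d2 where d2: "d2 > 0" "\<And>y. dist y x < d2 \<Longrightarrow> \<bar>A w v y - A w v x\<bar> < e"
      using cont[of w v, unfolded continuous_at_eps_delta dist_real_def, rule_format, OF e] by blast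
    define d where "d = min d0 (min d1 d2)"
    have d: "d > 0" using d0 d1 d2 by (simp add: d_def)
    \<comment> \<open>Keeps the whole parallelogram within distance d of x; the summand 1 makes the
      denominator positive when v = w = 0.\<close>
    define s where "s = (d / 2) / (norm v + norm w + 1)"
    have np: "0 < norm v + norm w + 1" by (simp add: add_nonneg_pos)
    have s: "s > 0" using d np unfolding s_def by (intro divide_pos_pos) auto
    have sN: "s * (norm v + norm w + 1) = d / 2"
      using np nonzero_eq_divide_eq[of "norm v + norm w + 1" s "d / 2"] unfolding s_def by linarith
    have close: "dist (x + \<xi> *\<^sub>R v + \<eta> *\<^sub>R w) x < d" if "0 \<le> \<xi>" "\<xi> \<le> s" "0 \<le> \<eta>" "\<eta> \<le> s" for \<xi> \<eta>
    proof -
      have "dist (x + \<xi> *\<^sub>R v + \<eta> *\<^sub>R w) x \<le> norm (\<xi> *\<^sub>R v) + norm (\<eta> *\<^sub>R w)"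
        by (simp add: dist_norm add.assoc norm_triangle_ineq del: norm_scaleR)
      also have "\<dots> \<le> s * norm v + s * norm w"
        using that by (auto intro!: add_mono mult_right_mono)
      also have "\<dots> < s * (norm v + norm w + 1)" using s by (simp add: algebra_simps)
      also note sN
      finally show ?thesis using d by simp
    qed
    have inS: "x + \<xi> *\<^sub>R v + \<eta> *\<^sub>R w \<in> S" if "0 \<le> \<xi>" "\<xi> \<le> s" "0 \<le> \<eta>" "\<eta> \<le> s" for \<xi> \<eta>
      using close[OF that] d0 by (auto simp: d_def dist_commute)
    have sw: "x + \<eta> *\<^sub>R w + \<xi> *\<^sub>R v = x + \<xi> *\<^sub>R v + \<eta> *\<^sub>R w" for \<xi> \<eta> by simp
    obtain \<xi> \<eta> where 1: "0 < \<xi>" "\<xi> < s" "0 < \<eta>" "\<eta> < s"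
     "f (x + s *\<^sub>R v + s *\<^sub>R w) - f (x + s *\<^sub>R v) - f (x + s *\<^sub>R w) + f x = s * (s * A v w (x + \<xi> *\<^sub>R v + \<eta> *\<^sub>R w))"
      using mixed_second_difference[OF assms(1) s inS] unfolding A_def by blast
    obtain \<xi>' \<eta>' where 2: "0 < \<xi>'" "\<xi>' < s" "0 < \<eta>'" "\<eta>' < s"
     "f (x + s *\<^sub>R w + s *\<^sub>R v) - f (x + s *\<^sub>R w) - f (x + s *\<^sub>R v) + f x = s * (s * A w v (x + \<xi>' *\<^sub>R w + \<eta>' *\<^sub>R v))"
      using mixed_second_difference[OF assms(1) s, of x w v] inS unfolding A_def by (metis sw)
    have "s * (s * A v w (x + \<xi> *\<^sub>R v + \<eta> *\<^sub>R w)) = s * (s * A w v (x + \<xi>' *\<^sub>R w + \<eta>' *\<^sub>R v))"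
      using 1(5) 2(5) unfolding sw[of s s] by linarith
    then have eq: "A v w (x + \<xi> *\<^sub>R v + \<eta> *\<^sub>R w) = A w v (x + \<eta>' *\<^sub>R v + \<xi>' *\<^sub>R w)"
      using s by (simp add: sw)
    have "\<bar>A v w (x + \<xi> *\<^sub>R v + \<eta> *\<^sub>R w) - A v w x\<bar> < e"
      using close[of \<xi> \<eta>] 1 d1(2) by (simp add: d_def)
    moreover have "\<bar>A w v (x + \<eta>' *\<^sub>R v + \<xi>' *\<^sub>R w) - A w v x\<bar> < e"
      using close[of \<eta>' \<xi>'] 2 d2(2) by (simp add: d_def)
    ultimately show ?thesis using eq by linarith
  qed
  from this[of "\<bar>A v w x - A w v x\<bar> / 2"] have "A v w x = A w v x" by (cases "A v w x = A w v x") auto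
  then show ?thesis by (simp add: A_def)
qed

text \<open>Reduces to the real-valued case by pairing with an arbitrary vector z, which commutes
  with differentiation.\<close>

lemma second_derivative_symmetric:
  fixes f :: "'a::real_normed_vector \<Rightarrow> 'b::real_inner"
  assumes "smooth_on S f" "open S" "x \<in> S"
  shows "frechet_derivative (\<lambda>y. frechet_derivative f (at y) v) (at x) w =
         frechet_derivative (\<lambda>y. frechet_derivative f (at y) w) (at x) v"
proof -
  have *: "frechet_derivative (\<lambda>y. g y \<bullet> z) (at y) v = frechet_derivative g (at y) v \<bullet> z"
    if "smooth_on S g" "y \<in> S" for g :: "'a \<Rightarrow> 'b" and y v z
    using bounded_linear.has_derivative[OF bounded_linear_inner_left smooth_on_has_derivative[OF that]]
    by (rule fun_cong[OF frechet_derivativeI])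
  have smz: "smooth_on S (\<lambda>y. f y \<bullet> z)" for z
    by (rule smooth_on_linear_compose[OF assms(2) bounded_linear_inner_left assms(1)])
  have sym: "frechet_derivative (\<lambda>y. frechet_derivative f (at y) v) (at x) w \<bullet> z =
    frechet_derivative (\<lambda>y. frechet_derivative (\<lambda>y. f y \<bullet> z) (at y) v) (at x) w" for z v w
  proof -
    have 1: "(\<lambda>y. frechet_derivative (\<lambda>y. f y \<bullet> z) (at y) v) differentiable (at x)"
      by (rule smooth_on_differentiable[OF smooth_on_frechet_derivative[OF smz] assms(3)])
    have "frechet_derivative (\<lambda>y. frechet_derivative (\<lambda>y. f y \<bullet> z) (at y) v) (at x) =
      frechet_derivative (\<lambda>y. frechet_derivative f (at y) v \<bullet> z) (at x)"
      by (rule frechet_derivative_transform_within_open[OF 1 assms(2,3)]) (rule *[OF assms(1)])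
    then show ?thesis using *[OF smooth_on_frechet_derivative[OF assms(1), of v] assms(3), of z w] by simp
  qed
  have "frechet_derivative (\<lambda>y. frechet_derivative f (at y) v) (at x) w \<bullet> z =
    frechet_derivative (\<lambda>y. frechet_derivative f (at y) w) (at x) v \<bullet> z" for z
    unfolding sym by (rule second_derivative_symmetric_real[OF smz assms(2,3)])
  then show ?thesis using vector_eq_rdot by blast
qed

section \<open>The flat function and bump functions\<close>

text \<open>The extra power of t makes the family closed under differentiation: the derivative of
  \<open>flat k\<close> is a combination of \<open>flat (k + 2)\<close> and
  \<open>flat (k + 1)\<close>. One induction on the order, with k arbitrary, then shows that all
  members are smooth.\<close>

definition flat :: "nat \<Rightarrow> real \<Rightarrow> real" where
  "flat k t = (if t \<le> 0 then 0 else exp (- (1 / t)) / t ^ k)"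

lemma flat_tendsto: "((\<lambda>t. flat k t) \<longlongrightarrow> 0) (at 0)"
proof -
  have "((\<lambda>t::real. (inverse t) ^ k / exp (inverse t)) \<longlongrightarrow> 0) (at_right 0)"
    by (rule filterlim_compose[OF tendsto_power_div_exp_0 filterlim_inverse_at_top_right])
  moreover have "eventually (\<lambda>t. (inverse t) ^ k / exp (inverse t) = flat k t) (at_right 0)"
    unfolding eventually_at_right_field
    by (intro exI[of _ 1]) (auto simp: flat_def exp_minus field_simps)
  ultimately have r: "((\<lambda>t. flat k t) \<longlongrightarrow> 0) (at_right 0)"
    by (rule Lim_transform_eventually)
  have "eventually (\<lambda>t. 0 = flat k t) (at_left 0)"
    unfolding eventually_at_left_field by (intro exI[of _ "-1"]) (auto simp: flat_def)
  then have l: "((\<lambda>t. flat k t) \<longlongrightarrow> 0) (at_left 0)"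
    using Lim_transform_eventually tendsto_const by blast
  from l r show ?thesis using filterlim_split_at by blast
qed

lemma flat_deriv: "(flat k has_real_derivative (flat (k + 2) t - k * flat (k + 1) t)) (at t)"
proof -
  consider "t < 0" | "t = 0" | "t > 0" by linarith
  then show ?thesis
  proof cases
    case 1
    have "((\<lambda>t. 0) has_real_derivative 0) (at t)" by simp
    then have "(flat k has_real_derivative 0) (at t)"
      by (rule has_field_derivative_transform_within_open[where S="{..<0}"]) (use 1 in \<open>auto simp: flat_def\<close>)
    then show ?thesis using 1 by (simp add: flat_def)
  next
    case 2
    \<comment> \<open>The difference quotient at 0 is \<open>flat (Suc k)\<close> itself, already
      known to tend to 0.\<close>
    have "((\<lambda>h. (flat k (0 + h) - flat k 0) / h) \<longlongrightarrow> 0) (at 0)"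
      by (rule Lim_transform_eventually[OF flat_tendsto[of "Suc k"]])
        (auto simp: flat_def eventually_at_filter)
    then show ?thesis using 2 by (simp add: DERIV_def flat_def)
  next
    case 3
    have "((\<lambda>t. exp (- (1 / t)) / t ^ k) has_real_derivative (flat (k + 2) t - k * flat (k + 1) t)) (at t)"
    proof (rule DERIV_cong)
      have "((\<lambda>t. exp (- (1 / t))) has_real_derivative exp (- (1 / t)) * (1 / t^2)) (at t)"
        using 3 by (auto intro!: derivative_eq_intros simp: power2_eq_square)
      then show "((\<lambda>t. exp (- (1 / t)) / t ^ k) has_real_derivative
        ((exp (- (1 / t)) * (1 / t^2)) * t ^ k - exp (- (1 / t)) * (real k * t ^ (k - Suc 0))) / (t ^ k * t ^ k)) (at t)"
        using 3 DERIV_pow[of k t] by (intro DERIV_divide) auto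
      have p: "real k * t ^ (k - Suc 0) = real k * t ^ k / t" using 3 by (cases k) auto
      show "((exp (- (1 / t)) * (1 / t^2)) * t ^ k - exp (- (1 / t)) * (real k * t ^ (k - Suc 0))) / (t ^ k * t ^ k)
        = flat (k + 2) t - real k * flat (k + 1) t"
        unfolding p using 3 by (simp add: flat_def field_simps power2_eq_square)
    qed
    then show ?thesis
      by (rule has_field_derivative_transform_within_open[where S="{0<..}"]) (use 3 in \<open>auto simp: flat_def\<close>)
  qed
qed

lemma smooth_on_flat: "smooth_on UNIV (flat k)"
proof -
  have "times_differentiable_on n UNIV (flat k)" for n
  proof (induction n arbitrary: k)
    case 0
    have "isCont (flat k) t" for t using flat_deriv by (rule DERIV_isCont)
    then show ?case by (simp add: continuous_at_imp_continuous_on)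
  next
    case (Suc n)
    have h: "(flat k has_derivative (\<lambda>v. (flat (k + 2) t - k * flat (k + 1) t) * v)) (at t)" for t
      using flat_deriv[of k t] by (simp add: has_field_derivative_def)
    have d: "frechet_derivative (flat k) (at t) v = flat (k + 2) t * v + flat (k + 1) t * (- real k * v)" for t v
      using frechet_derivativeI[OF h] by (simp add: algebra_simps)
    have "times_differentiable_on n UNIV (\<lambda>t. flat (k + 2) t * v + flat (k + 1) t * (- real k * v))" for v
      by (rule times_differentiable_on_add[OF open_UNIV];
          rule times_differentiable_on_bounded_linear_compose[OF open_UNIV bounded_linear_mult_left Suc.IH])
    then show ?case using h by (auto simp: d differentiable_def)
  qed
  then show ?thesis by (simp add: smooth_on_def)
qed

text \<open>Since \<open>flat 0 1 = 1 / e\<close>, composing \<open>flat 0\<close> with itself already clips at both ends; the usual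
  quotient is not needed.\<close>

definition smooth_step :: "real \<Rightarrow> real" where
  "smooth_step t = 1 - exp 1 * flat 0 (1 - exp 1 * flat 0 t)"

lemma smooth_step: "t \<le> 0 \<Longrightarrow> smooth_step t = 0" "1 \<le> t \<Longrightarrow> smooth_step t = 1"
proof -
  show "smooth_step t = 0" if "t \<le> 0" using that by (simp add: smooth_step_def flat_def flip: exp_add)
  assume t: "1 \<le> t"
  \<comment> \<open>The product equals exp (1 - 1 / t). Hence the argument of the outer
    \<open>flat\<close> is at most 0.\<close>
  have "exp 1 * flat 0 t \<ge> 1" using t by (simp add: flat_def flip: exp_add)
  then show "smooth_step t = 1" by (simp add: smooth_step_def flat_def)
qed

lemma smooth_on_smooth_step: "smooth_on UNIV smooth_step"
proof -
  have 1: "smooth_on UNIV (\<lambda>t. 1 - exp 1 * flat 0 t)"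
    by (intro smooth_on_diff smooth_on_const smooth_on_mult smooth_on_flat) auto
  then have "smooth_on UNIV (\<lambda>t. flat 0 (1 - exp 1 * flat 0 t))"
    by (intro smooth_on_compose[OF findim_euclidean _ _ 1 smooth_on_flat]) auto
  then have "smooth_on UNIV (\<lambda>t. 1 - exp 1 * flat 0 (1 - exp 1 * flat 0 t))"
    by (intro smooth_on_diff smooth_on_const smooth_on_mult) auto
  then show ?thesis by (simp add: smooth_step_def[abs_def])
qed

lemma smooth_bump_exists:
  fixes a :: "'a::real_inner"
  assumes "0 < r"
  obtains h :: "'a \<Rightarrow> real" where "smooth_on UNIV h" "\<And>x. x \<in> ball a r \<Longrightarrow> h x = 1"
    "\<And>x. x \<notin> cball a (2 * r) \<Longrightarrow> h x = 0"
proof -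
  \<comment> \<open>Interpolates in the squared norm, which is smooth also at a: q is 1 at distance
    r and 0 at distance 2 r, the two thresholds of \<open>smooth_step\<close>.\<close>
  define q where "q = (\<lambda>x. (4 * r^2 - (x - a) \<bullet> (x - a)) * (1 / (3 * r^2)))"
  have q: "smooth_on UNIV q" unfolding q_def
    by (intro smooth_on_mult smooth_on_diff smooth_on_const smooth_on_bilinear[OF _ bounded_bilinear_inner] smooth_on_ident open_UNIV)
  have "smooth_on UNIV (\<lambda>x. smooth_step (q x))"
    by (rule smooth_on_compose[OF findim_euclidean _ _ q smooth_on_smooth_step]) auto
  moreover have "smooth_step (q x) = 1" if "x \<in> ball a r" for x
  proof -
    have "(norm (x - a))\<^sup>2 \<le> r\<^sup>2" using that by (intro power_mono) (auto simp: dist_norm norm_minus_commute)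
    then show ?thesis using assms by (intro smooth_step) (simp add: q_def power2_norm_eq_inner field_simps)
  qed
  moreover have "smooth_step (q x) = 0" if "x \<notin> cball a (2 * r)" for x
  proof -
    have "(2 * r)\<^sup>2 \<le> (norm (x - a))\<^sup>2" using that assms by (intro power_mono) (auto simp: dist_norm norm_minus_commute)
    then have "4 * r^2 - (x - a) \<bullet> (x - a) \<le> 0" by (simp add: power2_norm_eq_inner)
    then show ?thesis using assms by (intro smooth_step) (simp add: q_def mult_le_0_iff divide_le_0_iff)
  qed
  ultimately show ?thesis using that by blast
qed

section \<open>Parameter integrals\<close>

lemma onorm_le_basis:
  fixes L :: "'a::real_inner \<Rightarrow> real"
  assumes "onb E" "linear L" "\<And>e. e \<in> E \<Longrightarrow> \<bar>L e\<bar> \<le> B" "0 \<le> B"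
  shows "onorm L \<le> (\<Sum>e\<in>E. norm e) * B"
proof (rule onorm_bound)
  show "0 \<le> (\<Sum>e\<in>E. norm e) * B" by (rule mult_nonneg_nonneg[OF sum_nonneg assms(4)]) simp
  fix x
  have "norm (L x) = \<bar>\<Sum>e\<in>E. (x \<bullet> e) * L e\<bar>" using linear_onb[OF assms(1,2), of x] by simp
  also have "\<dots> \<le> (\<Sum>e\<in>E. \<bar>(x \<bullet> e) * L e\<bar>)" by (rule sum_abs)
  also have "\<dots> \<le> (\<Sum>e\<in>E. (norm x * norm e) * B)"
  proof (rule sum_mono)
    fix e assume "e \<in> E"
    then show "\<bar>(x \<bullet> e) * L e\<bar> \<le> (norm x * norm e) * B"
      unfolding abs_mult using assms(3) by (rule_tac mult_mono[OF Cauchy_Schwarz_ineq2]) auto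
  qed
  also have "\<dots> = (\<Sum>e\<in>E. norm e) * B * norm x" by (simp add: sum_distrib_left sum_distrib_right ac_simps)
  finally show "norm (L x) \<le> (\<Sum>e\<in>E. norm e) * B * norm x" .
qed

text \<open>Differentiation under the integral sign. The open set W makes f differentiable also at
  the end points s = 0 and s = 1. By compactness of [0,1] the derivative in x varies little,
  uniformly in s, for each of finitely many basis vectors; this bounds the operator norm and feeds
  the mean value inequality for the remainder.\<close>

lemma has_derivative_integral_param:
  fixes f :: "'a::real_inner \<times> real \<Rightarrow> real"
  assumes fin: "findim TYPE('a)" and "open W" "open X" and XW: "X \<times> {0..1} \<subseteq> W"
    and df: "\<And>z. z \<in> W \<Longrightarrow> f differentiable (at z)"
    and cont: "\<And>v. continuous_on W (\<lambda>z. frechet_derivative f (at z) v)" and x: "x \<in> X"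
  shows "((\<lambda>x. integral {0..1} (\<lambda>s. f (x, s))) has_derivative
          (\<lambda>h. integral {0..1} (\<lambda>s. frechet_derivative f (at (x, s)) (h, 0)))) (at x)"
proof -
  obtain E :: "'a set" where E: "onb E" using onb_exists[OF fin] .
  have fE: "finite E" using E by (simp add: onb_def)
  have lin: "linear (frechet_derivative f (at z))" if "z \<in> W" for z
    using df[OF that] by (rule linear_frechet_derivative)
  have contf: "continuous_on W f"
    using df continuous_at_imp_continuous_on differentiable_imp_continuous_within by blast
  have cs: "continuous_on {0..1} (\<lambda>s. (y, s::real))" for y :: 'a by (intro continuous_intros)
  have If: "(\<lambda>s. f (y, s)) integrable_on {0..1}" if "y \<in> X" for y
    using XW that by (intro integrable_continuous_interval continuous_on_compose2[OF contf cs]) auto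
  have ID: "(\<lambda>s. frechet_derivative f (at (x, s)) v) integrable_on {0..1}" for v
    using XW x by (intro integrable_continuous_interval continuous_on_compose2[OF cont cs]) auto
  have xs: "(x, s) \<in> W" if "s \<in> {0..1}" for s using XW x that by auto
  have linL: "linear (\<lambda>h. integral {0..1} (\<lambda>s. frechet_derivative f (at (x, s)) (h, 0)))"
  proof (rule linearI)
    fix h k :: 'a and c :: real
    have "integral {0..1} (\<lambda>s. frechet_derivative f (at (x, s)) (h + k, 0)) =
      integral {0..1} (\<lambda>s. frechet_derivative f (at (x, s)) (h, 0) + frechet_derivative f (at (x, s)) (k, 0))"
      by (rule integral_cong) (use linear_add[OF lin[OF xs], of _ "(h,0)" "(k,0)"] in simp)
    then show "integral {0..1} (\<lambda>s. frechet_derivative f (at (x, s)) (h + k, 0)) =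
      integral {0..1} (\<lambda>s. frechet_derivative f (at (x, s)) (h, 0)) + integral {0..1} (\<lambda>s. frechet_derivative f (at (x, s)) (k, 0))"
      by (simp add: integral_add[OF ID ID])
    have "integral {0..1} (\<lambda>s. frechet_derivative f (at (x, s)) (c *\<^sub>R h, 0)) =
      integral {0..1} (\<lambda>s. c *\<^sub>R frechet_derivative f (at (x, s)) (h, 0))"
      by (rule integral_cong) (use linear_scale[OF lin[OF xs], of _ c "(h,0)"] in simp)
    then show "integral {0..1} (\<lambda>s. frechet_derivative f (at (x, s)) (c *\<^sub>R h, 0)) =
      c *\<^sub>R integral {0..1} (\<lambda>s. frechet_derivative f (at (x, s)) (h, 0))" by simp
  qed
  show ?thesis unfolding has_derivative_at_alt
  proof (intro conjI allI impI linear_bounded_findim[OF fin linL])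
    fix \<epsilon> :: real assume \<epsilon>: "0 < \<epsilon>"
    \<comment> \<open>Bounds the sum of the norms in \<open>onorm_le_basis\<close>; the summand 1
      keeps N positive for an empty basis.\<close>
    define N where "N = (\<Sum>e\<in>E. norm e) + 1"
    have N: "N > 0" by (simp add: N_def sum_nonneg add_nonneg_pos)
    have "\<exists>\<delta>>0. ball x \<delta> \<subseteq> X \<and> (\<forall>y\<in>ball x \<delta>. \<forall>s\<in>{0..1}.
        \<bar>frechet_derivative f (at (y, s)) (e, 0) - frechet_derivative f (at (x, s)) (e, 0)\<bar> \<le> \<epsilon> / N)" for e :: 'a
    proof -
      have c: "continuous_on (X \<times> {0..1}) (\<lambda>(y, s). frechet_derivative f (at (y, s)) (e, 0))"
        using continuous_on_subset[OF cont XW, of "(e,0)"] by (simp add: case_prod_beta')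
      obtain X0 where X0: "x \<in> X0" "open X0"
        "\<And>y s. y \<in> X0 \<inter> X \<Longrightarrow> s \<in> {0..1} \<Longrightarrow> dist (frechet_derivative f (at (y, s)) (e, 0)) (frechet_derivative f (at (x, s)) (e, 0)) \<le> \<epsilon> / N"
        by (rule continuous_on_prod_compactE[OF c compact_Icc x, of "\<epsilon> / N"]) (use \<epsilon> N in auto)
      obtain \<delta> where \<delta>: "\<delta> > 0" "ball x \<delta> \<subseteq> X0 \<inter> X" by (rule openE[of "X0 \<inter> X" x]) (use X0 x assms(3) in auto)
      then show ?thesis using X0(3)[unfolded dist_real_def] by (intro exI[of _ \<delta>]) blast
    qed
    then obtain \<delta> where \<delta>: "\<And>e::'a. \<delta> e > 0" "\<And>e. ball x (\<delta> e) \<subseteq> X"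
      "\<And>e y s. y \<in> ball x (\<delta> e) \<Longrightarrow> s \<in> {0..1} \<Longrightarrow> \<bar>frechet_derivative f (at (y, s)) (e, 0) - frechet_derivative f (at (x, s)) (e, 0)\<bar> \<le> \<epsilon> / N"
      by metis
    \<comment> \<open>Inserting 0 keeps the set nonempty when the space is trivial, and
      \<open>\<delta> 0\<close> supplies the inclusion of the ball in X.\<close>
    define d where "d = Min (\<delta> ` insert 0 E)"
    have d: "d > 0" "\<And>e. e \<in> E \<Longrightarrow> d \<le> \<delta> e" "d \<le> \<delta> 0" using \<delta>(1) fE by (auto simp: d_def)
    have dX: "ball x d \<subseteq> X" using \<delta>(2)[of 0] d by (meson order_trans subset_ball)
    show "\<exists>d>0. \<forall>y. norm (y - x) < d \<longrightarrow>
       norm (integral {0..1} (\<lambda>s. f (y, s)) - integral {0..1} (\<lambda>s. f (x, s)) -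
         integral {0..1} (\<lambda>s. frechet_derivative f (at (x, s)) (y - x, 0))) \<le> \<epsilon> * norm (y - x)"
    proof (intro exI[of _ d] conjI allI impI d)
      fix y assume "norm (y - x) < d"
      then have y: "y \<in> ball x d" by (simp add: dist_norm norm_minus_commute)
      have pt: "norm (f (y, s) - f (x, s) - frechet_derivative f (at (x, s)) (y - x, 0)) \<le> \<epsilon> * norm (y - x)"
        if s: "s \<in> {0..1}" for s
      proof -
        have zW: "(z, s) \<in> W" if "z \<in> ball x d" for z using that s dX XW by (meson SigmaI subsetD)
        have "((\<lambda>z. f (z, s)) has_derivative (\<lambda>h. frechet_derivative f (at (z, s)) (h, 0))) (at z within ball x d)"
          if "z \<in> ball x d" for z
        proof (rule has_derivative_at_withinI)
          have "((\<lambda>z. (z, s)) has_derivative (\<lambda>h. (h, 0))) (at z)"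
            by (auto intro!: derivative_eq_intros)
          from has_derivative_compose[OF this]
          show "((\<lambda>z. f (z, s)) has_derivative (\<lambda>h. frechet_derivative f (at (z, s)) (h, 0))) (at z)"
            using df[OF zW[OF that]] frechet_derivative_works by blast
        qed
        moreover have "onorm ((\<lambda>h. frechet_derivative f (at (z, s)) (h, 0)) - (\<lambda>h. frechet_derivative f (at (x, s)) (h, 0))) \<le> \<epsilon>"
          if z: "z \<in> ball x d" for z
        proof -
          have l: "linear (\<lambda>h. frechet_derivative f (at (z, s)) (h, 0))" if "z \<in> ball x d" for z
            using linear_compose[OF _ lin[OF zW[OF that]], of "\<lambda>h. (h, 0)"]
            by (simp add: o_def linear_iff)
          have "onorm ((\<lambda>h. frechet_derivative f (at (z, s)) (h, 0)) - (\<lambda>h. frechet_derivative f (at (x, s)) (h, 0)))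
            \<le> (\<Sum>e\<in>E. norm e) * (\<epsilon> / N)"
          proof (rule onorm_le_basis[OF E])
            show "0 \<le> \<epsilon> / N" using \<epsilon> N by simp
            show "linear ((\<lambda>h. frechet_derivative f (at (z, s)) (h, 0)) - (\<lambda>h. frechet_derivative f (at (x, s)) (h, 0)))"
              using linear_compose_sub[OF l[OF z] l[of x]] d by (simp add: fun_diff_def)
            fix e assume "e \<in> E"
            then have "z \<in> ball x (\<delta> e)" using z d(2)[of e] by auto
            then show "\<bar>((\<lambda>h. frechet_derivative f (at (z, s)) (h, 0)) - (\<lambda>h. frechet_derivative f (at (x, s)) (h, 0))) e\<bar> \<le> \<epsilon> / N"
              using \<delta>(3)[of z e s] s by simp
          qed
          also have "\<dots> \<le> N * (\<epsilon> / N)" using \<epsilon> N by (intro mult_right_mono) (auto simp: N_def)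
          finally show ?thesis using N by simp
        qed
        moreover have "x + t *\<^sub>R (y - x) \<in> ball x d" if "t \<in> {0..1}" for t
        proof -
          have "norm (t *\<^sub>R (y - x)) \<le> 1 * norm (y - x)" unfolding norm_scaleR using that by (intro mult_right_mono) auto
          then show ?thesis using y by (simp add: dist_norm norm_minus_commute)
        qed
        ultimately show ?thesis
          using differentiable_bound_linearization[of x y "ball x d" "\<lambda>z. f (z, s)" "\<lambda>z h. frechet_derivative f (at (z, s)) (h, 0)" x \<epsilon>] d
          by (simp add: mult.commute)
      qed
      have i: "(\<lambda>s. f (y, s) - f (x, s) - frechet_derivative f (at (x, s)) (y - x, 0)) integrable_on {0..1}"
        using y dX x by (intro integrable_diff If ID) auto
      have "integral {0..1} (\<lambda>s. f (y, s)) - integral {0..1} (\<lambda>s. f (x, s)) -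
         integral {0..1} (\<lambda>s. frechet_derivative f (at (x, s)) (y - x, 0)) =
         integral {0..1} (\<lambda>s. f (y, s) - f (x, s) - frechet_derivative f (at (x, s)) (y - x, 0))"
        using y dX x by (simp add: integral_diff If ID integrable_diff subset_iff)
      also have "norm \<dots> \<le> integral {0..1} (\<lambda>s::real. \<epsilon> * norm (y - x))"
        by (intro integral_norm_bound_integral i) (use pt in auto)
      finally show "norm (integral {0..1} (\<lambda>s. f (y, s)) - integral {0..1} (\<lambda>s. f (x, s)) -
         integral {0..1} (\<lambda>s. frechet_derivative f (at (x, s)) (y - x, 0))) \<le> \<epsilon> * norm (y - x)" by simp
    qed
  qed
qed

text \<open>Each directional derivative is again a parameter integral of a smooth function, so the
  induction on the order runs over all f at once.\<close>

lemma smooth_on_integral_param: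
  fixes f :: "'a::real_inner \<times> real \<Rightarrow> real"
  assumes fin: "findim TYPE('a)" and "open W" "open X" "X \<times> {0..1} \<subseteq> W" "smooth_on W f"
  shows "smooth_on X (\<lambda>x. integral {0..1} (\<lambda>s. f (x, s)))"
proof -
  have "times_differentiable_on n X (\<lambda>x. integral {0..1} (\<lambda>s. f (x, s)))" if "smooth_on W f" for n and f :: "'a \<times> real \<Rightarrow> real"
    using that
  proof (induction n arbitrary: f)
    case 0
    have "continuous_on (X \<times> cbox 0 1) (\<lambda>(x, s). f (x, s))"
      using continuous_on_subset[OF smooth_on_continuous[OF 0] assms(4)] by (simp add: case_prod_beta')
    from integral_continuous_on_param[OF this] show ?case by simp
  next
    case (Suc n)
    have d: "((\<lambda>x. integral {0..1} (\<lambda>s. f (x, s))) has_derivative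
          (\<lambda>h. integral {0..1} (\<lambda>s. frechet_derivative f (at (x, s)) (h, 0)))) (at x)" if "x \<in> X" for x
      by (rule has_derivative_integral_param[OF fin assms(2-4) _ _ that])
         (auto intro: smooth_on_differentiable[OF Suc.prems] smooth_on_continuous smooth_on_frechet_derivative[OF Suc.prems])
    have "times_differentiable_on n X (\<lambda>x. integral {0..1} (\<lambda>s. frechet_derivative f (at (x, s)) (v, 0)))" for v
      using Suc.IH[of "\<lambda>z. frechet_derivative f (at z) (v, 0)"] smooth_on_frechet_derivative[OF Suc.prems] by simp
    then have "times_differentiable_on n X (\<lambda>x. frechet_derivative (\<lambda>x. integral {0..1} (\<lambda>s. f (x, s))) (at x) v)" for v
      by (rule times_differentiable_on_cong[OF assms(3), rotated]) (simp add: frechet_derivativeI[OF d])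
    then show ?case using d by (auto simp: differentiable_def)
  qed
  then show ?thesis using assms(5) by (simp add: smooth_on_def[of X])
qed

section \<open>Pullback of forms along parametrizations\<close>

abbreviation fd :: "('a::real_normed_vector \<Rightarrow> 'b::real_normed_vector) \<Rightarrow> 'a \<Rightarrow> 'a \<Rightarrow> 'b" where
  "fd f x \<equiv> frechet_derivative f (at x)"

lemma frechet_derivative_cong_open:
  assumes "open S" "x \<in> S" "\<And>y. y \<in> S \<Longrightarrow> f y = g y"
  shows "fd f x = fd g x"
proof -
  have "(f has_derivative D) (at x) \<longleftrightarrow> (g has_derivative D) (at x)" for D
    using assms has_derivative_transform_within_open[of f D x UNIV S g]
      has_derivative_transform_within_open[of g D x UNIV S f] by auto
  then show ?thesis by (simp add: frechet_derivative_def)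
qed

text \<open>L is known to be differentiable only with its vector argument held fixed. Expanding the
  vector in an orthonormal basis gives a finite sum of products and reduces the claim to the
  ordinary product rule.\<close>

lemma has_derivative_linear_param:
  fixes L :: "'a::real_normed_vector \<Rightarrow> 'g::real_inner \<Rightarrow> real"
  assumes fin: "findim TYPE('g)" and lin: "\<And>z. z \<in> Z \<Longrightarrow> linear (L z)" and "open Z" "f x \<in> Z"
    and L: "\<And>a. (\<lambda>z. L z a) differentiable (at (f x))"
    and f: "(f has_derivative f') (at x)" and a: "(a has_derivative a') (at x)"
  shows "((\<lambda>y. L (f y) (a y)) has_derivative (\<lambda>u. fd (\<lambda>z. L z (a x)) (f x) (f' u) + L (f x) (a' u))) (at x)"
proof -
  obtain E :: "'g set" where E: "onb E" using onb_exists[OF fin] .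
  have LE: "L z b = (\<Sum>e\<in>E. (b \<bullet> e) * L z e)" if "z \<in> Z" for z b
    using linear_onb[OF E lin[OF that], of b] by simp
  have LD: "((\<lambda>z. L z b) has_derivative fd (\<lambda>z. L z b) (f x)) (at (f x))" for b
    using L frechet_derivative_works by blast
  have fda: "fd (\<lambda>z. L z b) (f x) = (\<lambda>h. \<Sum>e\<in>E. (b \<bullet> e) * fd (\<lambda>z. L z e) (f x) h)" for b
  proof (rule frechet_derivativeI)
    have "((\<lambda>z. \<Sum>e\<in>E. (b \<bullet> e) * L z e) has_derivative (\<lambda>h. \<Sum>e\<in>E. (b \<bullet> e) * fd (\<lambda>z. L z e) (f x) h)) (at (f x))"
      by (intro has_derivative_sum has_derivative_mult_right LD)
    then show "((\<lambda>z. L z b) has_derivative (\<lambda>h. \<Sum>e\<in>E. (b \<bullet> e) * fd (\<lambda>z. L z e) (f x) h)) (at (f x))"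
      by (rule has_derivative_transform_within_open[OF _ assms(3,4)]) (rule LE[symmetric])
  qed
  have "isCont f x" using f has_derivative_continuous by blast
  then obtain S where S: "open S" "x \<in> S" "\<And>y. y \<in> S \<Longrightarrow> f y \<in> Z"
    using assms(3,4) by (metis continuous_at_open)
  have "((\<lambda>y. \<Sum>e\<in>E. (a y \<bullet> e) * L (f y) e) has_derivative
      (\<lambda>u. \<Sum>e\<in>E. (a x \<bullet> e) * fd (\<lambda>z. L z e) (f x) (f' u) + (a' u \<bullet> e) * L (f x) e)) (at x)"
    by (intro has_derivative_sum has_derivative_mult has_derivative_compose[OF f LD]
       bounded_linear.has_derivative[OF bounded_linear_inner_left a])
  moreover have "(\<Sum>e\<in>E. (a x \<bullet> e) * fd (\<lambda>z. L z e) (f x) (f' u) + (a' u \<bullet> e) * L (f x) e) =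
     fd (\<lambda>z. L z (a x)) (f x) (f' u) + L (f x) (a' u)" for u
    unfolding fda[of "a x"] sum.distrib LE[OF assms(4), of "a' u"] ..
  ultimately have "((\<lambda>y. \<Sum>e\<in>E. (a y \<bullet> e) * L (f y) e) has_derivative
      (\<lambda>u. fd (\<lambda>z. L z (a x)) (f x) (f' u) + L (f x) (a' u))) (at x)" by simp
  then show ?thesis
    by (rule has_derivative_transform_within_open[OF _ S(1,2)]) (rule LE[OF S(3), symmetric])
qed

text \<open>The linear case twice: once b is absorbed into the parameter, the expression is linear
  in a over the moving point (f y, b y).\<close>

lemma has_derivative_bilinear_param:
  fixes W :: "'a::real_normed_vector \<Rightarrow> 'g::real_inner \<Rightarrow> 'g \<Rightarrow> real"
  assumes fin: "findim TYPE('g)" and lin: "\<And>z. z \<in> Z \<Longrightarrow> bilinear (W z)" and "open Z" "f x \<in> Z"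
    and W: "\<And>a b. (\<lambda>z. W z a b) differentiable (at (f x))"
    and f: "(f has_derivative f') (at x)" and a: "(a has_derivative a') (at x)" and b: "(b has_derivative b') (at x)"
  shows "((\<lambda>y. W (f y) (a y) (b y)) has_derivative
    (\<lambda>u. fd (\<lambda>z. W z (a x) (b x)) (f x) (f' u) + W (f x) (a' u) (b x) + W (f x) (a x) (b' u))) (at x)"
proof -
  have l: "linear (\<lambda>a. W z a c)" "linear (W z c)" if "z \<in> Z" for z c
    using lin[OF that] by (auto simp: bilinear_def)
  have WD: "((\<lambda>p. W (fst p) c (snd p)) has_derivative (\<lambda>u. fd (\<lambda>z. W z c (b x)) (f x) (fst u) + W (f x) c (snd u))) (at (f x, b x))" for c
    using has_derivative_linear_param[OF fin, of Z "\<lambda>z. W z c" fst "(f x, b x)" fst snd snd] l(2) assms(3,4) W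
    by (simp add: bounded_linear_imp_has_derivative bounded_linear_fst bounded_linear_snd)
  have "((\<lambda>y. W (fst (f y, b y)) (a y) (snd (f y, b y))) has_derivative (\<lambda>u. fd (\<lambda>z. W (fst z) (a x) (snd z)) (f x, b x) (f' u, b' u)
     + W (fst (f x, b x)) (a' u) (snd (f x, b x)))) (at x)"
    by (rule has_derivative_linear_param[OF fin, of "Z \<times> UNIV" "\<lambda>p a. W (fst p) a (snd p)" "\<lambda>y. (f y, b y)" x "\<lambda>u. (f' u, b' u)"])
       (use l(1) assms(3,4) WD f b a in \<open>auto simp: open_Times differentiable_def has_derivative_Pair\<close>)
  then show ?thesis unfolding frechet_derivativeI[OF WD] by (simp add: algebra_simps)
qed

lemma smooth_on_linear_param:
  fixes L :: "'a::real_inner \<Rightarrow> 'g::real_inner \<Rightarrow> real"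
  assumes fin: "findim TYPE('g)" "findim TYPE('a)" and lin: "\<And>z. z \<in> Z \<Longrightarrow> linear (L z)" and "open Z" "open X"
    and L: "\<And>a. smooth_on Z (\<lambda>z. L z a)" and f: "smooth_on X f" "f ` X \<subseteq> Z" and a: "smooth_on X a"
  shows "smooth_on X (\<lambda>x. L (f x) (a x))"
proof -
  obtain E :: "'g set" where E: "onb E" using onb_exists[OF fin(1)] .
  have "smooth_on X (\<lambda>x. \<Sum>e\<in>E. (a x \<bullet> e) * L (f x) e)"
    by (intro smooth_on_sum smooth_on_mult smooth_on_compose[OF fin(2) assms(5,4) f(1) L f(2)]
       smooth_on_linear_compose[OF _ bounded_linear_inner_left a] assms(5))
  then show ?thesis
    by (rule smooth_on_cong[OF assms(5)]) (use linear_onb[OF E lin] f(2) in \<open>auto simp: image_subset_iff\<close>)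
qed

lemma smooth_on_bilinear_param:
  fixes W :: "'a::real_inner \<Rightarrow> 'g::real_inner \<Rightarrow> 'g \<Rightarrow> real"
  assumes fin: "findim TYPE('g)" "findim TYPE('a)" and lin: "\<And>z. z \<in> Z \<Longrightarrow> bilinear (W z)" and op: "open Z" "open X"
    and W: "\<And>a b. smooth_on Z (\<lambda>z. W z a b)" and f: "smooth_on X f" "f ` X \<subseteq> Z" and ab: "smooth_on X a" "smooth_on X b"
  shows "smooth_on X (\<lambda>x. W (f x) (a x) (b x))"
proof -
  have l: "linear (\<lambda>a. W z a c)" "linear (W z c)" if "z \<in> Z" for z c
    using lin[OF that] by (auto simp: bilinear_def)
  have "smooth_on X (\<lambda>x. W (f x) c (b x))" for c
    by (rule smooth_on_linear_param[OF fin l(2) op W f ab(2)])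
  then show ?thesis
  proof -
    obtain E :: "'g set" where E: "onb E" using onb_exists[OF fin(1)] .
    assume s: "\<And>c. smooth_on X (\<lambda>x. W (f x) c (b x))"
    have "smooth_on X (\<lambda>x. \<Sum>e\<in>E. (a x \<bullet> e) * W (f x) e (b x))"
      by (intro smooth_on_sum smooth_on_mult s smooth_on_linear_compose[OF _ bounded_linear_inner_left ab(1)] op)
    then show ?thesis
      by (rule smooth_on_cong[OF op(2)])
        (use linear_onb[OF E l(1)] f(2) in \<open>auto simp: image_subset_iff\<close>)
  qed
qed

lemma pullback_derivative1:
  fixes \<alpha> :: "'g::real_inner \<Rightarrow> 'g \<Rightarrow> real" and f :: "'a::real_inner \<Rightarrow> 'g"
  assumes fin: "findim TYPE('g)" and lin: "\<And>z. z \<in> Z \<Longrightarrow> linear (\<alpha> z)" and op: "open Z" "open X"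
    and W: "\<And>a. smooth_on Z (\<lambda>z. \<alpha> z a)" and f: "smooth_on X f" "f ` X \<subseteq> Z" and x: "x \<in> X"
  shows "fd (\<lambda>y. \<alpha> (f y) (fd f y v)) x u = fd (\<lambda>z. \<alpha> z (fd f x v)) (f x) (fd f x u) + \<alpha> (f x) (fd (\<lambda>y. fd f y v) x u)"
proof -
  have fx: "f x \<in> Z" using f x by auto
  show ?thesis
    by (rule fun_cong[OF frechet_derivativeI], rule has_derivative_linear_param[where Z = Z and L = \<alpha> and f = f and x = x])
      (auto intro: fin lin op fx smooth_on_differentiable[OF W fx] smooth_on_has_derivative[OF f(1) x]
        smooth_on_has_derivative[OF smooth_on_frechet_derivative[OF f(1)] x])
qed

lemma pullback_derivative2:
  fixes W :: "'g::real_inner \<Rightarrow> 'g \<Rightarrow> 'g \<Rightarrow> real" and f :: "'a::real_inner \<Rightarrow> 'g"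
  assumes fin: "findim TYPE('g)" and lin: "\<And>z. z \<in> Z \<Longrightarrow> bilinear (W z)" and op: "open Z" "open X"
    and W: "\<And>a b. smooth_on Z (\<lambda>z. W z a b)" and f: "smooth_on X f" "f ` X \<subseteq> Z" and x: "x \<in> X"
  shows "fd (\<lambda>y. W (f y) (fd f y v) (fd f y w)) x u = fd (\<lambda>z. W z (fd f x v) (fd f x w)) (f x) (fd f x u)
    + W (f x) (fd (\<lambda>y. fd f y v) x u) (fd f x w) + W (f x) (fd f x v) (fd (\<lambda>y. fd f y w) x u)"
proof -
  have fx: "f x \<in> Z" using f x by auto
  show ?thesis
    by (rule fun_cong[OF frechet_derivativeI], rule has_derivative_bilinear_param[where Z = Z and W = W and f = f and x = x])
      (auto intro: fin lin op fx smooth_on_differentiable[OF W fx] smooth_on_has_derivative[OF f(1) x]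
        smooth_on_has_derivative[OF smooth_on_frechet_derivative[OF f(1)] x])
qed

text \<open>The terms with second derivatives of f cancel by symmetry. What is left is naturality of
  d on one-forms, in coordinates.\<close>

lemma pullback_ext_d1:
  fixes \<alpha> :: "'g::real_inner \<Rightarrow> 'g \<Rightarrow> real" and f :: "'a::real_inner \<Rightarrow> 'g"
  assumes "findim TYPE('g)" "\<And>z. z \<in> Z \<Longrightarrow> linear (\<alpha> z)" "open Z" "open X"
    "\<And>a. smooth_on Z (\<lambda>z. \<alpha> z a)" "smooth_on X f" "f ` X \<subseteq> Z" "x \<in> X"
  shows "fd (\<lambda>y. \<alpha> (f y) (fd f y w)) x v - fd (\<lambda>y. \<alpha> (f y) (fd f y v)) x w =
    fd (\<lambda>z. \<alpha> z (fd f x w)) (f x) (fd f x v) - fd (\<lambda>z. \<alpha> z (fd f x v)) (f x) (fd f x w)"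
  using second_derivative_symmetric[OF assms(6,4,8), of v w]
  by (simp add: pullback_derivative1[where \<alpha> = \<alpha> and f = f and Z = Z, OF assms])

lemma bilinear_alternating_skew:
  assumes "bilinear h" "\<And>v. h v v = (0::real)" shows "h v w = - h w v"
proof -
  have "h (v + w) (v + w) = h v v + h v w + (h w v + h w w)"
    using assms(1) by (simp add: bilinear_ladd bilinear_radd)
  then show ?thesis using assms(2) by simp
qed

text \<open>Six terms contain a second derivative of f. Four cancel by its symmetry alone, the other
  two by symmetry together with skewness of W; naturality of d on two-forms is what is left.\<close>

lemma pullback_ext_d2:
  fixes W :: "'g::real_inner \<Rightarrow> 'g \<Rightarrow> 'g \<Rightarrow> real" and f :: "'a::real_inner \<Rightarrow> 'g"
  assumes "findim TYPE('g)" and lin: "\<And>z. z \<in> Z \<Longrightarrow> bilinear (W z)" and "open Z" "open X"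
    "\<And>a b. smooth_on Z (\<lambda>z. W z a b)" "smooth_on X f" "f ` X \<subseteq> Z" "x \<in> X"
    and alt: "\<And>z v. z \<in> Z \<Longrightarrow> W z v v = 0"
  defines "P \<equiv> \<lambda>y v w. W (f y) (fd f y v) (fd f y w)"
  shows "fd (\<lambda>y. P y v w) x u - fd (\<lambda>y. P y u w) x v + fd (\<lambda>y. P y u v) x w =
    fd (\<lambda>z. W z (fd f x v) (fd f x w)) (f x) (fd f x u) - fd (\<lambda>z. W z (fd f x u) (fd f x w)) (f x) (fd f x v)
    + fd (\<lambda>z. W z (fd f x u) (fd f x v)) (f x) (fd f x w)"
proof -
  have fx: "f x \<in> Z" using assms by auto
  have sk: "W (f x) a b = - W (f x) b a" for a b
    by (rule bilinear_alternating_skew[OF lin alt]) (use fx in auto)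
  have sym: "fd (\<lambda>y. fd f y v) x w = fd (\<lambda>y. fd f y w) x v" for v w
    by (rule second_derivative_symmetric[OF assms(6,4,8)])
  have d: "fd (\<lambda>y. P y v w) x u = fd (\<lambda>z. W z (fd f x v) (fd f x w)) (f x) (fd f x u)
    + W (f x) (fd (\<lambda>y. fd f y v) x u) (fd f x w) + W (f x) (fd f x v) (fd (\<lambda>y. fd f y w) x u)" for u v w
    unfolding P_def by (rule pullback_derivative2[where W = W and f = f and Z = Z, OF assms(1-8)])
  show ?thesis unfolding d
    using sym[of u v] sym[of u w] sym[of v w] sk[of "fd (\<lambda>y. fd f y u) x w" "fd f x v"] by simp
qed

text \<open>The topology-free part of \<open>smooth_atlas\<close>. It is all that the calculus of forms needs, and it is
  easier to verify for fibres and products.\<close>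

definition wk_atlas :: "('a, 'e::real_normed_vector) chart set \<Rightarrow> bool" where
  "wk_atlas A \<longleftrightarrow> (\<forall>c\<in>A. inj_on (snd c) (fst c)) \<and>
     (\<forall>c\<in>A. \<forall>d\<in>A. open (snd c ` (fst c \<inter> fst d)) \<and> smooth_on (snd c ` (fst c \<inter> fst d)) (coord_expr c id d))"

text \<open>Smoothness of a map out of an open subset of a vector space without reference to a
  topology on N: openness of the preimages of chart domains stands in for continuity.\<close>

definition smooth_param ::
  "('b, 'f::real_normed_vector) manifold \<Rightarrow> 'x::real_normed_vector set \<Rightarrow> ('x \<Rightarrow> 'b) \<Rightarrow> bool" where
  "smooth_param N X \<phi> \<longleftrightarrow> open X \<and> (\<forall>x\<in>X. \<exists>d\<in>atlas N. \<phi> x \<in> fst d) \<and>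
     (\<forall>d\<in>atlas N. open (X \<inter> \<phi> -` fst d) \<and> smooth_on (X \<inter> \<phi> -` fst d) (\<lambda>x. snd d (\<phi> x)))"

text \<open>Forms are pulled back along maps from open sets of vector spaces, so that charts of the total
  space, of a fibre and of a product are treated alike; \<open>pullback2 M N f \<omega> c\<close> is the case of
  \<open>f \<circ> chart_inv c\<close>.\<close>

definition pb1 :: "('b, 'f::real_normed_vector) manifold \<Rightarrow> ('x::real_normed_vector \<Rightarrow> 'b) \<Rightarrow> ('b, 'f) form1
    \<Rightarrow> 'x \<Rightarrow> 'x \<Rightarrow> real" where
  "pb1 N \<phi> \<alpha> x v = (let d = (SOME d. d \<in> atlas N \<and> \<phi> x \<in> fst d)
     in \<alpha> d (snd d (\<phi> x)) (fd (\<lambda>x. snd d (\<phi> x)) x v))"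

definition pb2 :: "('b, 'f::real_normed_vector) manifold \<Rightarrow> ('x::real_normed_vector \<Rightarrow> 'b) \<Rightarrow> ('b, 'f) form2
    \<Rightarrow> 'x \<Rightarrow> 'x \<Rightarrow> 'x \<Rightarrow> real" where
  "pb2 N \<phi> \<omega> x v w = (let d = (SOME d. d \<in> atlas N \<and> \<phi> x \<in> fst d); D = fd (\<lambda>x. snd d (\<phi> x)) x
     in \<omega> d (snd d (\<phi> x)) (D v) (D w))"

lemma smooth_param_chart_derivative:
  assumes "smooth_param N X \<phi>" "d \<in> atlas N" "x \<in> X" "\<phi> x \<in> fst d"
  shows "((\<lambda>x. snd d (\<phi> x)) has_derivative fd (\<lambda>x. snd d (\<phi> x)) x) (at x)"
  using assms unfolding smooth_param_def by (intro smooth_on_has_derivative[of "X \<inter> \<phi> -` fst d"]) auto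

lemma wk_atlas_inv: "wk_atlas A \<Longrightarrow> c \<in> A \<Longrightarrow> x \<in> fst c \<Longrightarrow> chart_inv c (snd c x) = x"
  by (auto simp: wk_atlas_def)

lemma wk_atlas_open: "wk_atlas A \<Longrightarrow> c \<in> A \<Longrightarrow> open (chart_image c)"
  unfolding wk_atlas_def by (metis Int_absorb)

lemma smooth_param_transition:
  assumes w: "wk_atlas (atlas N)" and sp: "smooth_param N X \<phi>" and d: "d \<in> atlas N" "d' \<in> atlas N"
    and x: "x \<in> X" "\<phi> x \<in> fst d" "\<phi> x \<in> fst d'"
  shows "coord_expr d id d' (snd d (\<phi> x)) = snd d' (\<phi> x)"
    and "fd (\<lambda>x. snd d' (\<phi> x)) x v = fd (coord_expr d id d') (snd d (\<phi> x)) (fd (\<lambda>x. snd d (\<phi> x)) x v)"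
proof -
  have eq: "coord_expr d id d' (snd d (\<phi> y)) = snd d' (\<phi> y)" if "\<phi> y \<in> fst d" for y
    using wk_atlas_inv[OF w d(1) that] by (simp add: coord_expr_def)
  then show "coord_expr d id d' (snd d (\<phi> x)) = snd d' (\<phi> x)" using x by simp
  have c: "(coord_expr d id d' has_derivative fd (coord_expr d id d') (snd d (\<phi> x))) (at (snd d (\<phi> x)))"
    by (rule smooth_on_has_derivative[of "snd d ` (fst d \<inter> fst d')"]) (use w d x in \<open>auto simp: wk_atlas_def\<close>)
  have "((\<lambda>y. coord_expr d id d' (snd d (\<phi> y))) has_derivative
     (\<lambda>v. fd (coord_expr d id d') (snd d (\<phi> x)) (fd (\<lambda>x. snd d (\<phi> x)) x v))) (at x)"
    by (rule has_derivative_compose[OF smooth_param_chart_derivative[OF sp d(1) x(1,2)] c])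
  then have "((\<lambda>y. snd d' (\<phi> y)) has_derivative
     (\<lambda>v. fd (coord_expr d id d') (snd d (\<phi> x)) (fd (\<lambda>x. snd d (\<phi> x)) x v))) (at x)"
    by (rule has_derivative_transform_within_open[of _ _ x UNIV "X \<inter> \<phi> -` fst d"])
       (use sp d x eq in \<open>auto simp: smooth_param_def\<close>)
  from frechet_derivativeI[OF this]
  show "fd (\<lambda>x. snd d' (\<phi> x)) x v = fd (coord_expr d id d') (snd d (\<phi> x)) (fd (\<lambda>x. snd d (\<phi> x)) x v)" by simp
qed

lemma smooth_param_ex: "smooth_param N X \<phi> \<Longrightarrow> x \<in> X \<Longrightarrow> \<exists>d. d \<in> atlas N \<and> \<phi> x \<in> fst d"
  unfolding smooth_param_def by blast

lemma some_chart:
  assumes "smooth_param N X \<phi>" "x \<in> X"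
  shows "(SOME d. d \<in> atlas N \<and> \<phi> x \<in> fst d) \<in> atlas N" "\<phi> x \<in> fst (SOME d. d \<in> atlas N \<and> \<phi> x \<in> fst d)"
proof -
  from someI_ex[OF smooth_param_ex[OF assms]] show "(SOME d. d \<in> atlas N \<and> \<phi> x \<in> fst d) \<in> atlas N" "\<phi> x \<in> fst (SOME d. d \<in> atlas N \<and> \<phi> x \<in> fst d)"
    by auto
qed

lemma one_formD:
  assumes "one_form N \<alpha>" "c \<in> atlas N"
  shows "x \<in> chart_image c \<Longrightarrow> linear (\<alpha> c x)" "smooth_on (chart_image c) (\<lambda>x. \<alpha> c x v)"
    "d \<in> atlas N \<Longrightarrow> y \<in> fst c \<Longrightarrow> y \<in> fst d \<Longrightarrow>
      \<alpha> c (snd c y) v = \<alpha> d (coord_expr c id d (snd c y)) (fd (coord_expr c id d) (snd c y) v)"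
  using assms unfolding one_form_def by blast+

lemma two_formD:
  assumes "two_form N \<omega>" "c \<in> atlas N"
  shows "x \<in> chart_image c \<Longrightarrow> bilinear (\<omega> c x)" "x \<in> chart_image c \<Longrightarrow> \<omega> c x v v = 0"
    "smooth_on (chart_image c) (\<lambda>x. \<omega> c x v w)"
    "d \<in> atlas N \<Longrightarrow> y \<in> fst c \<Longrightarrow> y \<in> fst d \<Longrightarrow> \<omega> c (snd c y) v w =
      \<omega> d (coord_expr c id d (snd c y)) (fd (coord_expr c id d) (snd c y) v) (fd (coord_expr c id d) (snd c y) w)"
  using assms unfolding two_form_def by blast+

text \<open>Removes the arbitrary choice from the definition: by the transformation law the selected
  chart may be exchanged for any chart around the point, which is how concrete pullbacks are
  computed.\<close>

lemma pb1_chart: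
  assumes w: "wk_atlas (atlas N)" and sp: "smooth_param N X \<phi>" and \<alpha>: "one_form N \<alpha>" and d: "d \<in> atlas N" and x: "x \<in> X" "\<phi> x \<in> fst d"
  shows "pb1 N \<phi> \<alpha> x v = \<alpha> d (snd d (\<phi> x)) (fd (\<lambda>x. snd d (\<phi> x)) x v)"
proof -
  let ?c = "SOME d. d \<in> atlas N \<and> \<phi> x \<in> fst d"
  note c = some_chart[OF sp x(1)]
  show ?thesis
    unfolding pb1_def Let_def one_formD(3)[OF \<alpha> c(1) d c(2) x(2)]
      smooth_param_transition[OF w sp c(1) d x(1) c(2) x(2)] ..
qed

lemma pb2_chart:
  assumes w: "wk_atlas (atlas N)" and sp: "smooth_param N X \<phi>" and \<omega>: "two_form N \<omega>" and d: "d \<in> atlas N" and x: "x \<in> X" "\<phi> x \<in> fst d"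
  shows "pb2 N \<phi> \<omega> x v w = \<omega> d (snd d (\<phi> x)) (fd (\<lambda>x. snd d (\<phi> x)) x v) (fd (\<lambda>x. snd d (\<phi> x)) x w)"
proof -
  let ?c = "SOME d. d \<in> atlas N \<and> \<phi> x \<in> fst d"
  note c = some_chart[OF sp x(1)]
  show ?thesis
    unfolding pb2_def Let_def two_formD(4)[OF \<omega> c(1) d c(2) x(2)]
      smooth_param_transition[OF w sp c(1) d x(1) c(2) x(2)] ..
qed

lemma chart_rep:
  assumes w: "wk_atlas (atlas N)" and sp: "smooth_param N X \<phi>" and d: "d \<in> atlas N"
  shows "open (X \<inter> \<phi> -` fst d)" "smooth_on (X \<inter> \<phi> -` fst d) (\<lambda>x. snd d (\<phi> x))"
    "(\<lambda>x. snd d (\<phi> x)) ` (X \<inter> \<phi> -` fst d) \<subseteq> chart_image d" "open (chart_image d)"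
  using assms wk_atlas_open[OF w d] by (auto simp: smooth_param_def)

lemma pb1_form:
  fixes N :: "('b, 'f::real_inner) manifold" and \<phi> :: "'x::real_inner \<Rightarrow> 'b"
  assumes w: "wk_atlas (atlas N)" and fin: "findim TYPE('f)" and sp: "smooth_param N X \<phi>" and \<alpha>: "one_form N \<alpha>"
  shows "x \<in> X \<Longrightarrow> linear (pb1 N \<phi> \<alpha> x)" "smooth_on X (\<lambda>x. pb1 N \<phi> \<alpha> x v)"
proof -
  show "linear (pb1 N \<phi> \<alpha> x)" if x: "x \<in> X"
  proof -
    obtain d where d: "d \<in> atlas N" "\<phi> x \<in> fst d" using smooth_param_ex[OF sp x] by blast
    have 1: "linear (\<alpha> d (snd d (\<phi> x)))" by (rule one_formD(1)[OF \<alpha> d(1)]) (use d in auto)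
    have 2: "linear (fd (\<lambda>x. snd d (\<phi> x)) x)"
      using smooth_param_chart_derivative[OF sp d(1) x d(2)] by (rule has_derivative_linear)
    have "pb1 N \<phi> \<alpha> x = (\<lambda>v. \<alpha> d (snd d (\<phi> x)) (fd (\<lambda>x. snd d (\<phi> x)) x v))"
      using pb1_chart[OF w sp \<alpha> d(1) x d(2)] by blast
    then show ?thesis using linear_compose[OF 2 1] by (simp add: o_def)
  qed
  show "smooth_on X (\<lambda>x. pb1 N \<phi> \<alpha> x v)"
  proof (rule smooth_on_local)
    fix x assume x: "x \<in> X"
    obtain d where d: "d \<in> atlas N" "\<phi> x \<in> fst d" using smooth_param_ex[OF sp x] by blast
    note r = chart_rep[OF w sp d(1)]
    have "smooth_on (X \<inter> \<phi> -` fst d) (\<lambda>x. \<alpha> d (snd d (\<phi> x)) (fd (\<lambda>x. snd d (\<phi> x)) x v))"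
      by (rule smooth_on_linear_param[OF fin fin one_formD(1)[OF \<alpha> d(1)] r(4,1) one_formD(2)[OF \<alpha> d(1)] r(2,3)
          smooth_on_frechet_derivative[OF r(2)]])
    then have "smooth_on (X \<inter> \<phi> -` fst d) (\<lambda>x. pb1 N \<phi> \<alpha> x v)"
      by (rule smooth_on_cong[OF r(1)]) (use pb1_chart[OF w sp \<alpha> d(1)] in auto)
    then show "\<exists>U. open U \<and> x \<in> U \<and> smooth_on U (\<lambda>x. pb1 N \<phi> \<alpha> x v)"
      using r(1) d x by blast
  qed
qed

lemma pb2_form:
  fixes N :: "('b, 'f::real_inner) manifold" and \<phi> :: "'x::real_inner \<Rightarrow> 'b"
  assumes w: "wk_atlas (atlas N)" and fin: "findim TYPE('f)" and sp: "smooth_param N X \<phi>" and \<omega>: "two_form N \<omega>"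
  shows "x \<in> X \<Longrightarrow> bilinear (pb2 N \<phi> \<omega> x)" "x \<in> X \<Longrightarrow> pb2 N \<phi> \<omega> x v v = 0" "smooth_on X (\<lambda>x. pb2 N \<phi> \<omega> x v u)"
proof -
  show "bilinear (pb2 N \<phi> \<omega> x)" "pb2 N \<phi> \<omega> x v v = 0" if x: "x \<in> X"
  proof -
    obtain d where d: "d \<in> atlas N" "\<phi> x \<in> fst d" using smooth_param_ex[OF sp x] by blast
    have dx: "snd d (\<phi> x) \<in> chart_image d" using d by auto
    have 1: "linear (\<lambda>a. \<omega> d (snd d (\<phi> x)) a b)" "linear (\<omega> d (snd d (\<phi> x)) b)" for b
      using two_formD(1)[OF \<omega> d(1) dx] by (auto simp: bilinear_def)
    have 2: "linear (fd (\<lambda>x. snd d (\<phi> x)) x)"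
      using smooth_param_chart_derivative[OF sp d(1) x d(2)] by (rule has_derivative_linear)
    have e: "pb2 N \<phi> \<omega> x = (\<lambda>v w. \<omega> d (snd d (\<phi> x)) (fd (\<lambda>x. snd d (\<phi> x)) x v) (fd (\<lambda>x. snd d (\<phi> x)) x w))"
      using pb2_chart[OF w sp \<omega> d(1) x d(2)] by blast
    then show "bilinear (pb2 N \<phi> \<omega> x)"
      using linear_compose[OF 2 1(1)] linear_compose[OF 2 1(2)] by (auto simp: o_def bilinear_def)
    show "pb2 N \<phi> \<omega> x v v = 0" unfolding e by (rule two_formD(2)[OF \<omega> d(1) dx])
  qed
  show "smooth_on X (\<lambda>x. pb2 N \<phi> \<omega> x v u)"
  proof (rule smooth_on_local)
    fix x assume x: "x \<in> X"
    obtain d where d: "d \<in> atlas N" "\<phi> x \<in> fst d" using smooth_param_ex[OF sp x] by blast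
    note r = chart_rep[OF w sp d(1)]
    have "smooth_on (X \<inter> \<phi> -` fst d) (\<lambda>x. \<omega> d (snd d (\<phi> x)) (fd (\<lambda>x. snd d (\<phi> x)) x v) (fd (\<lambda>x. snd d (\<phi> x)) x u))"
      by (rule smooth_on_bilinear_param[OF fin fin two_formD(1)[OF \<omega> d(1)] r(4,1) two_formD(3)[OF \<omega> d(1)] r(2,3)
          smooth_on_frechet_derivative[OF r(2)] smooth_on_frechet_derivative[OF r(2)]])
    then have "smooth_on (X \<inter> \<phi> -` fst d) (\<lambda>x. pb2 N \<phi> \<omega> x v u)"
      by (rule smooth_on_cong[OF r(1)]) (use pb2_chart[OF w sp \<omega> d(1)] in auto)
    then show "\<exists>U. open U \<and> x \<in> U \<and> smooth_on U (\<lambda>x. pb2 N \<phi> \<omega> x v u)"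
      using r(1) d x by blast
  qed
qed

lemma pb2_closed:
  fixes N :: "('b, 'f::real_inner) manifold" and \<phi> :: "'x::real_inner \<Rightarrow> 'b"
  assumes w: "wk_atlas (atlas N)" and fin: "findim TYPE('f)" and sp: "smooth_param N X \<phi>" and cl: "closed_two_form N \<omega>" and x: "x \<in> X"
  shows "fd (\<lambda>y. pb2 N \<phi> \<omega> y v w) x u - fd (\<lambda>y. pb2 N \<phi> \<omega> y u w) x v + fd (\<lambda>y. pb2 N \<phi> \<omega> y u v) x w = 0"
proof -
  have \<omega>: "two_form N \<omega>" using cl by (simp add: closed_two_form_def)
  obtain d where d: "d \<in> atlas N" "\<phi> x \<in> fst d" using smooth_param_ex[OF sp x] by blast
  note r = chart_rep[OF w sp d(1)]
  let ?f = "\<lambda>x. snd d (\<phi> x)"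
  have xX: "x \<in> X \<inter> \<phi> -` fst d" using x d by auto
  have e: "fd (\<lambda>y. pb2 N \<phi> \<omega> y a b) x = fd (\<lambda>y. \<omega> d (?f y) (fd ?f y a) (fd ?f y b)) x" for a b
    by (rule frechet_derivative_cong_open[OF r(1) xX]) (use pb2_chart[OF w sp \<omega> d(1)] in auto)
  have "fd (\<lambda>y. \<omega> d (?f y) (fd ?f y v) (fd ?f y w)) x u - fd (\<lambda>y. \<omega> d (?f y) (fd ?f y u) (fd ?f y w)) x v
     + fd (\<lambda>y. \<omega> d (?f y) (fd ?f y u) (fd ?f y v)) x w =
     fd (\<lambda>z. \<omega> d z (fd ?f x v) (fd ?f x w)) (?f x) (fd ?f x u) - fd (\<lambda>z. \<omega> d z (fd ?f x u) (fd ?f x w)) (?f x) (fd ?f x v)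
    + fd (\<lambda>z. \<omega> d z (fd ?f x u) (fd ?f x v)) (?f x) (fd ?f x w)"
    by (rule pullback_ext_d2[OF fin two_formD(1)[OF \<omega> d(1)] r(4,1) two_formD(3)[OF \<omega> d(1)] r(2,3) xX two_formD(2)[OF \<omega> d(1)]])
  also have "\<dots> = 0" using cl d unfolding closed_two_form_def ext_d2_def by blast
  finally show ?thesis unfolding e .
qed

lemma pb_ext_d1:
  fixes N :: "('b, 'f::real_inner) manifold" and \<phi> :: "'x::real_inner \<Rightarrow> 'b"
  assumes w: "wk_atlas (atlas N)" and fin: "findim TYPE('f)" and sp: "smooth_param N X \<phi>" and \<alpha>: "one_form N \<alpha>" and x: "x \<in> X"
  shows "pb2 N \<phi> (ext_d1 \<alpha>) x v u = fd (\<lambda>y. pb1 N \<phi> \<alpha> y u) x v - fd (\<lambda>y. pb1 N \<phi> \<alpha> y v) x u"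
proof -
  \<comment> \<open>The very chart selected inside \<open>pb2\<close>: the transformation law of
    \<open>ext_d1 \<alpha>\<close> is established only later, so no other chart may be substituted
    yet.\<close>
  define d where "d = (SOME d. d \<in> atlas N \<and> \<phi> x \<in> fst d)"
  have d: "d \<in> atlas N" "\<phi> x \<in> fst d" using some_chart[OF sp x] by (auto simp: d_def)
  note r = chart_rep[OF w sp d(1)]
  let ?f = "\<lambda>x. snd d (\<phi> x)"
  have xX: "x \<in> X \<inter> \<phi> -` fst d" using x d by auto
  have e: "fd (\<lambda>y. pb1 N \<phi> \<alpha> y a) x = fd (\<lambda>y. \<alpha> d (?f y) (fd ?f y a)) x" for a
    by (rule frechet_derivative_cong_open[OF r(1) xX]) (use pb1_chart[OF w sp \<alpha> d(1)] in auto)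
  have "fd (\<lambda>y. \<alpha> d (?f y) (fd ?f y u)) x v - fd (\<lambda>y. \<alpha> d (?f y) (fd ?f y v)) x u =
    fd (\<lambda>z. \<alpha> d z (fd ?f x u)) (?f x) (fd ?f x v) - fd (\<lambda>z. \<alpha> d z (fd ?f x v)) (?f x) (fd ?f x u)"
    by (rule pullback_ext_d1[OF fin one_formD(1)[OF \<alpha> d(1)] r(4,1) one_formD(2)[OF \<alpha> d(1)] r(2,3) xX])
  then show ?thesis unfolding e by (simp add: pb2_def ext_d1_def Let_def flip: d_def)
qed

lemma smooth_param_compose:
  fixes N :: "('b, 'f::real_inner) manifold" and \<phi> :: "'x::real_inner \<Rightarrow> 'b" and g :: "'y::real_normed_vector \<Rightarrow> 'x"
  assumes sp: "smooth_param N X \<phi>" and fin: "findim TYPE('x)" and g: "open Y" "smooth_on Y g" "g ` Y \<subseteq> X"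
  shows "smooth_param N Y (\<lambda>y. \<phi> (g y))"
  unfolding smooth_param_def
proof (intro conjI ballI g)
  fix y assume "y \<in> Y" then show "\<exists>d\<in>atlas N. \<phi> (g y) \<in> fst d" using smooth_param_ex[OF sp, of "g y"] g by blast
next
  fix d assume d: "d \<in> atlas N"
  have o: "open (X \<inter> \<phi> -` fst d)" "smooth_on (X \<inter> \<phi> -` fst d) (\<lambda>x. snd d (\<phi> x))"
    using sp d by (auto simp: smooth_param_def)
  have eq: "Y \<inter> (\<lambda>y. \<phi> (g y)) -` fst d = Y \<inter> g -` (X \<inter> \<phi> -` fst d)" using g by auto
  then show op: "open (Y \<inter> (\<lambda>y. \<phi> (g y)) -` fst d)"
    using continuous_open_preimage[OF smooth_on_continuous[OF g(2)] g(1) o(1)] by simp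
  show "smooth_on (Y \<inter> (\<lambda>y. \<phi> (g y)) -` fst d) (\<lambda>y. snd d (\<phi> (g y)))"
    by (rule smooth_on_compose[OF fin op o(1) smooth_on_subset[OF g(2)] o(2)]) (use eq in auto)
qed

lemma compose_chart_derivative:
  fixes N :: "('b, 'f::real_inner) manifold" and \<phi> :: "'x::real_inner \<Rightarrow> 'b" and g :: "'y::real_normed_vector \<Rightarrow> 'x"
  assumes sp: "smooth_param N X \<phi>" and g: "smooth_on Y g" "g ` Y \<subseteq> X" and y: "y \<in> Y" and d: "d \<in> atlas N" "\<phi> (g y) \<in> fst d"
  shows "fd (\<lambda>y. snd d (\<phi> (g y))) y = (\<lambda>v. fd (\<lambda>x. snd d (\<phi> x)) (g y) (fd g y v))"
  by (rule frechet_derivativeI, rule has_derivative_compose[OF smooth_on_has_derivative[OF g(1) y]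
     smooth_param_chart_derivative[OF sp d(1) _ d(2)]]) (use g y in auto)

text \<open>Both sides select their chart from the same point, so this is the chain rule alone and
  holds for arbitrary coordinate families, also before they are known to be forms.\<close>

lemma pb_compose:
  fixes N :: "('b, 'f::real_inner) manifold" and \<phi> :: "'x::real_inner \<Rightarrow> 'b" and g :: "'y::real_normed_vector \<Rightarrow> 'x"
  assumes sp: "smooth_param N X \<phi>" and g: "smooth_on Y g" "g ` Y \<subseteq> X" and y: "y \<in> Y"
  shows "pb1 N (\<lambda>y. \<phi> (g y)) \<alpha> y v = pb1 N \<phi> \<alpha> (g y) (fd g y v)"
    "pb2 N (\<lambda>y. \<phi> (g y)) \<omega> y v w = pb2 N \<phi> \<omega> (g y) (fd g y v) (fd g y w)"
proof -
  have gy: "g y \<in> X" using g y by auto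
  show "pb1 N (\<lambda>y. \<phi> (g y)) \<alpha> y v = pb1 N \<phi> \<alpha> (g y) (fd g y v)"
    "pb2 N (\<lambda>y. \<phi> (g y)) \<omega> y v w = pb2 N \<phi> \<omega> (g y) (fd g y v) (fd g y w)"
    unfolding pb1_def pb2_def Let_def compose_chart_derivative[OF sp g y some_chart[OF sp gy]] by simp_all
qed

lemma pb_cong:
  fixes N :: "('b, 'f::real_normed_vector) manifold" and \<phi> :: "'x::real_normed_vector \<Rightarrow> 'b"
  assumes "open X" "x \<in> X" "\<And>y. y \<in> X \<Longrightarrow> \<phi> y = \<phi>' y"
  shows "pb1 N \<phi> \<alpha> x = pb1 N \<phi>' \<alpha> x" "pb2 N \<phi> \<omega> x = pb2 N \<phi>' \<omega> x"
proof -
  have e: "\<phi> x = \<phi>' x" using assms by auto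
  have "fd (\<lambda>x. snd d (\<phi> x)) x = fd (\<lambda>x. snd d (\<phi>' x)) x" for d :: "('b, 'f) chart"
    by (rule frechet_derivative_cong_open[OF assms(1,2)]) (use assms(3) in auto)
  then show "pb1 N \<phi> \<alpha> x = pb1 N \<phi>' \<alpha> x" "pb2 N \<phi> \<omega> x = pb2 N \<phi>' \<omega> x"
    by (auto simp: pb1_def[abs_def] pb2_def[abs_def] Let_def e)
qed

lemma smooth_param_cong:
  assumes "smooth_param N X \<phi>" "\<And>y. y \<in> X \<Longrightarrow> \<phi> y = \<phi>' y"
  shows "smooth_param N X \<phi>'"
proof -
  have "X \<inter> \<phi> -` S = X \<inter> \<phi>' -` S" for S using assms(2) by auto
  then show ?thesis using assms unfolding smooth_param_def
    by (auto intro: smooth_on_cong[where f = "\<lambda>x. snd _ (\<phi> x)"])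
qed

lemma smooth_param_subset:
  assumes "smooth_param N X \<phi>" "open Y" "Y \<subseteq> X"
  shows "smooth_param N Y \<phi>"
proof -
  have "Y \<inter> \<phi> -` S = Y \<inter> (X \<inter> \<phi> -` S)" for S using assms(3) by auto
  then show ?thesis using assms unfolding smooth_param_def
    by (metis (no_types, lifting) inf_le2 open_Int smooth_on_subset subset_iff)
qed

lemma smooth_param_chart_inv:
  assumes w: "wk_atlas (atlas N)" and c: "c \<in> atlas N"
  shows "smooth_param N (chart_image c) (chart_inv c)"
  unfolding smooth_param_def
proof (intro conjI ballI wk_atlas_open[OF w c])
  show "\<exists>d\<in>atlas N. chart_inv c x \<in> fst d" if "x \<in> chart_image c" for x
    using c that by (blast intro: inv_into_into)
  fix d assume d: "d \<in> atlas N"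
  have "chart_image c \<inter> chart_inv c -` fst d = snd c ` (fst c \<inter> fst d)"
    using wk_atlas_inv[OF w c] by force
  moreover have "(\<lambda>x. snd d (chart_inv c x)) = coord_expr c id d" by (simp add: coord_expr_def fun_eq_iff)
  ultimately show "open (chart_image c \<inter> chart_inv c -` fst d)"
     "smooth_on (chart_image c \<inter> chart_inv c -` fst d) (\<lambda>x. snd d (chart_inv c x))"
    using w c d by (auto simp: wk_atlas_def)
qed

lemma pb_chart_inv:
  assumes w: "wk_atlas (atlas N)" and c: "c \<in> atlas N" and x: "x \<in> chart_image c"
  shows "one_form N \<alpha> \<Longrightarrow> pb1 N (chart_inv c) \<alpha> x = \<alpha> c x"
    "two_form N \<omega> \<Longrightarrow> pb2 N (chart_inv c) \<omega> x = \<omega> c x"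
proof -
  have cx: "chart_inv c x \<in> fst c" using x by (rule inv_into_into)
  have e: "snd c (chart_inv c y) = y" if "y \<in> chart_image c" for y using that by (rule f_inv_into_f)
  have d: "fd (\<lambda>x. snd c (chart_inv c x)) x = (\<lambda>v. v)"
    using frechet_derivative_cong_open[OF wk_atlas_open[OF w c] x e] by simp
  show "pb1 N (chart_inv c) \<alpha> x = \<alpha> c x" if "one_form N \<alpha>"
    using pb1_chart[OF w smooth_param_chart_inv[OF w c] that c x cx] d e[OF x] by auto
  show "pb2 N (chart_inv c) \<omega> x = \<omega> c x" if "two_form N \<omega>"
    using pb2_chart[OF w smooth_param_chart_inv[OF w c] that c x cx] d e[OF x] by auto
qed

definition pullback1 ::
  "('a, 'e::real_normed_vector) manifold \<Rightarrow> ('b, 'f::real_normed_vector) manifold \<Rightarrow>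
   ('a \<Rightarrow> 'b) \<Rightarrow> ('b, 'f) form1 \<Rightarrow> ('a, 'e) form1" where
  "pullback1 M N f \<alpha> = (\<lambda>c. pb1 N (\<lambda>x. f (chart_inv c x)) \<alpha>)"

lemma pullback2_pb2: "pullback2 M N f \<omega> c = pb2 N (\<lambda>x. f (chart_inv c x)) \<omega>"
  by (simp add: pullback2_def pb2_def[abs_def] coord_expr_def)

definition chart_smooth :: "('a, 'e::real_normed_vector) manifold \<Rightarrow> ('b, 'f::real_normed_vector) manifold \<Rightarrow> ('a \<Rightarrow> 'b) \<Rightarrow> bool" where
  "chart_smooth M N f \<longleftrightarrow> (\<forall>c\<in>atlas M. smooth_param N (chart_image c) (\<lambda>x. f (chart_inv c x)))"

lemma overlap_transition:
  assumes "wk_atlas (atlas M)" "c \<in> atlas M" "d \<in> atlas M"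
  shows "open (snd c ` (fst c \<inter> fst d))" "smooth_on (snd c ` (fst c \<inter> fst d)) (coord_expr c id d)"
    "coord_expr c id d ` (snd c ` (fst c \<inter> fst d)) \<subseteq> chart_image d"
    "\<And>x. x \<in> snd c ` (fst c \<inter> fst d) \<Longrightarrow> chart_inv d (coord_expr c id d x) = chart_inv c x"
  using assms wk_atlas_inv[OF assms(1,2)] wk_atlas_inv[OF assms(1,3)] by (auto simp: wk_atlas_def coord_expr_def)

text \<open>A transition map is a reparametrization, so the transformation law of a pulled-back form
  is functoriality. The set Y admits maps that are smooth only over part of the chart, such as a
  trivialization over a cell of the base.\<close>

lemma pb_overlap:
  fixes M :: "('a, 'e::real_inner) manifold" and N :: "('b, 'f::real_inner) manifold"
  assumes w: "wk_atlas (atlas M)" and c: "c \<in> atlas M" "d \<in> atlas M" and fin: "findim TYPE('e)"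
    and sp: "smooth_param N Y (\<lambda>x. f (chart_inv d x))" and x: "x \<in> snd c ` (fst c \<inter> fst d)" "coord_expr c id d x \<in> Y"
  shows "pb1 N (\<lambda>x. f (chart_inv c x)) \<alpha> x v =
      pb1 N (\<lambda>x. f (chart_inv d x)) \<alpha> (coord_expr c id d x) (fd (coord_expr c id d) x v)"
    "pb2 N (\<lambda>x. f (chart_inv c x)) \<omega> x v u =
      pb2 N (\<lambda>x. f (chart_inv d x)) \<omega> (coord_expr c id d x) (fd (coord_expr c id d) x v) (fd (coord_expr c id d) x u)"
proof -
  note t = overlap_transition[OF w c]
  let ?U = "snd c ` (fst c \<inter> fst d) \<inter> coord_expr c id d -` Y"
  have Y: "open Y" using sp by (simp add: smooth_param_def)
  have U: "open ?U" by (rule continuous_open_preimage[OF smooth_on_continuous[OF t(2)] t(1) Y])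
  have xU: "x \<in> ?U" using x by auto
  have g: "smooth_on ?U (coord_expr c id d)" "coord_expr c id d ` ?U \<subseteq> Y" using smooth_on_subset[OF t(2)] by auto
  have e: "y \<in> ?U \<Longrightarrow> f (chart_inv c y) = f (chart_inv d (coord_expr c id d y))" for y using t(4) by auto
  show "pb1 N (\<lambda>x. f (chart_inv c x)) \<alpha> x v =
      pb1 N (\<lambda>x. f (chart_inv d x)) \<alpha> (coord_expr c id d x) (fd (coord_expr c id d) x v)"
    "pb2 N (\<lambda>x. f (chart_inv c x)) \<omega> x v u =
      pb2 N (\<lambda>x. f (chart_inv d x)) \<omega> (coord_expr c id d x) (fd (coord_expr c id d) x v) (fd (coord_expr c id d) x u)"
    unfolding pb_compose[OF sp g xU, symmetric]
    by (simp_all only: pb_cong[where \<phi> = "\<lambda>x. f (chart_inv c x)" and \<phi>' = "\<lambda>y. f (chart_inv d (coord_expr c id d y))", OF U xU e])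
qed

lemma pullback_forms:
  fixes M :: "('a, 'e::real_inner) manifold" and N :: "('b, 'f::real_inner) manifold"
  assumes wM: "wk_atlas (atlas M)" and wN: "wk_atlas (atlas N)" and fin: "findim TYPE('e)" "findim TYPE('f)"
    and f: "chart_smooth M N f"
  shows "one_form N \<alpha> \<Longrightarrow> one_form M (pullback1 M N f \<alpha>)"
    "two_form N \<omega> \<Longrightarrow> two_form M (pullback2 M N f \<omega>)"
    "closed_two_form N \<omega> \<Longrightarrow> closed_two_form M (pullback2 M N f \<omega>)"
    "one_form N \<alpha> \<Longrightarrow> eq_form2 M (pullback2 M N f (ext_d1 \<alpha>)) (ext_d1 (pullback1 M N f \<alpha>))"
proof -
  have sp: "smooth_param N (chart_image c) (\<lambda>x. f (chart_inv c x))" if "c \<in> atlas M" for c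
    using f that by (simp add: chart_smooth_def)
  have tr: "coord_expr c id d x \<in> chart_image d" if "c \<in> atlas M" "d \<in> atlas M" "x \<in> snd c ` (fst c \<inter> fst d)" for c d x
    using overlap_transition(3)[OF wM that(1,2)] that(3) by blast
  show "one_form M (pullback1 M N f \<alpha>)" if \<alpha>: "one_form N \<alpha>"
    unfolding one_form_def pullback1_def
  proof (intro conjI ballI allI)
    fix c x v assume c: "c \<in> atlas M"
    show "x \<in> chart_image c \<Longrightarrow> linear (pb1 N (\<lambda>x. f (chart_inv c x)) \<alpha> x)"
      "smooth_on (chart_image c) (\<lambda>x. pb1 N (\<lambda>x. f (chart_inv c x)) \<alpha> x v)"
      by (rule pb1_form[OF wN fin(2) sp[OF c] \<alpha>], assumption?)+
    fix d assume d: "d \<in> atlas M" and x: "x \<in> snd c ` (fst c \<inter> fst d)"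
    show "pb1 N (\<lambda>x. f (chart_inv c x)) \<alpha> x v =
      pb1 N (\<lambda>x. f (chart_inv d x)) \<alpha> (coord_expr c id d x) (fd (coord_expr c id d) x v)"
      by (rule pb_overlap(1)[OF wM c d fin(1) sp[OF d] x tr[OF c d x]])
  qed
  show 2: "two_form M (pullback2 M N f \<omega>)" if \<omega>: "two_form N \<omega>" for \<omega>
    unfolding two_form_def pullback2_pb2
  proof (intro conjI ballI allI)
    fix c x v w assume c: "c \<in> atlas M"
    show "x \<in> chart_image c \<Longrightarrow> bilinear (pb2 N (\<lambda>x. f (chart_inv c x)) \<omega> x)"
      "x \<in> chart_image c \<Longrightarrow> pb2 N (\<lambda>x. f (chart_inv c x)) \<omega> x v v = 0"
      "smooth_on (chart_image c) (\<lambda>x. pb2 N (\<lambda>x. f (chart_inv c x)) \<omega> x v w)"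
      by (rule pb2_form[OF wN fin(2) sp[OF c] \<omega>], assumption?)+
    fix d assume d: "d \<in> atlas M" and x: "x \<in> snd c ` (fst c \<inter> fst d)"
    show "pb2 N (\<lambda>x. f (chart_inv c x)) \<omega> x v w =
      pb2 N (\<lambda>x. f (chart_inv d x)) \<omega> (coord_expr c id d x) (fd (coord_expr c id d) x v) (fd (coord_expr c id d) x w)"
      by (rule pb_overlap(2)[OF wM c d fin(1) sp[OF d] x tr[OF c d x]])
  qed
  show "closed_two_form M (pullback2 M N f \<omega>)" if \<omega>: "closed_two_form N \<omega>"
    unfolding closed_two_form_def ext_d2_def
  proof (intro conjI ballI allI)
    show "two_form M (pullback2 M N f \<omega>)" by (rule 2) (use \<omega> in \<open>simp add: closed_two_form_def\<close>)
    fix c x u v w assume c: "c \<in> atlas M" and x: "x \<in> chart_image c"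
    show "fd (\<lambda>y. pullback2 M N f \<omega> c y v w) x u - fd (\<lambda>y. pullback2 M N f \<omega> c y u w) x v
       + fd (\<lambda>y. pullback2 M N f \<omega> c y u v) x w = 0"
      unfolding pullback2_pb2 by (rule pb2_closed[OF wN fin(2) sp[OF c] \<omega> x])
  qed
  show "eq_form2 M (pullback2 M N f (ext_d1 \<alpha>)) (ext_d1 (pullback1 M N f \<alpha>))" if "one_form N \<alpha>"
    unfolding eq_form2_def pullback2_pb2 ext_d1_def[of "pullback1 M N f \<alpha>"]
    unfolding pullback1_def
    by (intro ballI allI pb_ext_d1[OF wN fin(2) sp that])
qed

section \<open>Cohomology classes\<close>

lemma one_form_fd:
  fixes M :: "('a, 'e::real_normed_vector) manifold"
  assumes w: "wk_atlas (atlas M)" and \<alpha>: "one_form M \<alpha>" and c: "c \<in> atlas M" and x: "x \<in> chart_image c"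
  shows "fd (\<lambda>y. \<alpha> c y (v + v')) x = (\<lambda>u. fd (\<lambda>y. \<alpha> c y v) x u + fd (\<lambda>y. \<alpha> c y v') x u)"
    "fd (\<lambda>y. \<alpha> c y (k *\<^sub>R v)) x = (\<lambda>u. k * fd (\<lambda>y. \<alpha> c y v) x u)"
    "linear (fd (\<lambda>y. \<alpha> c y v) x)"
proof -
  note op = wk_atlas_open[OF w c]
  have D: "((\<lambda>y. \<alpha> c y v) has_derivative fd (\<lambda>y. \<alpha> c y v) x) (at x)" for v
    by (rule smooth_on_has_derivative[OF one_formD(2)[OF \<alpha> c] x])
  show "linear (fd (\<lambda>y. \<alpha> c y v) x)" using D by (rule has_derivative_linear)
  have "fd (\<lambda>y. \<alpha> c y (v + v')) x = fd (\<lambda>y. \<alpha> c y v + \<alpha> c y v') x"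
    by (rule frechet_derivative_cong_open[OF op x]) (rule linear_add[OF one_formD(1)[OF \<alpha> c]])
  then show "fd (\<lambda>y. \<alpha> c y (v + v')) x = (\<lambda>u. fd (\<lambda>y. \<alpha> c y v) x u + fd (\<lambda>y. \<alpha> c y v') x u)"
    using frechet_derivativeI[OF has_derivative_add[OF D D]] by simp
  have "fd (\<lambda>y. \<alpha> c y (k *\<^sub>R v)) x = fd (\<lambda>y. k * \<alpha> c y v) x"
    by (rule frechet_derivative_cong_open[OF op x]) (use linear_scale[OF one_formD(1)[OF \<alpha> c]] in simp)
  then show "fd (\<lambda>y. \<alpha> c y (k *\<^sub>R v)) x = (\<lambda>u. k * fd (\<lambda>y. \<alpha> c y v) x u)"
    using frechet_derivativeI[OF has_derivative_mult_right[OF D]] by simp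
qed

text \<open>The transformation law is naturality of d under transition maps. Closedness is d d = 0:
  six second derivatives cancel in pairs by symmetry.\<close>

lemma ext_d1_closed:
  fixes M :: "('a, 'e::real_inner) manifold"
  assumes w: "wk_atlas (atlas M)" and fin: "findim TYPE('e)" and \<alpha>: "one_form M \<alpha>"
  shows "closed_two_form M (ext_d1 \<alpha>)"
  unfolding closed_two_form_def two_form_def
proof (intro conjI ballI allI)
  fix c x v v' assume c: "c \<in> atlas M"
  note sm = one_formD(2)[OF \<alpha> c] and op = wk_atlas_open[OF w c]
  show "bilinear (ext_d1 \<alpha> c x)" if x: "x \<in> chart_image c"
    using one_form_fd[OF w \<alpha> c x]
    by (auto simp: bilinear_def ext_d1_def linear_iff algebra_simps)
  show "ext_d1 \<alpha> c x v v = 0" by (simp add: ext_d1_def)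
  show "smooth_on (chart_image c) (\<lambda>x. ext_d1 \<alpha> c x v v')" unfolding ext_d1_def
    by (intro smooth_on_diff op smooth_on_frechet_derivative sm)
  show "ext_d1 \<alpha> c x v v' = ext_d1 \<alpha> d (coord_expr c id d x) (fd (coord_expr c id d) x v) (fd (coord_expr c id d) x v')"
    if d: "d \<in> atlas M" and x: "x \<in> snd c ` (fst c \<inter> fst d)" for d
  proof -
    let ?g = "coord_expr c id d"
    note t = overlap_transition[OF w c d]
    have e: "fd (\<lambda>y. \<alpha> c y a) x = fd (\<lambda>y. \<alpha> d (?g y) (fd ?g y a)) x" for a
      by (rule frechet_derivative_cong_open[OF t(1) x]) (use one_formD(3)[OF \<alpha> c d] in auto)
    show ?thesis unfolding ext_d1_def e
      by (rule pullback_ext_d1[OF fin one_formD(1)[OF \<alpha> d] wk_atlas_open[OF w d] t(1) one_formD(2)[OF \<alpha> d] t(2,3) x])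
  qed
  fix u assume x: "x \<in> chart_image c"
  define A where "A = (\<lambda>w v. fd (\<lambda>y. fd (\<lambda>z. \<alpha> c z w) y v) x)"
  have sym: "A a b e = A a e b" for a b e
    unfolding A_def by (rule second_derivative_symmetric[OF sm op x])
  have D: "((\<lambda>y. fd (\<lambda>z. \<alpha> c z a) y b) has_derivative A a b) (at x)" for a b
    unfolding A_def by (rule smooth_on_has_derivative[OF smooth_on_frechet_derivative[OF sm] x])
  have d: "fd (\<lambda>y. ext_d1 \<alpha> c y a b) x = (\<lambda>u. A b a u - A a b u)" for a b
    unfolding ext_d1_def by (rule frechet_derivativeI[OF has_derivative_diff[OF D D]])
  show "ext_d2 (ext_d1 \<alpha>) c x u v v' = 0"
    unfolding ext_d2_def d using sym[of u v v'] sym[of v u v'] sym[of v' u v] by simp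
qed

section \<open>Linear operations on forms and on classes\<close>

lemma one_form_add:
  assumes w: "wk_atlas (atlas M)" and a: "one_form M \<alpha>" and b: "one_form M \<beta>"
  shows "one_form M (\<lambda>c x v. \<alpha> c x v + \<beta> c x v)"
  unfolding one_form_def
proof (intro conjI ballI allI)
  fix c x v assume c: "c \<in> atlas M"
  show "linear (\<lambda>v. \<alpha> c x v + \<beta> c x v)" if "x \<in> chart_image c"
    by (intro linear_compose_add one_formD(1)[OF a c that] one_formD(1)[OF b c that])
  show "smooth_on (chart_image c) (\<lambda>x. \<alpha> c x v + \<beta> c x v)"
    by (intro smooth_on_add wk_atlas_open[OF w c] one_formD(2)[OF a c] one_formD(2)[OF b c])
  fix d assume d: "d \<in> atlas M" and "x \<in> snd c ` (fst c \<inter> fst d)"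
  then show "\<alpha> c x v + \<beta> c x v = \<alpha> d (coord_expr c id d x) (fd (coord_expr c id d) x v) + \<beta> d (coord_expr c id d x) (fd (coord_expr c id d) x v)"
    using one_formD(3)[OF a c d] one_formD(3)[OF b c d] by auto
qed

lemma one_form_scale:
  assumes w: "wk_atlas (atlas M)" and a: "one_form M \<alpha>"
  shows "one_form M (\<lambda>c x v. k * \<alpha> c x v)"
  unfolding one_form_def
proof (intro conjI ballI allI)
  fix c x v assume c: "c \<in> atlas M"
  show "linear (\<lambda>v. k * \<alpha> c x v)" if "x \<in> chart_image c"
    using linear_compose_scale_right[OF one_formD(1)[OF a c that], of k] by simp
  show "smooth_on (chart_image c) (\<lambda>x. k * \<alpha> c x v)"
    by (intro smooth_on_mult smooth_on_const wk_atlas_open[OF w c] one_formD(2)[OF a c])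
  fix d assume d: "d \<in> atlas M" and "x \<in> snd c ` (fst c \<inter> fst d)"
  then show "k * \<alpha> c x v = k * \<alpha> d (coord_expr c id d x) (fd (coord_expr c id d) x v)"
    using one_formD(3)[OF a c d] by auto
qed

lemma one_form_zero: "one_form M (\<lambda>c x v. 0)"
  by (auto simp: one_form_def smooth_on_const linear_iff)

lemma ext_d1_add:
  assumes a: "one_form M \<alpha>" and b: "one_form M \<beta>" and c: "c \<in> atlas M" and x: "x \<in> chart_image c"
  shows "ext_d1 (\<lambda>c x v. \<alpha> c x v + \<beta> c x v) c x v w = ext_d1 \<alpha> c x v w + ext_d1 \<beta> c x v w"
proof -
  have "fd (\<lambda>y. \<alpha> c y a + \<beta> c y a) x = (\<lambda>u. fd (\<lambda>y. \<alpha> c y a) x u + fd (\<lambda>y. \<beta> c y a) x u)" for a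
    by (rule frechet_derivativeI[OF has_derivative_add[OF smooth_on_has_derivative[OF one_formD(2)[OF a c] x]
      smooth_on_has_derivative[OF one_formD(2)[OF b c] x]]])
  then show ?thesis by (simp add: ext_d1_def)
qed

lemma ext_d1_scale:
  assumes a: "one_form M \<alpha>" and c: "c \<in> atlas M" and x: "x \<in> chart_image c"
  shows "ext_d1 (\<lambda>c x v. k * \<alpha> c x v) c x v w = k * ext_d1 \<alpha> c x v w"
proof -
  have "fd (\<lambda>y. k * \<alpha> c y a) x = (\<lambda>u. k * fd (\<lambda>y. \<alpha> c y a) x u)" for a
    by (rule frechet_derivativeI[OF has_derivative_mult_right[OF smooth_on_has_derivative[OF one_formD(2)[OF a c] x]]])
  then show ?thesis by (simp add: ext_d1_def algebra_simps)
qed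

lemma closed_two_formD:
  "closed_two_form M \<omega> \<Longrightarrow> two_form M \<omega>"
  "closed_two_form M \<omega> \<Longrightarrow> c \<in> atlas M \<Longrightarrow> x \<in> chart_image c \<Longrightarrow> ext_d2 \<omega> c x u v w = 0"
  by (auto simp: closed_two_form_def)

lemma closed_two_form_add:
  assumes w: "wk_atlas (atlas M)" and a: "closed_two_form M \<omega>" and b: "closed_two_form M \<eta>"
  shows "closed_two_form M (add_form2 \<omega> \<eta>)"
  unfolding closed_two_form_def two_form_def add_form2_def
proof (intro conjI ballI allI)
  note a' = closed_two_formD(1)[OF a] and b' = closed_two_formD(1)[OF b]
  fix c x v v' assume c: "c \<in> atlas M"
  show "bilinear (\<lambda>v v'. \<omega> c x v v' + \<eta> c x v v')" if "x \<in> chart_image c"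
    using two_formD(1)[OF a' c that] two_formD(1)[OF b' c that] by (auto simp: bilinear_def intro: linear_compose_add)
  show "\<omega> c x v v + \<eta> c x v v = 0" if "x \<in> chart_image c"
    using two_formD(2)[OF a' c that] two_formD(2)[OF b' c that] by simp
  show "smooth_on (chart_image c) (\<lambda>x. \<omega> c x v v' + \<eta> c x v v')"
    by (intro smooth_on_add wk_atlas_open[OF w c] two_formD(3)[OF a' c] two_formD(3)[OF b' c])
  show "\<omega> c x v v' + \<eta> c x v v' = \<omega> d (coord_expr c id d x) (fd (coord_expr c id d) x v) (fd (coord_expr c id d) x v')
     + \<eta> d (coord_expr c id d x) (fd (coord_expr c id d) x v) (fd (coord_expr c id d) x v')"
    if d: "d \<in> atlas M" and x: "x \<in> snd c ` (fst c \<inter> fst d)" for d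
    using x two_formD(4)[OF a' c d] two_formD(4)[OF b' c d] by auto
  fix u assume x: "x \<in> chart_image c"
  have "fd (\<lambda>y. \<omega> c y a b + \<eta> c y a b) x = (\<lambda>u. fd (\<lambda>y. \<omega> c y a b) x u + fd (\<lambda>y. \<eta> c y a b) x u)" for a b
    by (rule frechet_derivativeI[OF has_derivative_add[OF smooth_on_has_derivative[OF two_formD(3)[OF a' c] x]
      smooth_on_has_derivative[OF two_formD(3)[OF b' c] x]]])
  then show "ext_d2 (\<lambda>c x v w. \<omega> c x v w + \<eta> c x v w) c x u v v' = 0"
    using closed_two_formD(2)[OF a c x, of u v v'] closed_two_formD(2)[OF b c x, of u v v'] by (simp add: ext_d2_def)
qed

lemma closed_two_form_scale:
  assumes w: "wk_atlas (atlas M)" and a: "closed_two_form M \<omega>"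
  shows "closed_two_form M (scale_form2 k \<omega>)"
  unfolding closed_two_form_def two_form_def scale_form2_def
proof (intro conjI ballI allI)
  note a' = closed_two_formD(1)[OF a]
  fix c x v v' assume c: "c \<in> atlas M"
  show "bilinear (\<lambda>v v'. k * \<omega> c x v v')" if "x \<in> chart_image c"
    using two_formD(1)[OF a' c that] by (auto simp: bilinear_def linear_iff algebra_simps)
  show "k * \<omega> c x v v = 0" if "x \<in> chart_image c"
    using two_formD(2)[OF a' c that] by simp
  show "smooth_on (chart_image c) (\<lambda>x. k * \<omega> c x v v')"
    by (intro smooth_on_mult smooth_on_const wk_atlas_open[OF w c] two_formD(3)[OF a' c])
  show "k * \<omega> c x v v' = k * \<omega> d (coord_expr c id d x) (fd (coord_expr c id d) x v) (fd (coord_expr c id d) x v')"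
    if d: "d \<in> atlas M" and x: "x \<in> snd c ` (fst c \<inter> fst d)" for d
    using x two_formD(4)[OF a' c d] by auto
  fix u assume x: "x \<in> chart_image c"
  have "fd (\<lambda>y. k * \<omega> c y a b) x = (\<lambda>u. k * fd (\<lambda>y. \<omega> c y a b) x u)" for a b
    by (rule frechet_derivativeI[OF has_derivative_mult_right[OF smooth_on_has_derivative[OF two_formD(3)[OF a' c] x]]])
  then have "ext_d2 (\<lambda>c x v w. k * \<omega> c x v w) c x u v v' = k * ext_d2 \<omega> c x u v v'"
    by (simp add: ext_d2_def algebra_simps)
  then show "ext_d2 (\<lambda>c x v w. k * \<omega> c x v w) c x u v v' = 0"
    using closed_two_formD(2)[OF a c x, of u v v'] by simp
qed

lemma cohomologousI:
  assumes "closed_two_form M \<omega>" "closed_two_form M \<eta>" "one_form M \<alpha>"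
    "\<And>c x v w. c \<in> atlas M \<Longrightarrow> x \<in> chart_image c \<Longrightarrow> \<omega> c x v w = \<eta> c x v w + ext_d1 \<alpha> c x v w"
  shows "(\<omega>, \<eta>) \<in> cohomologous M"
  using assms by (auto simp: cohomologous_def eq_form2_def add_form2_def)

lemma cohomologousD:
  assumes "(\<omega>, \<eta>) \<in> cohomologous M"
  shows "\<exists>\<alpha>. closed_two_form M \<omega> \<and> closed_two_form M \<eta> \<and> one_form M \<alpha> \<and>
    (\<forall>c x v w. c \<in> atlas M \<longrightarrow> x \<in> chart_image c \<longrightarrow> \<omega> c x v w = \<eta> c x v w + ext_d1 \<alpha> c x v w)"
  using assms unfolding cohomologous_def eq_form2_def add_form2_def by blast

lemma ext_d1_zero: "ext_d1 (\<lambda>c x v. 0) c x v w = 0"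
  by (simp add: ext_d1_def)

lemma cohomologous_refl: "closed_two_form M \<omega> \<Longrightarrow> (\<omega>, \<omega>) \<in> cohomologous M"
  by (rule cohomologousI[OF _ _ one_form_zero]) (auto simp: ext_d1_zero)

lemma cohomologous_equiv:
  assumes w: "wk_atlas (atlas M)"
  shows "equiv (Collect (closed_two_form M)) (cohomologous M)"
proof (rule equivI)
  show "cohomologous M \<subseteq> Collect (closed_two_form M) \<times> Collect (closed_two_form M)"
    by (auto simp: cohomologous_def)
  show "refl_on (Collect (closed_two_form M)) (cohomologous M)"
    using cohomologous_refl by (auto intro!: refl_onI)
  show "sym (cohomologous M)"
  proof (rule symI)
    fix \<omega> \<eta> assume "(\<omega>, \<eta>) \<in> cohomologous M"
    from cohomologousD[OF this] obtain \<alpha> where a: "closed_two_form M \<omega>" "closed_two_form M \<eta>" "one_form M \<alpha>"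
       "\<And>c x v w. c \<in> atlas M \<Longrightarrow> x \<in> chart_image c \<Longrightarrow> \<omega> c x v w = \<eta> c x v w + ext_d1 \<alpha> c x v w"
      by blast
    show "(\<eta>, \<omega>) \<in> cohomologous M"
    proof (rule cohomologousI[OF a(2,1) one_form_scale[OF w a(3), of "-1"]])
      fix c x v w assume c: "c \<in> atlas M" "x \<in> chart_image c"
      show "\<eta> c x v w = \<omega> c x v w + ext_d1 (\<lambda>c x v. - 1 * \<alpha> c x v) c x v w"
        unfolding ext_d1_scale[OF a(3) c] a(4)[OF c] by simp
    qed
  qed
  show "trans (cohomologous M)"
  proof (rule transI)
    fix \<omega> \<eta> \<zeta> assume 1: "(\<omega>, \<eta>) \<in> cohomologous M" and 2: "(\<eta>, \<zeta>) \<in> cohomologous M"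
    obtain \<alpha> \<beta> where a: "closed_two_form M \<omega>" "closed_two_form M \<eta>" "one_form M \<alpha>"
       "\<And>c x v w. c \<in> atlas M \<Longrightarrow> x \<in> chart_image c \<Longrightarrow> \<omega> c x v w = \<eta> c x v w + ext_d1 \<alpha> c x v w"
      using cohomologousD[OF 1] by blast
    obtain \<beta> where b: "closed_two_form M \<eta>" "closed_two_form M \<zeta>" "one_form M \<beta>"
       "\<And>c x v w. c \<in> atlas M \<Longrightarrow> x \<in> chart_image c \<Longrightarrow> \<eta> c x v w = \<zeta> c x v w + ext_d1 \<beta> c x v w"
      using cohomologousD[OF 2] by blast
    show "(\<omega>, \<zeta>) \<in> cohomologous M"
    proof (rule cohomologousI[OF a(1) b(2) one_form_add[OF w b(3) a(3)]])
      fix c x v w assume c: "c \<in> atlas M" "x \<in> chart_image c"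
      show "\<omega> c x v w = \<zeta> c x v w + ext_d1 (\<lambda>c x v. \<beta> c x v + \<alpha> c x v) c x v w"
        unfolding ext_d1_add[OF b(3) a(3) c] a(4)[OF c] b(4)[OF c] by simp
    qed
  qed
qed

lemma cohomologous_add:
  assumes w: "wk_atlas (atlas M)" and 1: "(\<omega>, \<omega>') \<in> cohomologous M" and 2: "(\<eta>, \<eta>') \<in> cohomologous M"
  shows "(add_form2 \<omega> \<eta>, add_form2 \<omega>' \<eta>') \<in> cohomologous M"
proof -
  obtain \<alpha> where a: "closed_two_form M \<omega>" "closed_two_form M \<omega>'" "one_form M \<alpha>"
       "\<And>c x v w. c \<in> atlas M \<Longrightarrow> x \<in> chart_image c \<Longrightarrow> \<omega> c x v w = \<omega>' c x v w + ext_d1 \<alpha> c x v w"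
    using cohomologousD[OF 1] by blast
  obtain \<beta> where b: "closed_two_form M \<eta>" "closed_two_form M \<eta>'" "one_form M \<beta>"
       "\<And>c x v w. c \<in> atlas M \<Longrightarrow> x \<in> chart_image c \<Longrightarrow> \<eta> c x v w = \<eta>' c x v w + ext_d1 \<beta> c x v w"
    using cohomologousD[OF 2] by blast
  show ?thesis
  proof (rule cohomologousI[OF closed_two_form_add[OF w a(1) b(1)] closed_two_form_add[OF w a(2) b(2)] one_form_add[OF w a(3) b(3)]])
    fix c x v w assume c: "c \<in> atlas M" "x \<in> chart_image c"
    show "add_form2 \<omega> \<eta> c x v w = add_form2 \<omega>' \<eta>' c x v w + ext_d1 (\<lambda>c x v. \<alpha> c x v + \<beta> c x v) c x v w"
      unfolding ext_d1_add[OF a(3) b(3) c] add_form2_def a(4)[OF c] b(4)[OF c] by simp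
  qed
qed

lemma cohomologous_scale:
  assumes w: "wk_atlas (atlas M)" and 1: "(\<omega>, \<omega>') \<in> cohomologous M"
  shows "(scale_form2 k \<omega>, scale_form2 k \<omega>') \<in> cohomologous M"
proof -
  obtain \<alpha> where a: "closed_two_form M \<omega>" "closed_two_form M \<omega>'" "one_form M \<alpha>"
       "\<And>c x v w. c \<in> atlas M \<Longrightarrow> x \<in> chart_image c \<Longrightarrow> \<omega> c x v w = \<omega>' c x v w + ext_d1 \<alpha> c x v w"
    using cohomologousD[OF 1] by blast
  show ?thesis
  proof (rule cohomologousI[OF closed_two_form_scale[OF w a(1)] closed_two_form_scale[OF w a(2)] one_form_scale[OF w a(3)]])
    fix c x v w assume c: "c \<in> atlas M" "x \<in> chart_image c"
    show "scale_form2 k \<omega> c x v w = scale_form2 k \<omega>' c x v w + ext_d1 (\<lambda>c x v. k * \<alpha> c x v) c x v w"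
      unfolding ext_d1_scale[OF a(3) c] scale_form2_def a(4)[OF c] by (simp add: distrib_left)
  qed
qed

text \<open>Coordinate families carry meaning on chart images only, so the additivity is assumed
  just there; the chart selected by \<open>pb2\<close> contains the point, which places the
  evaluation inside.\<close>

lemma pb2_add:
  fixes N :: "('b, 'f::real_inner) manifold" and \<phi> :: "'x::real_inner \<Rightarrow> 'b"
  assumes sp: "smooth_param N X \<phi>" and x: "x \<in> X"
    and e: "\<And>c x v w. c \<in> atlas N \<Longrightarrow> x \<in> chart_image c \<Longrightarrow> \<omega> c x v w = \<eta> c x v w + \<zeta> c x v w"
  shows "pb2 N \<phi> \<omega> x v w = pb2 N \<phi> \<eta> x v w + pb2 N \<phi> \<zeta> x v w"
  unfolding pb2_def Let_def using some_chart[OF sp x] by (intro e) auto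

lemma cohomologous_pullback:
  fixes M :: "('a, 'e::real_inner) manifold" and N :: "('b, 'f::real_inner) manifold"
  assumes wM: "wk_atlas (atlas M)" and wN: "wk_atlas (atlas N)" and fin: "findim TYPE('e)" "findim TYPE('f)"
    and f: "chart_smooth M N f" and 1: "(\<omega>, \<omega>') \<in> cohomologous N"
  shows "(pullback2 M N f \<omega>, pullback2 M N f \<omega>') \<in> cohomologous M"
proof -
  note pf = pullback_forms[OF wM wN fin f]
  obtain \<alpha> where a: "closed_two_form N \<omega>" "closed_two_form N \<omega>'" "one_form N \<alpha>"
       "\<And>c x v w. c \<in> atlas N \<Longrightarrow> x \<in> chart_image c \<Longrightarrow> \<omega> c x v w = \<omega>' c x v w + ext_d1 \<alpha> c x v w"
    using cohomologousD[OF 1] by blast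
  show ?thesis
  proof (rule cohomologousI[OF pf(3)[OF a(1)] pf(3)[OF a(2)] pf(1)[OF a(3)]])
    fix c x v w assume c: "c \<in> atlas M" "x \<in> chart_image c"
    have sp: "smooth_param N (chart_image c) (\<lambda>x. f (chart_inv c x))" using f c by (simp add: chart_smooth_def)
    show "pullback2 M N f \<omega> c x v w = pullback2 M N f \<omega>' c x v w + ext_d1 (pullback1 M N f \<alpha>) c x v w"
      using pf(4)[OF a(3)] c pb2_add[OF sp c(2) a(4)] unfolding eq_form2_def pullback2_pb2 by auto
  qed
qed

text \<open>The operations on classes are unions over representatives. Each union collapses to the
  class of one representative: all members give the same class because the operation respects
  \<open>cohomologous\<close>, and the class contains its representative by reflexivity.\<close>

lemma class_arithmetic:
  fixes M :: "('a, 'e::real_inner) manifold" and N :: "('b, 'f::real_inner) manifold"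
  assumes wM: "wk_atlas (atlas M)" and wN: "wk_atlas (atlas N)" and fin: "findim TYPE('e)" "findim TYPE('f)"
    and f: "chart_smooth M N f" and \<omega>: "closed_two_form M \<omega>" and \<eta>: "closed_two_form N \<eta>"
  shows "add_class M (coh_class M \<omega>) (scale_class M k (pullback_class M N f (coh_class N \<eta>))) =
    coh_class M (add_form2 \<omega> (scale_form2 k (pullback2 M N f \<eta>)))"
proof -
  note eM = cohomologous_equiv[OF wM] and eN = cohomologous_equiv[OF wN]
  have cl: "closed_two_form M (pullback2 M N f \<eta>)" by (rule pullback_forms(3)[OF wM wN fin f \<eta>])
  let ?\<zeta> = "pullback2 M N f \<eta>"
  have eqc: "coh_class M a = coh_class M b" if "(a, b) \<in> cohomologous M" for a b
    using equiv_class_eq[OF eM that] by (simp add: coh_class_def)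
  have UNc: "(\<Union>a\<in>coh_class L b. g a) = g b" if "closed_two_form L b" "\<And>a. (b, a) \<in> cohomologous L \<Longrightarrow> g a = g b"
    for L :: "('q, 'r::real_normed_vector) manifold" and b and g :: "_ \<Rightarrow> 's set"
    using cohomologous_refl[OF that(1)] that(2) unfolding coh_class_def by blast
  have symM: "(b, a) \<in> cohomologous M" if "(a, b) \<in> cohomologous M" for a b
    using eM that by (meson equivE symD)
  have p: "pullback_class M N f (coh_class N \<eta>) = coh_class M ?\<zeta>"
    unfolding pullback_class_def
    by (rule UNc[OF \<eta>]) (rule eqc[OF symM[OF cohomologous_pullback[OF wM wN fin f]]])
  have s: "scale_class M k (coh_class M ?\<zeta>) = coh_class M (scale_form2 k ?\<zeta>)"
    unfolding scale_class_def
    by (rule UNc[OF cl]) (rule eqc[OF symM[OF cohomologous_scale[OF wM]]])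
  have cls: "closed_two_form M (scale_form2 k ?\<zeta>)" by (rule closed_two_form_scale[OF wM cl])
  have "add_class M (coh_class M \<omega>) (coh_class M (scale_form2 k ?\<zeta>)) =
    (\<Union>\<eta>\<in>coh_class M (scale_form2 k ?\<zeta>). coh_class M (add_form2 \<omega> \<eta>))"
    unfolding add_class_def
    by (rule UNc[OF \<omega>], rule SUP_cong[OF refl], rule eqc[OF symM[OF cohomologous_add[OF wM _ cohomologous_refl]]])
      (auto simp: coh_class_def cohomologous_def)
  also have "\<dots> = coh_class M (add_form2 \<omega> (scale_form2 k ?\<zeta>))"
    by (rule UNc[OF cls]) (rule eqc[OF symM[OF cohomologous_add[OF wM cohomologous_refl[OF \<omega>]]]])
  finally show ?thesis unfolding p s .
qed

section \<open>From topological atlases to the topology-free notions\<close>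

lemma chart_open_image:
  assumes "smooth_atlas X A" "c \<in> A" "openin X W"
  shows "open (snd c ` (fst c \<inter> W))"
proof -
  have c: "openin X (fst c)" "open (chart_image c)" "homeomorphic_map (subtopology X (fst c)) (top_of_set (chart_image c)) (snd c)"
    using assms unfolding smooth_atlas_def by auto
  have "openin (subtopology X (fst c)) (fst c \<inter> W)" using assms(3) by (simp add: openin_subtopology_Int2)
  then have "openin (top_of_set (chart_image c)) (snd c ` (fst c \<inter> W))"
    using homeomorphic_imp_open_map[OF c(3)] by (simp add: open_map_def)
  then show ?thesis using c(2) openin_open_trans by blast
qed

lemma smooth_atlas_domain:
  assumes "smooth_atlas X A" "c \<in> A"
  shows "openin X (fst c)" "fst c \<subseteq> topspace X" "inj_on (snd c) (fst c)"
proof -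
  show o: "openin X (fst c)" using assms unfolding smooth_atlas_def by auto
  then show s: "fst c \<subseteq> topspace X" by (rule openin_subset)
  have "inj_on (snd c) (topspace (subtopology X (fst c)))"
    using assms unfolding smooth_atlas_def by (intro homeomorphic_imp_injective_map) auto
  then show "inj_on (snd c) (fst c)" using s by (simp add: topspace_subtopology Int_absorb1)
qed

lemma smooth_atlas_cover: "smooth_atlas X A \<Longrightarrow> x \<in> topspace X \<Longrightarrow> \<exists>c\<in>A. x \<in> fst c"
  unfolding smooth_atlas_def by blast

lemma smooth_atlas_imp_wk:
  assumes "smooth_atlas X A" shows "wk_atlas A"
  unfolding wk_atlas_def
proof (intro conjI ballI)
  fix c assume c: "c \<in> A"
  show "inj_on (snd c) (fst c)" by (rule smooth_atlas_domain[OF assms c])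
  fix d assume d: "d \<in> A"
  show "open (snd c ` (fst c \<inter> fst d))" by (rule chart_open_image[OF assms c smooth_atlas_domain(1)[OF assms d]])
  show "smooth_on (snd c ` (fst c \<inter> fst d)) (coord_expr c id d)" using assms c d by (simp add: smooth_atlas_def)
qed

text \<open>Continuity of f supplies the open preimages that \<open>smooth_param\<close> asks
  for.\<close>

lemma smooth_map_chart_smooth:
  assumes M: "smooth_atlas (mtop M) (atlas M)" and N: "smooth_atlas (mtop N) (atlas N)" and f: "smooth_map M N f"
  shows "chart_smooth M N f"
  unfolding chart_smooth_def smooth_param_def
proof (intro ballI conjI)
  fix c assume c: "c \<in> atlas M"
  have cont: "continuous_map (mtop M) (mtop N) f" using f by (simp add: smooth_map_def)
  show "open (chart_image c)" using M c unfolding smooth_atlas_def by auto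
  fix x assume x: "x \<in> chart_image c"
  then have "chart_inv c x \<in> points M" using smooth_atlas_domain(2)[OF M c] inv_into_into[OF x] by auto
  then have "f (chart_inv c x) \<in> points N" using cont by (auto simp: continuous_map_def)
  then show "\<exists>d\<in>atlas N. f (chart_inv c x) \<in> fst d" by (rule smooth_atlas_cover[OF N])
next
  fix c d assume c: "c \<in> atlas M" and d: "d \<in> atlas N"
  have cont: "continuous_map (mtop M) (mtop N) f" using f by (simp add: smooth_map_def)
  have i: "chart_inv c (snd c x) = x" if "x \<in> fst c" for x
    using smooth_atlas_domain(3)[OF M c] that by simp
  have e: "chart_image c \<inter> (\<lambda>x. f (chart_inv c x)) -` fst d = snd c ` (fst c \<inter> f -` fst d)"
    using i by force
  have "snd c ` (fst c \<inter> f -` fst d) = snd c ` (fst c \<inter> {x \<in> points M. f x \<in> fst d})"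
    using smooth_atlas_domain(2)[OF M c] by auto
  then show "open (chart_image c \<inter> (\<lambda>x. f (chart_inv c x)) -` fst d)" unfolding e
    using chart_open_image[OF M c openin_continuous_map_preimage[OF cont smooth_atlas_domain(1)[OF N d]]] by simp
  show "smooth_on (chart_image c \<inter> (\<lambda>x. f (chart_inv c x)) -` fst d) (\<lambda>x. snd d (f (chart_inv c x)))"
    unfolding e using f c d unfolding smooth_map_def coord_expr_def by blast
qed

section \<open>Trivializations and fibres\<close>

lemma chart_inv_continuous:
  assumes "smooth_atlas X A" "c \<in> A"
  shows "continuous_map (top_of_set (chart_image c)) X (chart_inv c)"
  unfolding continuous_map_def
proof (intro conjI allI impI)
  show "chart_inv c \<in> topspace (top_of_set (chart_image c)) \<rightarrow> topspace X"
  proof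
    fix x assume "x \<in> topspace (top_of_set (chart_image c))"
    then have "chart_inv c x \<in> fst c" by (intro inv_into_into) simp
    then show "chart_inv c x \<in> topspace X" using smooth_atlas_domain(2)[OF assms] by blast
  qed
  fix W assume W: "openin X W"
  have "{x \<in> topspace (top_of_set (chart_image c)). chart_inv c x \<in> W} = snd c ` (fst c \<inter> W)"
    using smooth_atlas_domain(3)[OF assms] by (auto simp: image_iff)
  then show "openin (top_of_set (chart_image c)) {x \<in> topspace (top_of_set (chart_image c)). chart_inv c x \<in> W}"
    using chart_open_image[OF assms W] open_subset[of "snd c ` (fst c \<inter> W)" "chart_image c"] by auto
qed

lemma product_chart:
  "c \<in> atlas L \<Longrightarrow> d \<in> atlas N \<Longrightarrow> (fst c \<times> fst d, map_prod (snd c) (snd d)) \<in> atlas (product_manifold L N)"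
  unfolding product_manifold_def manifold.select_convs by (rule CollectI, rule exI[of _ c], rule exI[of _ d]) simp

lemma sub_chart: "c \<in> atlas L \<Longrightarrow> (fst c \<inter> U, snd c) \<in> atlas (open_submanifold L U)"
  unfolding open_submanifold_def manifold.select_convs by (rule CollectI, rule exI[of _ c]) simp

lemma smooth_map_coord:
  assumes "smooth_map M N f" "c \<in> atlas M" "d \<in> atlas N"
  shows "smooth_on (snd c ` (fst c \<inter> f -` fst d)) (coord_expr c f d)"
  using assms unfolding smooth_map_def by blast

definition fibre_chart :: "('m, 'e) manifold \<Rightarrow> ('m \<Rightarrow> 'b) \<Rightarrow> 'b \<Rightarrow> 'b set \<times> ('m \<Rightarrow> 'b \<times> 'f) \<Rightarrow> ('f, 'v) chart \<Rightarrow> ('m, 'v) chart" where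
  "fibre_chart M p b t d = ({x \<in> points M \<inter> p -` {b}. snd (snd t x) \<in> fst d}, \<lambda>x. snd d (snd (snd t x)))"

lemma atlas_fibre: "atlas (fibre M F p T b) = {fibre_chart M p b t d |t d. t \<in> T \<and> b \<in> fst t \<and> d \<in> atlas F}"
  by (simp add: fibre_def fibre_chart_def)

locale symp_fib =
  fixes M :: "('m, 'e::real_inner) manifold" and B :: "('b, 'h::real_inner) manifold"
    and F :: "('f, 'v::real_inner) manifold" and \<omega>\<^sub>0 :: "('f, 'v) form2"
    and p :: "'m \<Rightarrow> 'b" and T :: "('b set \<times> ('m \<Rightarrow> 'b \<times> 'f)) set"
  assumes fib: "symplectic_fibration M B F \<omega>\<^sub>0 p T"
begin

text \<open>The inverse of a trivialization in curried form, written as in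
  \<open>symplectic_fibration\<close> so that the transition maps there become expressions in
  \<open>glue\<close>.\<close>

definition glue :: "'b set \<times> ('m \<Rightarrow> 'b \<times> 'f) \<Rightarrow> 'b \<Rightarrow> 'f \<Rightarrow> 'm" where
  "glue t b y = inv_into (points M \<inter> p -` fst t) (snd t) (b, y)"

abbreviation tube :: "'b set \<times> ('m \<Rightarrow> 'b \<times> 'f) \<Rightarrow> 'm set" where
  "tube t \<equiv> points M \<inter> p -` fst t"

lemma manifolds: "smooth_manifold M" "smooth_manifold B" "smooth_manifold F" and p_smooth: "smooth_map M B p"
  and symp: "symplectic_form F \<omega>\<^sub>0" and triv: "\<And>t. t \<in> T \<Longrightarrow> local_trivialization M B F p t"
  and cover: "(\<Union>t\<in>T. fst t) = points B"
  and trans_symp: "\<And>t s b. t \<in> T \<Longrightarrow> s \<in> T \<Longrightarrow> b \<in> fst t \<Longrightarrow> b \<in> fst s \<Longrightarrow>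
     symplectomorphism F \<omega>\<^sub>0 (\<lambda>y. snd (snd s (glue t b y)))"
  using fib unfolding symplectic_fibration_def glue_def by auto

lemma atlases: "smooth_atlas (mtop M) (atlas M)" "smooth_atlas (mtop B) (atlas B)" "smooth_atlas (mtop F) (atlas F)"
  using manifolds by (auto simp: smooth_manifold_def)

lemmas wkM = smooth_atlas_imp_wk[OF atlases(1)]
lemmas wkB = smooth_atlas_imp_wk[OF atlases(2)]
lemmas wkF = smooth_atlas_imp_wk[OF atlases(3)]

lemma findims: "findim TYPE('e)" "findim TYPE('h)" "findim TYPE('v)"
  using manifolds by (auto simp: smooth_manifold_def findim_def)

lemma chart_smooth_p: "chart_smooth M B p"
  by (rule smooth_map_chart_smooth[OF atlases(1,2) p_smooth])

lemma closed_\<omega>\<^sub>0: "closed_two_form F \<omega>\<^sub>0" using symp by (simp add: symplectic_form_def)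
lemmas two_form_\<omega>\<^sub>0 = closed_two_formD(1)[OF closed_\<omega>\<^sub>0]

lemma continuous_p: "continuous_map (mtop M) (mtop B) p" using p_smooth by (simp add: smooth_map_def)

lemma p_in: "x \<in> points M \<Longrightarrow> p x \<in> points B" using continuous_p by (auto simp: continuous_map_def)

lemma fst_T: "t \<in> T \<Longrightarrow> openin (mtop B) (fst t)" "t \<in> T \<Longrightarrow> fst t \<subseteq> points B"
  using triv[of t] openin_subset by (auto simp: local_trivialization_def)

lemma tube_open: "t \<in> T \<Longrightarrow> openin (mtop M) (tube t)"
  using openin_continuous_map_preimage[OF continuous_p fst_T(1)] by (simp add: vimage_def Collect_conj_eq)

lemma base_preimage_open: "openin (mtop B) U \<Longrightarrow> openin (mtop M) (points M \<inter> p -` U)"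
  using openin_continuous_map_preimage[OF continuous_p] by (simp add: vimage_def Collect_conj_eq)

lemma triv_smooth:
  assumes t: "t \<in> T"
  shows "smooth_map (open_submanifold M (tube t)) (product_manifold (open_submanifold B (fst t)) F) (snd t)"
    "\<exists>q. smooth_map (product_manifold (open_submanifold B (fst t)) F) (open_submanifold M (tube t)) q \<and>
       (\<forall>x\<in>tube t. q (snd t x) = x) \<and> (\<forall>z\<in>fst t \<times> points F. snd t (q z) = z \<and> q z \<in> tube t)"
proof -
  have d: "diffeomorphism (open_submanifold M (tube t)) (product_manifold (open_submanifold B (fst t)) F) (snd t)"
    using triv[OF t] by (simp add: local_trivialization_def)
  then show "smooth_map (open_submanifold M (tube t)) (product_manifold (open_submanifold B (fst t)) F) (snd t)"
    by (simp add: diffeomorphism_def)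
  have pp: "points (product_manifold (open_submanifold B (fst t)) F) = fst t \<times> points F"
    using fst_T(2)[OF t] by (auto simp: product_manifold_def open_submanifold_def)
  have pm: "points (open_submanifold M (tube t)) = tube t" by (auto simp: open_submanifold_def)
  obtain q where q: "smooth_map (product_manifold (open_submanifold B (fst t)) F) (open_submanifold M (tube t)) q"
    "\<forall>x\<in>tube t. q (snd t x) = x" "\<forall>z\<in>fst t \<times> points F. snd t (q z) = z"
    using d unfolding diffeomorphism_def pp pm by blast
  have "q z \<in> tube t" if "z \<in> fst t \<times> points F" for z
    using q(1) that pp pm unfolding smooth_map_def continuous_map_def by blast
  then show "\<exists>q. smooth_map (product_manifold (open_submanifold B (fst t)) F) (open_submanifold M (tube t)) q \<and>
       (\<forall>x\<in>tube t. q (snd t x) = x) \<and> (\<forall>z\<in>fst t \<times> points F. snd t (q z) = z \<and> q z \<in> tube t)"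
    using q by blast
qed

lemma triv_in: "t \<in> T \<Longrightarrow> x \<in> tube t \<Longrightarrow> snd (snd t x) \<in> points F"
proof -
  assume t: "t \<in> T" and x: "x \<in> tube t"
  have "snd t x \<in> points (product_manifold (open_submanifold B (fst t)) F)"
    using triv_smooth(1)[OF t] x unfolding smooth_map_def continuous_map_def by (auto simp: open_submanifold_def)
  then show ?thesis by (auto simp: product_manifold_def)
qed

lemma triv_fst: "t \<in> T \<Longrightarrow> x \<in> tube t \<Longrightarrow> snd t x = (p x, snd (snd t x))"
  using triv[of t] by (simp add: local_trivialization_def prod_eq_iff)

lemma triv_fst': "t \<in> T \<Longrightarrow> x \<in> tube t \<Longrightarrow> fst (snd t x) = p x"
  using triv[of t] by (simp add: local_trivialization_def)

lemma triv_inj: "t \<in> T \<Longrightarrow> inj_on (snd t) (tube t)"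
  using triv_smooth(2) by (metis inj_on_inverseI)

lemma glue_triv: "t \<in> T \<Longrightarrow> x \<in> tube t \<Longrightarrow> glue t (p x) (snd (snd t x)) = x"
  unfolding glue_def using triv_fst triv_inj by (metis inv_into_f_f)

lemma glue_in:
  assumes t: "t \<in> T" and b: "b \<in> fst t" and y: "y \<in> points F"
  shows "glue t b y \<in> tube t" "snd t (glue t b y) = (b, y)" "p (glue t b y) = b"
proof -
  obtain q where "\<forall>z\<in>fst t \<times> points F. snd t (q z) = z \<and> q z \<in> tube t" using triv_smooth(2)[OF t] by blast
  then have "(b, y) \<in> snd t ` tube t" using b y by (metis SigmaI image_eqI)
  then show 1: "glue t b y \<in> tube t" "snd t (glue t b y) = (b, y)"
    unfolding glue_def by (rule inv_into_into, rule f_inv_into_f)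
  then show "p (glue t b y) = b" using triv_fst[OF t 1(1)] by simp
qed

text \<open>Describes the trivialization in an unrestricted chart of M, whereas the diffeomorphism
  speaks of charts cut down to the tube. The work lies in passing from one to the other.\<close>

lemma triv_chart:
  assumes t: "t \<in> T" and c: "c \<in> atlas M" and cB: "cB \<in> atlas B" and d: "d \<in> atlas F"
  defines "W \<equiv> {x \<in> tube t. p x \<in> fst cB \<and> snd (snd t x) \<in> fst d}"
  shows "openin (mtop M) W" "open (snd c ` (fst c \<inter> W))"
    "smooth_on (snd c ` (fst c \<inter> W)) (\<lambda>x. (snd cB (p (chart_inv c x)), snd d (snd (snd t (chart_inv c x)))))"
proof -
  let ?S = "open_submanifold M (tube t)" and ?P = "product_manifold (open_submanifold B (fst t)) F"
  let ?D = "(fst cB \<inter> fst t) \<times> fst d"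
  have cont: "continuous_map (subtopology (mtop M) (tube t)) (mtop ?P) (snd t)"
    using triv_smooth(1)[OF t] by (simp add: smooth_map_def open_submanifold_def)
  have W: "W = {x \<in> tube t. snd t x \<in> ?D}"
    unfolding W_def using triv_fst'[OF t] by (auto simp: mem_Times_iff)
  have "openin (mtop ?P) ?D"
    using smooth_atlas_domain(1)[OF atlases(2) cB] smooth_atlas_domain(1)[OF atlases(3) d]
    by (simp add: product_manifold_def open_submanifold_def openin_prod_Times_iff openin_subtopology_Int)
  from openin_continuous_map_preimage[OF cont this]
  have "openin (subtopology (mtop M) (tube t)) W" unfolding W by (simp add: Int_absorb1)
  then show o: "openin (mtop M) W" using tube_open[OF t] openin_trans_full by blast
  then show op: "open (snd c ` (fst c \<inter> W))" by (rule chart_open_image[OF atlases(1) c])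
  have "smooth_on (snd c ` ((fst c \<inter> tube t) \<inter> snd t -` ?D))
     (coord_expr (fst c \<inter> tube t, snd c) (snd t) (?D, map_prod (snd cB) (snd d)))"
    using smooth_map_coord[OF triv_smooth(1)[OF t] sub_chart[OF c] product_chart[OF sub_chart[OF cB] d]]
    by (simp only: fst_conv snd_conv)
  moreover have "(fst c \<inter> tube t) \<inter> snd t -` ?D = fst c \<inter> W" unfolding W by auto
  ultimately have "smooth_on (snd c ` (fst c \<inter> W)) (coord_expr (fst c \<inter> tube t, snd c) (snd t) (?D, map_prod (snd cB) (snd d)))"
    by simp
  then show "smooth_on (snd c ` (fst c \<inter> W)) (\<lambda>x. (snd cB (p (chart_inv c x)), snd d (snd (snd t (chart_inv c x)))))"
  proof (rule smooth_on_cong[OF op])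
    fix x assume "x \<in> snd c ` (fst c \<inter> W)"
    then obtain z where z: "z \<in> fst c" "z \<in> W" "x = snd c z" by auto
    have zt: "z \<in> tube t" using z by (simp add: W_def)
    have inj: "inj_on (snd c) (fst c)" by (rule smooth_atlas_domain[OF atlases(1) c])
    \<comment> \<open>Cutting down the domain of a chart changes its inverse function only off the
      smaller image.\<close>
    have "inv_into (fst c \<inter> tube t) (snd c) x = z"
      using z zt by (metis IntI Int_lower1 inj inj_on_subset inv_into_f_f)
    moreover have "chart_inv c x = z" using z inj by simp
    ultimately show "coord_expr (fst c \<inter> tube t, snd c) (snd t) (?D, map_prod (snd cB) (snd d)) x =
       (snd cB (p (chart_inv c x)), snd d (snd (snd t (chart_inv c x))))"
      using triv_fst'[OF t zt] by (simp add: coord_expr_def map_prod_def split_beta)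
  qed
qed

definition glue_chart :: "'b set \<times> ('m \<Rightarrow> 'b \<times> 'f) \<Rightarrow> ('b, 'h) chart \<Rightarrow> ('f, 'v) chart \<Rightarrow> 'h \<times> 'v \<Rightarrow> 'm" where
  "glue_chart t cB d = (\<lambda>z. glue t (chart_inv cB (fst z)) (chart_inv d (snd z)))"

lemma chart_F_in: "d \<in> atlas F \<Longrightarrow> y \<in> chart_image d \<Longrightarrow> chart_inv d y \<in> points F"
  by (metis atlases(3) inv_into_into smooth_atlas_domain(2) subsetD)

lemma base_chart_inv:
  assumes "cB \<in> atlas B" "x \<in> snd cB ` (fst cB \<inter> U)"
  shows "chart_inv cB x \<in> fst cB \<inter> U" "snd cB (chart_inv cB x) = x"
  using assms smooth_atlas_domain(3)[OF atlases(2) assms(1)] by auto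

lemma glue_chart_param:
  assumes t: "t \<in> T" and cB: "cB \<in> atlas B" and d: "d \<in> atlas F"
  shows "smooth_param M ((snd cB ` (fst cB \<inter> fst t)) \<times> chart_image d) (glue_chart t cB d)"
proof -
  let ?S = "open_submanifold M (tube t)" and ?P = "product_manifold (open_submanifold B (fst t)) F"
  let ?D = "(fst cB \<inter> fst t) \<times> fst d" and ?BU = "snd cB ` (fst cB \<inter> fst t)"
  let ?X = "?BU \<times> chart_image d"
  obtain q where q: "smooth_map ?P ?S q" "\<And>x. x\<in>tube t \<Longrightarrow> q (snd t x) = x"
     "\<And>z. z \<in> fst t \<times> points F \<Longrightarrow> snd t (q z) = z \<and> q z \<in> tube t" using triv_smooth(2)[OF t] by blast
  have opB: "open ?BU" by (rule chart_open_image[OF atlases(2) cB fst_T(1)[OF t]])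
  have opX: "open ?X" using opB wk_atlas_open[OF wkF d] by (simp add: open_Times)
  \<comment> \<open>Smoothness is known for the inverse q that comes with the diffeomorphism, while
    \<open>glue\<close> is defined by choice. They agree here because \<open>glue\<close> lands in
    the tube, where q undoes the trivialization.\<close>
  have gq: "glue_chart t cB d z = q (chart_inv cB (fst z), chart_inv d (snd z))" if "z \<in> ?X" for z
  proof -
    have 1: "chart_inv cB (fst z) \<in> fst t" "chart_inv d (snd z) \<in> points F"
      using base_chart_inv[OF cB, of "fst z" "fst t"] chart_F_in[OF d, of "snd z"] that by (auto simp: mem_Times_iff)
    then show ?thesis unfolding glue_chart_def
      using glue_in[OF t 1] q(2) by metis
  qed
  have contq: "continuous_map (prod_topology (subtopology (mtop B) (fst t)) (mtop F)) (mtop M) q"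
    using q(1) by (simp add: smooth_map_def product_manifold_def open_submanifold_def continuous_map_in_subtopology)
  have "continuous_map (top_of_set ?X) (prod_topology (subtopology (mtop B) (fst t)) (mtop F)) (\<lambda>z. (chart_inv cB (fst z), chart_inv d (snd z)))"
  proof (intro continuous_map_pairedI)
    have "continuous_map (top_of_set ?X) (top_of_set (chart_image cB)) fst"
      by (auto intro!: continuous_intros)
    from continuous_map_compose[OF this chart_inv_continuous[OF atlases(2) cB]]
    show "continuous_map (top_of_set ?X) (subtopology (mtop B) (fst t)) (\<lambda>z. chart_inv cB (fst z))"
      using base_chart_inv[OF cB, of _ "fst t"] by (auto simp: continuous_map_in_subtopology o_def)
    have "continuous_map (top_of_set ?X) (top_of_set (chart_image d)) snd"
      by (auto intro!: continuous_intros)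
    from continuous_map_compose[OF this chart_inv_continuous[OF atlases(3) d]]
    show "continuous_map (top_of_set ?X) (mtop F) (\<lambda>z. chart_inv d (snd z))" by (simp add: o_def)
  qed
  from continuous_map_compose[OF this contq]
  have cont: "continuous_map (top_of_set ?X) (mtop M) (glue_chart t cB d)"
    by (rule continuous_map_eq) (simp add: gq)
  have inM: "glue_chart t cB d z \<in> tube t" if "z \<in> ?X" for z
    unfolding glue_chart_def
    using base_chart_inv[OF cB, of "fst z" "fst t"] chart_F_in[OF d, of "snd z"] that
    by (intro glue_in[OF t]) (auto simp: mem_Times_iff)
  show ?thesis unfolding smooth_param_def
  proof (intro conjI ballI opX)
    fix z assume "z \<in> ?X"
    then show "\<exists>c\<in>atlas M. glue_chart t cB d z \<in> fst c" using inM smooth_atlas_cover[OF atlases(1)] by blast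
  next
    fix c assume c: "c \<in> atlas M"
    have "openin (top_of_set ?X) {z \<in> topspace (top_of_set ?X). glue_chart t cB d z \<in> fst c}"
      by (rule openin_continuous_map_preimage[OF cont smooth_atlas_domain(1)[OF atlases(1) c]])
    moreover have "{z \<in> topspace (top_of_set ?X). glue_chart t cB d z \<in> fst c} = ?X \<inter> glue_chart t cB d -` fst c" by auto
    ultimately show op: "open (?X \<inter> glue_chart t cB d -` fst c)" unfolding openin_open_eq[OF opX] by simp
    have "smooth_on (map_prod (snd cB) (snd d) ` (?D \<inter> q -` (fst c \<inter> tube t)))
      (coord_expr (?D, map_prod (snd cB) (snd d)) q (fst c \<inter> tube t, snd c))"
      using smooth_map_coord[OF q(1) product_chart[OF sub_chart[OF cB] d] sub_chart[OF c]]
      by (simp only: fst_conv snd_conv)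

    moreover have inv: "inv_into ?D (map_prod (snd cB) (snd d)) z = (chart_inv cB (fst z), chart_inv d (snd z))" if "z \<in> ?X" for z
    proof (rule inv_into_f_eq)
      have "inj_on (map_prod (snd cB) (snd d)) (fst cB \<times> fst d)"
        by (rule map_prod_inj_on[OF smooth_atlas_domain(3)[OF atlases(2) cB] smooth_atlas_domain(3)[OF atlases(3) d]])
      then show "inj_on (map_prod (snd cB) (snd d)) ?D" by (rule inj_on_subset) auto
      show "(chart_inv cB (fst z), chart_inv d (snd z)) \<in> ?D" "map_prod (snd cB) (snd d) (chart_inv cB (fst z), chart_inv d (snd z)) = z"
        using base_chart_inv[OF cB, of "fst z" "fst t"] that inv_into_into[of "snd z" "snd d" "fst d"] f_inv_into_f[of "snd z" "snd d" "fst d"]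
        by (auto simp: mem_Times_iff prod_eq_iff)
    qed
    moreover have "map_prod (snd cB) (snd d) ` (?D \<inter> q -` (fst c \<inter> tube t)) = ?X \<inter> glue_chart t cB d -` fst c" (is "?L = ?R")
    proof
      show "?L \<subseteq> ?R"
      proof
        fix z assume "z \<in> ?L"
        then obtain b y where bb: "b \<in> fst cB" "b \<in> fst t" "y \<in> fst d" "q (b, y) \<in> fst c" "z = (snd cB b, snd d y)" by auto
        then have zX: "z \<in> ?X" by auto
        have "(chart_inv cB (fst z), chart_inv d (snd z)) = (b, y)"
          using bb smooth_atlas_domain(3)[OF atlases(2) cB] smooth_atlas_domain(3)[OF atlases(3) d] by simp
        then show "z \<in> ?R" using zX gq[OF zX] bb by simp
      qed
      show "?R \<subseteq> ?L"
      proof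
        fix z assume z: "z \<in> ?R"
        then have zX: "z \<in> ?X" by simp
        let ?w = "(chart_inv cB (fst z), chart_inv d (snd z))"
        have "?w \<in> ?D" and "map_prod (snd cB) (snd d) ?w = z"
          using base_chart_inv[OF cB, of "fst z" "fst t"] zX inv_into_into[of "snd z" "snd d" "fst d"] f_inv_into_f[of "snd z" "snd d" "fst d"]
          by (auto simp: mem_Times_iff prod_eq_iff)
        moreover have "q ?w \<in> fst c \<inter> tube t" using z gq[OF zX] inM[OF zX] by simp
        ultimately show "z \<in> ?L" by (intro image_eqI[of _ _ ?w] IntI vimageI2) simp_all
      qed
    qed
    ultimately have "smooth_on (?X \<inter> glue_chart t cB d -` fst c) (coord_expr (?D, map_prod (snd cB) (snd d)) q (fst c \<inter> tube t, snd c))"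
      by simp
    then show "smooth_on (?X \<inter> glue_chart t cB d -` fst c) (\<lambda>z. snd c (glue_chart t cB d z))"
      by (rule smooth_on_cong[OF op]) (simp add: coord_expr_def inv gq)
  qed
qed
end

section \<open>The fibres: charts, symplectic form and inclusion\<close>

context symp_fib begin

definition trans_map where "trans_map t s b y = snd (snd s (glue t b y))"

lemma trans_map_symp:
  assumes "t \<in> T" "s \<in> T" "b \<in> fst t" "b \<in> fst s"
  shows "smooth_map F F (trans_map t s b)" "eq_form2 F (pullback2 F F (trans_map t s b) \<omega>\<^sub>0) \<omega>\<^sub>0"
    "chart_smooth F F (trans_map t s b)"
proof -
  show 1: "smooth_map F F (trans_map t s b)" "eq_form2 F (pullback2 F F (trans_map t s b) \<omega>\<^sub>0) \<omega>\<^sub>0"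
    using trans_symp[OF assms] by (auto simp: trans_map_def[abs_def] symplectomorphism_def diffeomorphism_def)
  show "chart_smooth F F (trans_map t s b)" by (rule smooth_map_chart_smooth[OF atlases(3,3) 1(1)])
qed

text \<open>Allows all calculations on the fibre over b to be done in coordinates of F, with
  \<open>glue t b\<close> as the parametrization of the fibre.\<close>

lemma fibre_chart_facts:
  assumes t: "t \<in> T" "b \<in> fst t" and d: "d \<in> atlas F"
  shows "inj_on (snd (fibre_chart M p b t d)) (fst (fibre_chart M p b t d))"
    "y \<in> fst d \<Longrightarrow> glue t b y \<in> fst (fibre_chart M p b t d)"
    "y \<in> fst d \<Longrightarrow> snd (fibre_chart M p b t d) (glue t b y) = snd d y"
    "chart_image (fibre_chart M p b t d) = chart_image d"
    "z \<in> chart_image d \<Longrightarrow> chart_inv (fibre_chart M p b t d) z = glue t b (chart_inv d z)"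
    "x \<in> fst (fibre_chart M p b t d) \<Longrightarrow> \<exists>y\<in>fst d. x = glue t b y"
proof -
  let ?c = "fibre_chart M p b t d"
  have sub: "fst d \<subseteq> points F" by (rule smooth_atlas_domain(2)[OF atlases(3) d])
  have dinj: "inj_on (snd d) (fst d)" by (rule smooth_atlas_domain(3)[OF atlases(3) d])
  have x: "x \<in> tube t \<and> snd (snd t x) \<in> fst d \<and> x = glue t b (snd (snd t x))" if "x \<in> fst ?c" for x
    using glue_triv[OF t(1), of x] that t(2) by (auto simp: fibre_chart_def)
  then show ex: "x \<in> fst ?c \<Longrightarrow> \<exists>y\<in>fst d. x = glue t b y" for x by blast
  have g: "glue t b y \<in> tube t" "snd t (glue t b y) = (b, y)" "p (glue t b y) = b" if "y \<in> fst d" for y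
    using glue_in[OF t, of y] that sub by auto
  show 1: "glue t b y \<in> fst ?c" if "y \<in> fst d" for y using g[OF that] that by (auto simp: fibre_chart_def)
  show 2: "snd ?c (glue t b y) = snd d y" if "y \<in> fst d" for y using g[OF that] that by (auto simp: fibre_chart_def)
  show inj: "inj_on (snd ?c) (fst ?c)"
  proof (rule inj_onI)
    fix x x' assume "x \<in> fst ?c" "x' \<in> fst ?c" and e: "snd ?c x = snd ?c x'"
    then obtain y y' where y: "y \<in> fst d" "x = glue t b y" "y' \<in> fst d" "x' = glue t b y'" using ex by metis
    then have "snd d y = snd d y'" using e 2 by simp
    then show "x = x'" using y inj_onD[OF dinj] by blast
  qed
  show im: "chart_image ?c = chart_image d"
  proof
    show "chart_image ?c \<subseteq> chart_image d" using ex 2 by fastforce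
    show "chart_image d \<subseteq> chart_image ?c" using 1 2 by (metis image_eqI image_subsetI)
  qed
  show "chart_inv ?c z = glue t b (chart_inv d z)" if "z \<in> chart_image d" for z
    using 1 2 that inv_into_into[OF that] f_inv_into_f[OF that] by (intro inv_into_f_eq[OF inj]) auto
qed

text \<open>Changes of fibre charts are coordinate expressions of the transition symplectomorphisms.
  Smoothness of the fibre atlas and invariance of the fibre form thus both come from the structure
  group.\<close>

lemma fibre_overlap:
  assumes t: "t \<in> T" "b \<in> fst t" and d: "d \<in> atlas F" and s: "s \<in> T" "b \<in> fst s" and d': "d' \<in> atlas F"
  shows "snd (fibre_chart M p b t d) ` (fst (fibre_chart M p b t d) \<inter> fst (fibre_chart M p b s d')) =
      chart_image d \<inter> (\<lambda>y. trans_map t s b (chart_inv d y)) -` fst d'"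
    "y \<in> chart_image d \<Longrightarrow> coord_expr (fibre_chart M p b t d) id (fibre_chart M p b s d') y = snd d' (trans_map t s b (chart_inv d y))"
proof -
  let ?c = "fibre_chart M p b t d" and ?c' = "fibre_chart M p b s d'"
  note f = fibre_chart_facts[OF t d]
  have sub: "fst d \<subseteq> points F" by (rule smooth_atlas_domain(2)[OF atlases(3) d])
  have m: "glue t b y \<in> fst ?c' \<longleftrightarrow> trans_map t s b y \<in> fst d'" if "y \<in> fst d" for y
  proof -
    have "y \<in> points F" using sub that by auto
    from glue_in[OF t this] show ?thesis by (auto simp: fibre_chart_def trans_map_def)
  qed
  show "snd ?c ` (fst ?c \<inter> fst ?c') = chart_image d \<inter> (\<lambda>y. trans_map t s b (chart_inv d y)) -` fst d'"
  proof
    show "snd ?c ` (fst ?c \<inter> fst ?c') \<subseteq> chart_image d \<inter> (\<lambda>y. trans_map t s b (chart_inv d y)) -` fst d'"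
    proof
      fix z assume "z \<in> snd ?c ` (fst ?c \<inter> fst ?c')"
      then obtain x where x: "x \<in> fst ?c" "x \<in> fst ?c'" "z = snd ?c x" by auto
      obtain y where y: "y \<in> fst d" "x = glue t b y" using f(6)[OF x(1)] by auto
      have "z = snd d y" using f(3)[OF y(1)] x y by simp
      moreover have "chart_inv d (snd d y) = y" by (rule wk_atlas_inv[OF wkF d y(1)])
      ultimately show "z \<in> chart_image d \<inter> (\<lambda>y. trans_map t s b (chart_inv d y)) -` fst d'"
        using m[OF y(1)] x y by auto
    qed
    show "chart_image d \<inter> (\<lambda>y. trans_map t s b (chart_inv d y)) -` fst d' \<subseteq> snd ?c ` (fst ?c \<inter> fst ?c')"
    proof
      fix z assume z: "z \<in> chart_image d \<inter> (\<lambda>y. trans_map t s b (chart_inv d y)) -` fst d'"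
      let ?y = "chart_inv d z"
      have y: "?y \<in> fst d" "snd d ?y = z" using z by (auto intro: inv_into_into f_inv_into_f)
      have "snd ?c (glue t b ?y) = z" "glue t b ?y \<in> fst ?c" "glue t b ?y \<in> fst ?c'"
        using f(2,3)[OF y(1)] m[OF y(1)] y z by auto
      then show "z \<in> snd ?c ` (fst ?c \<inter> fst ?c')" by (metis IntI image_eqI)
    qed
  qed
  show "coord_expr ?c id ?c' y = snd d' (trans_map t s b (chart_inv d y))" if "y \<in> chart_image d"
    using f(5)[OF that] by (simp add: coord_expr_def) (simp add: fibre_chart_def trans_map_def)
qed

lemma fibre_overlap_smooth:
  assumes t: "t \<in> T" "b \<in> fst t" and d: "d \<in> atlas F" and s: "s \<in> T" "b \<in> fst s" and d': "d' \<in> atlas F"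
  shows "open (chart_image d \<inter> (\<lambda>y. trans_map t s b (chart_inv d y)) -` fst d')"
    "smooth_on (chart_image d \<inter> (\<lambda>y. trans_map t s b (chart_inv d y)) -` fst d') (\<lambda>y. snd d' (trans_map t s b (chart_inv d y)))"
    "smooth_param F (chart_image d) (\<lambda>y. trans_map t s b (chart_inv d y))"
proof -
  show sp: "smooth_param F (chart_image d) (\<lambda>y. trans_map t s b (chart_inv d y))"
    using trans_map_symp(3)[OF t(1) s(1) t(2) s(2)] d by (simp add: chart_smooth_def)
  show "open (chart_image d \<inter> (\<lambda>y. trans_map t s b (chart_inv d y)) -` fst d')"
    "smooth_on (chart_image d \<inter> (\<lambda>y. trans_map t s b (chart_inv d y)) -` fst d') (\<lambda>y. snd d' (trans_map t s b (chart_inv d y)))"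
    using chart_rep[OF wkF sp d'] by auto
qed

lemma atlas_fibre_cases:
  assumes "c \<in> atlas (fibre M F p T b)"
  obtains t d where "t \<in> T" "b \<in> fst t" "d \<in> atlas F" "c = fibre_chart M p b t d"
  using assms unfolding atlas_fibre by blast

lemma atlas_fibreI: "t \<in> T \<Longrightarrow> b \<in> fst t \<Longrightarrow> d \<in> atlas F \<Longrightarrow> fibre_chart M p b t d \<in> atlas (fibre M F p T b)"
  unfolding atlas_fibre by blast

lemma wk_fibre: "wk_atlas (atlas (fibre M F p T b))"
  unfolding wk_atlas_def
proof (intro conjI ballI)
  fix c assume "c \<in> atlas (fibre M F p T b)"
  then obtain t d where c: "t \<in> T" "b \<in> fst t" "d \<in> atlas F" "c = fibre_chart M p b t d" by (rule atlas_fibre_cases)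
  show "inj_on (snd c) (fst c)" unfolding c(4) by (rule fibre_chart_facts(1)[OF c(1-3)])
  fix c' assume "c' \<in> atlas (fibre M F p T b)"
  then obtain s d' where c': "s \<in> T" "b \<in> fst s" "d' \<in> atlas F" "c' = fibre_chart M p b s d'" by (rule atlas_fibre_cases)
  note o = fibre_overlap[OF c(1-3) c'(1-3)] and os = fibre_overlap_smooth[OF c(1-3) c'(1-3)]
  show "open (snd c ` (fst c \<inter> fst c'))" unfolding c(4) c'(4) o(1) by (rule os(1))
  show "smooth_on (snd c ` (fst c \<inter> fst c')) (coord_expr c id c')" unfolding c(4) c'(4) o(1)
    by (rule smooth_on_cong[OF os(1,2)]) (use o(2) in auto)
qed

text \<open>\<open>fibre_form\<close> rests on a chosen trivialization s. In a chart built from t it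
  becomes the pullback of \<open>\<omega>\<^sub>0\<close> under the transition map from t to s,
  which is symplectic, so the choice leaves no trace.\<close>

lemma fibre_form_chart:
  assumes t: "t \<in> T" "b \<in> fst t" and d: "d \<in> atlas F" and y: "y \<in> chart_image d"
  shows "fibre_form M F \<omega>\<^sub>0 p T b (fibre_chart M p b t d) y v w = \<omega>\<^sub>0 d y v w"
proof -
  define s where "s = (SOME t. t \<in> T \<and> b \<in> fst t)"
  have s: "s \<in> T" "b \<in> fst s" unfolding s_def using someI[of "\<lambda>t. t \<in> T \<and> b \<in> fst t" t] t by auto
  let ?c = "fibre_chart M p b t d"
  have "fibre_form M F \<omega>\<^sub>0 p T b ?c y = pb2 F (\<lambda>z. (snd \<circ> snd s) (chart_inv ?c z)) \<omega>\<^sub>0 y"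
    by (simp add: fibre_form_def pullback2_pb2 flip: s_def)
  also have "\<dots> = pb2 F (\<lambda>z. trans_map t s b (chart_inv d z)) \<omega>\<^sub>0 y"
    by (rule pb_cong(2)[OF wk_atlas_open[OF wkF d] y]) (simp add: fibre_chart_facts(5)[OF t d] trans_map_def)
  also have "\<dots> = pullback2 F F (trans_map t s b) \<omega>\<^sub>0 d y" by (simp add: pullback2_pb2)
  finally have "fibre_form M F \<omega>\<^sub>0 p T b ?c y v w = pullback2 F F (trans_map t s b) \<omega>\<^sub>0 d y v w" by simp
  also have "\<dots> = \<omega>\<^sub>0 d y v w"
    using trans_map_symp(2)[OF t(1) s(1) t(2) s(2)] d y unfolding eq_form2_def by blast
  finally show ?thesis .
qed

lemma fibre_form_closed: "closed_two_form (fibre M F p T b) (fibre_form M F \<omega>\<^sub>0 p T b)"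
  unfolding closed_two_form_def two_form_def
proof (intro conjI ballI allI)
  let ?\<eta> = "fibre_form M F \<omega>\<^sub>0 p T b"
  fix c x v w assume "c \<in> atlas (fibre M F p T b)"
  then obtain t d where c: "t \<in> T" "b \<in> fst t" "d \<in> atlas F" "c = fibre_chart M p b t d" by (rule atlas_fibre_cases)
  have im: "chart_image c = chart_image d" unfolding c(4) by (rule fibre_chart_facts(4)[OF c(1-3)])
  have e: "?\<eta> c y v w = \<omega>\<^sub>0 d y v w" if "y \<in> chart_image d" for y v w
    unfolding c(4) by (rule fibre_form_chart[OF c(1-3) that])
  then have e': "?\<eta> c y = \<omega>\<^sub>0 d y" if "y \<in> chart_image d" for y using that by (intro ext)
  have op: "open (chart_image d)" by (rule wk_atlas_open[OF wkF c(3)])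
  show "x \<in> chart_image c \<Longrightarrow> bilinear (?\<eta> c x)"  "x \<in> chart_image c \<Longrightarrow> ?\<eta> c x v v = 0"
    unfolding im by (simp_all only: e' two_formD(1,2)[OF two_form_\<omega>\<^sub>0 c(3)])
  show "smooth_on (chart_image c) (\<lambda>x. ?\<eta> c x v w)" unfolding im
    by (rule smooth_on_cong[OF op two_formD(3)[OF two_form_\<omega>\<^sub>0 c(3)]]) (simp only: e)
  show "?\<eta> c x v w = ?\<eta> c' (coord_expr c id c' x) (fd (coord_expr c id c') x v) (fd (coord_expr c id c') x w)"
    if c'0: "c' \<in> atlas (fibre M F p T b)" and x: "x \<in> snd c ` (fst c \<inter> fst c')" for c'
  proof -
    obtain s d' where c': "s \<in> T" "b \<in> fst s" "d' \<in> atlas F" "c' = fibre_chart M p b s d'"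
      using c'0 by (rule atlas_fibre_cases)
    note o = fibre_overlap[OF c(1-3) c'(1-3), folded c(4) c'(4)] and os = fibre_overlap_smooth[OF c(1-3) c'(1-3)]
    let ?\<tau> = "\<lambda>y. trans_map t s b (chart_inv d y)"
    have x': "x \<in> chart_image d \<inter> ?\<tau> -` fst d'" using x o(1) by simp
    have ce: "coord_expr c id c' x = snd d' (?\<tau> x)" using o(2) x' by auto
    have fde: "fd (coord_expr c id c') x = fd (\<lambda>y. snd d' (?\<tau> y)) x"
      by (rule frechet_derivative_cong_open[OF os(1) x']) (use o(2) in auto)
    have "?\<eta> c x v w = \<omega>\<^sub>0 d x v w" using e x' by auto
    also have "\<dots> = pullback2 F F (trans_map t s b) \<omega>\<^sub>0 d x v w"
      using trans_map_symp(2)[OF c(1) c'(1) c(2) c'(2)] c(3) x' unfolding eq_form2_def by auto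
    also have "\<dots> = \<omega>\<^sub>0 d' (snd d' (?\<tau> x)) (fd (\<lambda>y. snd d' (?\<tau> y)) x v) (fd (\<lambda>y. snd d' (?\<tau> y)) x w)"
      unfolding pullback2_pb2 by (rule pb2_chart[OF wkF os(3) two_form_\<omega>\<^sub>0 c'(3)]) (use x' in auto)
    also have "\<dots> = ?\<eta> c' (coord_expr c id c' x) (fd (coord_expr c id c') x v) (fd (coord_expr c id c') x w)"
      unfolding fde ce unfolding c'(4) using x' by (intro fibre_form_chart[OF c'(1-3), symmetric]) auto
    finally show ?thesis .
  qed
  fix u assume x: "x \<in> chart_image c"
  have "fd (\<lambda>y. ?\<eta> c y v w) x = fd (\<lambda>y. \<omega>\<^sub>0 d y v w) x" for v w
    by (rule frechet_derivative_cong_open[OF op]) (use x im e in auto)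
  then show "ext_d2 ?\<eta> c x u v w = 0"
    using closed_two_formD(2)[OF closed_\<omega>\<^sub>0 c(3), of x u v w] x im by (simp add: ext_d2_def)
qed

text \<open>A slice of \<open>glue_chart_param\<close> at constant base coordinate.\<close>

lemma fibre_param:
  assumes t: "t \<in> T" "b \<in> fst t" and d: "d \<in> atlas F"
  shows "smooth_param M (chart_image d) (\<lambda>y. glue t b (chart_inv d y))"
proof -
  obtain cB where cB: "cB \<in> atlas B" "b \<in> fst cB"
    using smooth_atlas_cover[OF atlases(2), of b] fst_T(2)[OF t(1)] t(2) by blast
  have "smooth_param M (chart_image d) (\<lambda>y. glue_chart t cB d (snd cB b, y))"
    by (rule smooth_param_compose[OF glue_chart_param[OF t(1) cB(1) d] findim_prod[OF findims(2,3)] wk_atlas_open[OF wkF d]])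
      (use cB t in \<open>auto intro!: smooth_on_Pair smooth_on_const smooth_on_ident wk_atlas_open[OF wkF d]\<close>)
  then show ?thesis
    by (rule smooth_param_cong) (simp add: glue_chart_def wk_atlas_inv[OF wkB cB])
qed

lemma fibre_inclusion_smooth: "chart_smooth (fibre M F p T b) M (\<lambda>x. x)"
  unfolding chart_smooth_def
proof
  fix c assume "c \<in> atlas (fibre M F p T b)"
  then obtain t d where c: "t \<in> T" "b \<in> fst t" "d \<in> atlas F" "c = fibre_chart M p b t d" by (rule atlas_fibre_cases)
  show "smooth_param M (chart_image c) (chart_inv c)"
    unfolding c(4) fibre_chart_facts(4)[OF c(1-3)]
    by (rule smooth_param_cong[OF fibre_param[OF c(1-3)]]) (simp add: fibre_chart_facts(5)[OF c(1-3)])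
qed

lemma pullback2_fibre:
  assumes t: "t \<in> T" "b \<in> fst t" and d: "d \<in> atlas F" and y: "y \<in> chart_image d"
  shows "pullback2 (fibre M F p T b) M (\<lambda>x. x) \<omega> (fibre_chart M p b t d) y = pb2 M (\<lambda>y. glue t b (chart_inv d y)) \<omega> y"
  unfolding pullback2_pb2
  by (rule pb_cong(2)[OF wk_atlas_open[OF wkF d] y]) (simp add: fibre_chart_facts(5)[OF t d])

text \<open>One trivialization is enough: its charts already cover the whole fibre, and the
  transformation law carries the equality to the charts of the others.\<close>

lemma two_form_fibre_eqI:
  assumes a: "two_form (fibre M F p T b) \<eta>" "two_form (fibre M F p T b) \<eta>'"
    and t: "t \<in> T" "b \<in> fst t"
    and e: "\<And>d y v w. d \<in> atlas F \<Longrightarrow> y \<in> chart_image d \<Longrightarrow> \<eta> (fibre_chart M p b t d) y v w = \<eta>' (fibre_chart M p b t d) y v w"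
  shows "eq_form2 (fibre M F p T b) \<eta> \<eta>'"
  unfolding eq_form2_def
proof (intro ballI allI)
  fix c x v w assume c0: "c \<in> atlas (fibre M F p T b)" and x: "x \<in> chart_image c"
  then obtain s d where c: "s \<in> T" "b \<in> fst s" "d \<in> atlas F" "c = fibre_chart M p b s d" by (metis atlas_fibre_cases)
  obtain z where z: "z \<in> fst c" "x = snd c z" using x by auto
  have "z \<in> tube t" using z t unfolding c(4) by (auto simp: fibre_chart_def)
  then obtain d' where d': "d' \<in> atlas F" "snd (snd t z) \<in> fst d'"
    using smooth_atlas_cover[OF atlases(3)] triv_in[OF t(1)] by blast
  let ?c' = "fibre_chart M p b t d'"
  have c': "?c' \<in> atlas (fibre M F p T b)" by (rule atlas_fibreI[OF t d'(1)])
  have zc': "z \<in> fst ?c'" using z d' unfolding c(4) by (auto simp: fibre_chart_def)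
  then have "coord_expr c id ?c' (snd c z) \<in> chart_image ?c'"
    using overlap_transition(3)[OF wk_fibre c0 c'] z by blast
  then have "coord_expr c id ?c' (snd c z) \<in> chart_image d'" unfolding fibre_chart_facts(4)[OF t d'(1)] .
  then show "\<eta> c x v w = \<eta>' c x v w"
    unfolding z(2) two_formD(4)[OF a(1) c0 c' z(1) zc'] two_formD(4)[OF a(2) c0 c' z(1) zc'] by (rule e[OF d'(1)])
qed

text \<open>The fibre form lies in its own class, hence in the union that defines
  \<open>pullback_class\<close>; so it is cohomologous to the restriction of some member of u. That
  member may depend on b.\<close>

lemma fibre_cohomology:
  assumes "pullback_class (fibre M F p T b) M (\<lambda>x. x) u = coh_class (fibre M F p T b) (fibre_form M F \<omega>\<^sub>0 p T b)"
  shows "\<exists>\<omega>\<in>u. (pullback2 (fibre M F p T b) M (\<lambda>x. x) \<omega>, fibre_form M F \<omega>\<^sub>0 p T b) \<in> cohomologous (fibre M F p T b)"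
proof -
  have "fibre_form M F \<omega>\<^sub>0 p T b \<in> coh_class (fibre M F p T b) (fibre_form M F \<omega>\<^sub>0 p T b)"
    using cohomologous_refl[OF fibre_form_closed] by (simp add: coh_class_def)
  then have "fibre_form M F \<omega>\<^sub>0 p T b \<in> pullback_class (fibre M F p T b) M (\<lambda>x. x) u" unfolding assms .
  then show ?thesis unfolding pullback_class_def coh_class_def by blast
qed

end

section \<open>The fibrewise primitive\<close>

text \<open>The homotopy operator of the contraction of the first factor to \<open>a\<close>, cut down to its vertical
  part: the remaining part does not affect the restrictions to the fibres.\<close>

definition homotopy_form :: "'h::real_inner \<Rightarrow> ('h \<times> 'v \<Rightarrow> 'h \<times> 'v \<Rightarrow> 'h \<times> 'v \<Rightarrow> real) \<Rightarrow> 'h \<times> 'v::real_inner \<Rightarrow> 'h \<times> 'v \<Rightarrow> real" where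
  "homotopy_form a W z v = integral {0..1} (\<lambda>s. W (a + s *\<^sub>R (fst z - a), snd z) (fst z - a, 0) (0, snd v))"

lemma segment_in_ball:
  fixes x a :: "'a::real_normed_vector"
  assumes "x \<in> ball a R" "0 \<le> s" "s \<le> 1" shows "a + s *\<^sub>R (x - a) \<in> ball a R"
proof -
  have "norm (s *\<^sub>R (x - a)) \<le> 1 * norm (x - a)" unfolding norm_scaleR using assms by (intro mult_right_mono) auto
  then show ?thesis using assms by (simp add: dist_norm norm_minus_commute)
qed

lemma fst_snd_smooth: "smooth_on S (\<lambda>q :: 'x::real_normed_vector \<times> 'y::real_normed_vector. fst q)" "smooth_on S (\<lambda>q :: 'x \<times> 'y. snd q)"
  by (auto intro: smooth_on_bounded_linear bounded_linear_fst bounded_linear_snd)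

context
  fixes a :: "'h::real_inner" and R :: real and Y :: "'v::real_inner set" and W :: "'h \<times> 'v \<Rightarrow> 'h \<times> 'v \<Rightarrow> 'h \<times> 'v \<Rightarrow> real"
  assumes fin: "findim TYPE('h)" "findim TYPE('v)" and Y: "open Y"
    and bil: "\<And>z. z \<in> ball a R \<times> Y \<Longrightarrow> bilinear (W z)"
    and sm: "\<And>v w. smooth_on (ball a R \<times> Y) (\<lambda>z. W z v w)"
begin

text \<open>The pairs of a point and a time for which the contraction stays in the domain of W. This
  is an open neighbourhood of the cylinder over [0,1], as differentiation under the integral
  demands; the cylinder itself is not open.\<close>

definition "htpy_dom = {q :: ('h \<times> 'v) \<times> real. a + snd q *\<^sub>R (fst (fst q) - a) \<in> ball a R \<and> snd (fst q) \<in> Y}"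

lemma htpy_dom_open: "open htpy_dom"
proof -
  have "htpy_dom = (\<lambda>q. (a + snd q *\<^sub>R (fst (fst q) - a), snd (fst q))) -` (ball a R \<times> Y)"
    by (auto simp: htpy_dom_def)
  moreover have "open \<dots>"
    by (rule open_vimage) (auto intro!: open_Times Y continuous_intros)
  ultimately show ?thesis by simp
qed

lemma htpy_dom_sub: "(ball a R \<times> Y) \<times> {0..1} \<subseteq> htpy_dom"
  using segment_in_ball unfolding htpy_dom_def by fastforce

lemma htpy_smooth: "smooth_on htpy_dom (\<lambda>q. W (a + snd q *\<^sub>R (fst (fst q) - a), snd (fst q)) (fst (fst q) - a, 0) (0, snd v))"
proof -
  note lin = smooth_on_linear_compose[OF htpy_dom_open]
  have f: "smooth_on htpy_dom (\<lambda>q. fst (fst q))" "smooth_on htpy_dom (\<lambda>q. snd (fst q))"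
    by (auto intro: lin[OF bounded_linear_fst] lin[OF bounded_linear_snd] fst_snd_smooth)
  have s: "smooth_on htpy_dom (\<lambda>q. (a + snd q *\<^sub>R (fst (fst q) - a), snd (fst q)))"
    "smooth_on htpy_dom (\<lambda>q. (fst (fst q) - a, 0::'v))" "smooth_on htpy_dom (\<lambda>q. (0::'h, snd v))"
    by (intro smooth_on_Pair smooth_on_add smooth_on_scaleR smooth_on_diff smooth_on_const f fst_snd_smooth htpy_dom_open)+
  have "(\<lambda>q. (a + snd q *\<^sub>R (fst (fst q) - a), snd (fst q))) ` htpy_dom \<subseteq> ball a R \<times> Y" by (auto simp: htpy_dom_def)
  from smooth_on_bilinear_param[OF findim_prod[OF fin] findim_prod[OF fin] bil open_Times[OF open_ball Y] htpy_dom_open sm s(1) this s(2,3)]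
  show ?thesis .
qed

lemma homotopy_form_smooth: "smooth_on (ball a R \<times> Y) (\<lambda>z. homotopy_form a W z v)"
  unfolding homotopy_form_def
  using smooth_on_integral_param[OF findim_prod[OF fin] htpy_dom_open open_Times[OF open_ball Y] htpy_dom_sub htpy_smooth]
  by simp

lemma homotopy_form_linear:
  assumes z: "z \<in> ball a R \<times> Y"
  shows "linear (homotopy_form a W z)"
proof -
  have int: "(\<lambda>s. W (a + s *\<^sub>R (fst z - a), snd z) (fst z - a, 0) (0, snd v)) integrable_on {0..1}" for v
  proof (rule integrable_continuous_interval)
    have "continuous_on {0..1} (\<lambda>s::real. (z, s))" by (intro continuous_intros)
    moreover have "(\<lambda>s::real. (z, s)) ` {0..1} \<subseteq> htpy_dom" using htpy_dom_sub z by auto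
    ultimately show "continuous_on {0..1} (\<lambda>s. W (a + s *\<^sub>R (fst z - a), snd z) (fst z - a, 0) (0, snd v))"
      using continuous_on_compose2[OF smooth_on_continuous[OF htpy_smooth[of v]]] by fastforce
  qed
  have in_dom: "(a + s *\<^sub>R (fst z - a), snd z) \<in> ball a R \<times> Y" if "s \<in> {0..1}" for s
    using z that segment_in_ball[of "fst z" a R s] by (auto simp: mem_Times_iff)
  show ?thesis
  proof (rule linearI)
    fix v w :: "'h \<times> 'v" and k :: real
    have 1: "W (a + s *\<^sub>R (fst z - a), snd z) (fst z - a, 0) (0, snd (v + w)) =
      W (a + s *\<^sub>R (fst z - a), snd z) (fst z - a, 0) (0, snd v) + W (a + s *\<^sub>R (fst z - a), snd z) (fst z - a, 0) (0, snd w)"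
      if "s \<in> {0..1}" for s
      using bilinear_radd[OF bil[OF in_dom[OF that]], of _ "(0, snd v)" "(0, snd w)"] by simp
    show "homotopy_form a W z (v + w) = homotopy_form a W z v + homotopy_form a W z w"
      unfolding homotopy_form_def integral_add[OF int int, symmetric] by (rule integral_cong) (rule 1)
    have 2: "W (a + s *\<^sub>R (fst z - a), snd z) (fst z - a, 0) (0, snd (k *\<^sub>R v)) =
      k *\<^sub>R W (a + s *\<^sub>R (fst z - a), snd z) (fst z - a, 0) (0, snd v)"
      if "s \<in> {0..1}" for s
      using bilinear_rmul[OF bil[OF in_dom[OF that]], of _ k "(0, snd v)"] by simp
    show "homotopy_form a W z (k *\<^sub>R v) = k *\<^sub>R homotopy_form a W z v"
      unfolding homotopy_form_def integral_cmul[symmetric] by (rule integral_cong) (rule 2)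
  qed
qed

text \<open>Cartan's homotopy formula on vertical vectors. The contraction fixes these and has
  velocity (x - a, 0). Closedness of W on two vertical vectors and the velocity turns the vertical
  exterior derivative of the integrand into the derivative of W on the two vertical vectors along
  the segment, whose integral is the difference of the end values.\<close>

lemma homotopy_form_fibre_derivative:
  assumes closed: "\<And>z u v w. z \<in> ball a R \<times> Y \<Longrightarrow>
      fd (\<lambda>z. W z v w) z u - fd (\<lambda>z. W z u w) z v + fd (\<lambda>z. W z u v) z w = 0"
    and x: "x \<in> ball a R" and y: "y \<in> Y"
  shows "fd (\<lambda>y. homotopy_form a W (x, y) (0, v')) y v - fd (\<lambda>y. homotopy_form a W (x, y) (0, v)) y v' =
    W (x, y) (0, v) (0, v') - W (a, y) (0, v) (0, v')"
proof -
  let ?u = "(x - a, 0::'v)" and ?Z = "\<lambda>s. (a + s *\<^sub>R (x - a), y)"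
  define f where "f = (\<lambda>v (q :: 'v \<times> real). W (a + snd q *\<^sub>R (x - a), fst q) ?u (0, v))"
  define D where "D = {q :: 'v \<times> real. ((x, fst q), snd q) \<in> htpy_dom}"
  have "D = (\<lambda>q. ((x, fst q), snd q)) -` htpy_dom" by (auto simp: D_def)
  then have Dop: "open D" by (auto intro!: open_vimage htpy_dom_open continuous_intros)
  have DY: "Y \<times> {0..1} \<subseteq> D" using htpy_dom_sub x unfolding D_def by fastforce
  have fsm: "smooth_on D (f v)" for v
  proof -
    have i: "smooth_on D (\<lambda>q. ((x, fst q), snd q))" "(\<lambda>q. ((x, fst q), snd q)) ` D \<subseteq> htpy_dom"
      by (intro smooth_on_Pair smooth_on_const fst_snd_smooth Dop) (auto simp: D_def)
    have "smooth_on D (\<lambda>q. W (a + snd ((x, fst q), snd q) *\<^sub>R (fst (fst ((x, fst q), snd q)) - a), snd (fst ((x, fst q), snd q)))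
       (fst (fst ((x, fst q), snd q)) - a, 0) (0, snd (0::'h, v)))"
      by (rule smooth_on_compose[OF findim_prod[OF findim_prod[OF fin] findim_euclidean] Dop htpy_dom_open i(1) htpy_smooth i(2)])
    then show ?thesis by (simp add: f_def)
  qed
  have inD: "(y, s) \<in> D" "?Z s \<in> ball a R \<times> Y" if "s \<in> {0..1}" for s
    using DY y that segment_in_ball[OF x, of s] by auto
  have dI: "((\<lambda>y. integral {0..1} (\<lambda>s. f v (y, s))) has_derivative
          (\<lambda>h. integral {0..1} (\<lambda>s. fd (f v) (y, s) (h, 0)))) (at y)" for v
    by (rule has_derivative_integral_param[OF fin(2) Dop Y DY _ _ y])
      (auto intro: smooth_on_differentiable[OF fsm] smooth_on_continuous smooth_on_frechet_derivative[OF fsm])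
  have hf: "homotopy_form a W (x, y) (0, v) = integral {0..1} (\<lambda>s. f v (y, s))" for y v
    by (simp add: homotopy_form_def f_def)
  have dH: "fd (\<lambda>y. homotopy_form a W (x, y) (0, v)) y h = integral {0..1} (\<lambda>s. fd (f v) (y, s) (h, 0))" for v h
    unfolding hf frechet_derivativeI[OF dI] ..
  have WD: "((\<lambda>z. W z b c) has_derivative fd (\<lambda>z. W z b c) (?Z s)) (at (?Z s))" if "s \<in> {0..1}" for b c s
    by (rule smooth_on_has_derivative[OF sm inD(2)[OF that]])
  have df: "fd (f v) (y, s) (h, 0) = fd (\<lambda>z. W z ?u (0, v)) (?Z s) (0, h)" if s: "s \<in> {0..1}" for v h s
  proof -
    have g: "((\<lambda>q. (a + snd q *\<^sub>R (x - a), fst q)) has_derivative (\<lambda>h. (snd h *\<^sub>R (x - a), fst h))) (at (y, s))"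
      by (auto intro!: derivative_eq_intros)
    have "(f v has_derivative (\<lambda>h. fd (\<lambda>z. W z ?u (0, v)) (?Z s) (snd h *\<^sub>R (x - a), fst h))) (at (y, s))"
      unfolding f_def using has_derivative_compose[OF g, of "\<lambda>z. W z ?u (0, v)" "fd (\<lambda>z. W z ?u (0, v)) (?Z s)"] WD[OF s] by simp
    from frechet_derivativeI[OF this] show ?thesis by simp
  qed
  have int: "(\<lambda>s. fd (f v) (y, s) (h, 0)) integrable_on {0..1}" for v h
  proof (rule integrable_continuous_interval)
    have "continuous_on {0..1} (\<lambda>s::real. (y, s))" by (intro continuous_intros)
    moreover have "(\<lambda>s::real. (y, s)) ` {0..1} \<subseteq> D" using inD by auto
    ultimately show "continuous_on {0..1} (\<lambda>s. fd (f v) (y, s) (h, 0))"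
      using continuous_on_compose2[OF smooth_on_continuous[OF smooth_on_frechet_derivative[OF fsm]]] by blast
  qed
  have "fd (\<lambda>y. homotopy_form a W (x, y) (0, v')) y v - fd (\<lambda>y. homotopy_form a W (x, y) (0, v)) y v' =
    integral {0..1} (\<lambda>s. fd (f v') (y, s) (v, 0) - fd (f v) (y, s) (v', 0))"
    unfolding dH by (rule integral_diff[OF int int, symmetric])
  also have "\<dots> = integral {0..1} (\<lambda>s. fd (\<lambda>z. W z (0, v) (0, v')) (?Z s) ?u)"
  proof (rule integral_cong)
    fix s :: real assume s: "s \<in> {0..1}"
    show "fd (f v') (y, s) (v, 0) - fd (f v) (y, s) (v', 0) = fd (\<lambda>z. W z (0, v) (0, v')) (?Z s) ?u"
      unfolding df[OF s] using closed[OF inD(2)[OF s], of "(0, v)" "(0, v')" ?u] by simp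
  qed
  also have "\<dots> = W (?Z 1) (0, v) (0, v') - W (?Z 0) (0, v) (0, v')"
  proof (rule integral_unique, rule fundamental_theorem_of_calculus)
    fix s :: real assume "s \<in> {0..1}"
    then have g: "((\<lambda>z. W z (0, v) (0, v')) has_derivative fd (\<lambda>z. W z (0, v) (0, v')) (?Z s)) (at (?Z s))" by (rule WD)
    have "((\<lambda>s. ?Z s) has_derivative (\<lambda>h. (h *\<^sub>R (x - a), 0))) (at s)" by (auto intro!: derivative_eq_intros)
    from has_derivative_compose[OF this g]
    have "((\<lambda>s. W (?Z s) (0, v) (0, v')) has_derivative (\<lambda>h. fd (\<lambda>z. W z (0, v) (0, v')) (?Z s) (h *\<^sub>R (x - a), 0))) (at s)" .
    moreover have "fd (\<lambda>z. W z (0, v) (0, v')) (?Z s) (h *\<^sub>R (x - a), 0) = h *\<^sub>R fd (\<lambda>z. W z (0, v) (0, v')) (?Z s) ?u" for h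
      using linear_scale[OF has_derivative_linear[OF g], of h ?u] by simp
    ultimately show "((\<lambda>s. W (?Z s) (0, v) (0, v')) has_vector_derivative fd (\<lambda>z. W z (0, v) (0, v')) (?Z s) ?u) (at s within {0..1})"
      by (simp add: has_vector_derivative_def has_derivative_at_withinI)
  qed simp
  finally show ?thesis by simp
qed
end

section \<open>The product model over a coordinate ball\<close>

locale symp_patch = symp_fib M B F \<omega>\<^sub>0 p T
  for M :: "('m, 'e::real_inner) manifold" and B :: "('b, 'h::real_inner) manifold"
    and F :: "('f, 'v::real_inner) manifold" and \<omega>\<^sub>0 p T +
  fixes t cB and a :: 'h and R :: real
  assumes t: "t \<in> T" and cB: "cB \<in> atlas B" and R: "0 < R" and ball_sub: "ball a R \<subseteq> snd cB ` (fst cB \<inter> fst t)"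
begin

definition "cell = chart_inv cB ` ball a R"
definition "centre = chart_inv cB a"
definition "pc d = (cell \<times> fst d, map_prod (snd cB) (snd d))" for d :: "('f, 'v) chart"
text \<open>The cell times F, charted by one fixed base chart times the charts of F. Transition maps
  are then the identity in the base factor and independent of the base point, so they commute with
  the contraction of the ball.\<close>

definition patch :: "('b \<times> 'f, 'h \<times> 'v) manifold" where
  "patch = \<lparr>mtop = prod_topology (mtop B) (mtop F), atlas = pc ` atlas F\<rparr>"

abbreviation "fcc \<equiv> fibre_chart M p centre t"
abbreviation "Fc \<equiv> fibre M F p T centre"

lemma ball_inv: "x \<in> ball a R \<Longrightarrow> chart_inv cB x \<in> fst cB \<inter> fst t" "x \<in> ball a R \<Longrightarrow> snd cB (chart_inv cB x) = x"
  using base_chart_inv[OF cB, of x "fst t"] ball_sub by blast+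

lemma cell_iff: "b \<in> cell \<longleftrightarrow> b \<in> fst cB \<and> snd cB b \<in> ball a R"
  unfolding cell_def using ball_inv wk_atlas_inv[OF wkB cB] by force

lemma cell_sub: "cell \<subseteq> fst cB" "cell \<subseteq> fst t" unfolding cell_def using ball_inv by blast+

lemma centre_in: "centre \<in> cell" "centre \<in> fst t" "snd cB centre = a"
  using R ball_inv[of a] by (auto simp: cell_def centre_def)

lemma cell_open: "openin (mtop B) cell"
proof -
  have c: "homeomorphic_map (subtopology (mtop B) (fst cB)) (top_of_set (chart_image cB)) (snd cB)" "open (chart_image cB)"
    using atlases(2) cB unfolding smooth_atlas_def by auto
  have sub: "fst cB \<subseteq> points B" by (rule smooth_atlas_domain(2)[OF atlases(2) cB])
  have "openin (top_of_set (chart_image cB)) (ball a R)"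
    using ball_sub by (auto intro!: open_subset)
  from openin_continuous_map_preimage[OF homeomorphic_imp_continuous_map[OF c(1)] this]
  have "openin (subtopology (mtop B) (fst cB)) cell"
  proof (rule back_subst[where P = "openin (subtopology (mtop B) (fst cB))"])
    show "{x \<in> topspace (subtopology (mtop B) (fst cB)). snd cB x \<in> ball a R} = cell"
      using cell_iff sub by auto
  qed
  then show ?thesis using smooth_atlas_domain(1)[OF atlases(2) cB] openin_trans_full by blast
qed

lemma atlas_patch: "e \<in> atlas patch \<longleftrightarrow> (\<exists>d\<in>atlas F. e = pc d)"
  by (auto simp: patch_def)

lemma pc_image: "chart_image (pc d) = ball a R \<times> chart_image d"
proof -
  have "snd cB ` cell = ball a R" unfolding cell_def using ball_inv(2) by force
  then show ?thesis by (simp add: pc_def map_prod_image)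
qed

lemma pc_inj: "d \<in> atlas F \<Longrightarrow> inj_on (snd (pc d)) (fst (pc d))"
  unfolding pc_def using inj_on_subset[OF smooth_atlas_domain(3)[OF atlases(2) cB] cell_sub(1)] smooth_atlas_domain(3)[OF atlases(3)]
  by (simp add: map_prod_inj_on)

lemma pc_inv:
  assumes "d \<in> atlas F" "z \<in> ball a R \<times> chart_image d"
  shows "chart_inv (pc d) z = (chart_inv cB (fst z), chart_inv d (snd z))"
proof (rule inv_into_f_eq[OF pc_inj[OF assms(1)]])
  show "(chart_inv cB (fst z), chart_inv d (snd z)) \<in> fst (pc d)" "snd (pc d) (chart_inv cB (fst z), chart_inv d (snd z)) = z"
    using assms(2) ball_inv(2)[of "fst z"] inv_into_into[of "snd z" "snd d" "fst d"] f_inv_into_f[of "snd z" "snd d" "fst d"]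
    by (auto simp: pc_def cell_def mem_Times_iff prod_eq_iff)
qed

lemma pc_overlap:
  assumes d: "d \<in> atlas F" and d': "d' \<in> atlas F"
  shows "snd (pc d) ` (fst (pc d) \<inter> fst (pc d')) = ball a R \<times> snd d ` (fst d \<inter> fst d')"
    "z \<in> ball a R \<times> chart_image d \<Longrightarrow> coord_expr (pc d) id (pc d') z = (fst z, coord_expr d id d' (snd z))"
proof -
  have "snd cB ` cell = ball a R" unfolding cell_def using ball_inv(2) by force
  moreover have "fst (pc d) \<inter> fst (pc d') = cell \<times> (fst d \<inter> fst d')" by (auto simp: pc_def)
  ultimately show "snd (pc d) ` (fst (pc d) \<inter> fst (pc d')) = ball a R \<times> snd d ` (fst d \<inter> fst d')"
    by (simp add: pc_def map_prod_image)
  show "coord_expr (pc d) id (pc d') z = (fst z, coord_expr d id d' (snd z))" if "z \<in> ball a R \<times> chart_image d"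
    using that ball_inv(2)[of "fst z"] by (auto simp: coord_expr_def pc_inv[OF d that]) (simp_all add: pc_def)
qed

lemma pc_overlap_derivative:
  assumes d: "d \<in> atlas F" and d': "d' \<in> atlas F" and z: "z \<in> ball a R \<times> snd d ` (fst d \<inter> fst d')"
  shows "(coord_expr (pc d) id (pc d') has_derivative (\<lambda>v. (fst v, fd (coord_expr d id d') (snd z) (snd v)))) (at z)"
    "fd (coord_expr (pc d) id (pc d')) z v = (fst v, fd (coord_expr d id d') (snd z) (snd v))"
proof -
  note o = overlap_transition[OF wkF d d']
  have D: "(coord_expr d id d' has_derivative fd (coord_expr d id d') (snd z)) (at (snd z))"
    by (rule smooth_on_has_derivative[OF o(2)]) (use z in auto)
  have "((\<lambda>z. (fst z, coord_expr d id d' (snd z))) has_derivative (\<lambda>v. (fst v, fd (coord_expr d id d') (snd z) (snd v)))) (at z)"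
    using has_derivative_compose[OF bounded_linear_imp_has_derivative[OF bounded_linear_snd] D]
    by (intro has_derivative_Pair bounded_linear_imp_has_derivative bounded_linear_fst)
  then show 1: "(coord_expr (pc d) id (pc d') has_derivative (\<lambda>v. (fst v, fd (coord_expr d id d') (snd z) (snd v)))) (at z)"
    by (rule has_derivative_transform_within_open[OF _ open_Times[OF open_ball o(1)] z])
       (rule pc_overlap(2)[OF d d', symmetric], auto)
  show "fd (coord_expr (pc d) id (pc d')) z v = (fst v, fd (coord_expr d id d') (snd z) (snd v))"
    unfolding frechet_derivativeI[OF 1] ..
qed

lemma wk_patch: "wk_atlas (atlas patch)"
  unfolding wk_atlas_def
proof (intro conjI ballI)
  fix e assume "e \<in> atlas patch"
  then obtain d where e: "d \<in> atlas F" "e = pc d" using atlas_patch by blast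
  show "inj_on (snd e) (fst e)" unfolding e(2) by (rule pc_inj[OF e(1)])
  fix e' assume "e' \<in> atlas patch"
  then obtain d' where e': "d' \<in> atlas F" "e' = pc d'" using atlas_patch by blast
  note o = overlap_transition[OF wkF e(1) e'(1)]
  have op: "open (ball a R \<times> snd d ` (fst d \<inter> fst d'))" by (rule open_Times[OF open_ball o(1)])
  show "open (snd e ` (fst e \<inter> fst e'))" unfolding e e' pc_overlap(1)[OF e(1) e'(1)] by (rule op)
  have "smooth_on (ball a R \<times> snd d ` (fst d \<inter> fst d')) (\<lambda>z. coord_expr d id d' (snd z))"
    by (rule smooth_on_compose[OF findims(3) op o(1) fst_snd_smooth(2) o(2)]) auto
  then have "smooth_on (ball a R \<times> snd d ` (fst d \<inter> fst d')) (\<lambda>z. (fst z, coord_expr d id d' (snd z)))"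
    by (intro smooth_on_Pair op fst_snd_smooth)
  then show "smooth_on (snd e ` (fst e \<inter> fst e')) (coord_expr e id e')" unfolding e e' pc_overlap(1)[OF e(1) e'(1)]
    by (rule smooth_on_cong[OF op]) (rule pc_overlap(2)[OF e(1) e'(1), symmetric], auto)
qed

lemma findim_hv: "findim TYPE('h \<times> 'v)" by (rule findim_prod[OF findims(2,3)])

text \<open>The inverse trivialization, along which forms on M are brought to the product.\<close>

lemma patch_to_total: "chart_smooth patch M (\<lambda>z. glue t (fst z) (snd z))"
  unfolding chart_smooth_def
proof
  fix e assume "e \<in> atlas patch"
  then obtain d where e: "d \<in> atlas F" "e = pc d" using atlas_patch by blast
  have op: "open (ball a R \<times> chart_image d)" by (rule open_Times[OF open_ball wk_atlas_open[OF wkF e(1)]])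
  have "smooth_param M (ball a R \<times> chart_image d) (glue_chart t cB d)"
    by (rule smooth_param_subset[OF glue_chart_param[OF t cB e(1)] op]) (use ball_sub in auto)
  then show "smooth_param M (chart_image e) (\<lambda>x. glue t (fst (chart_inv e x)) (snd (chart_inv e x)))"
    unfolding e(2) pc_image by (rule smooth_param_cong) (simp add: glue_chart_def pc_inv[OF e(1)])
qed

text \<open>The projection to the central fibre, used to spread a primitive found there over the
  whole patch.\<close>

lemma patch_to_fibre: "chart_smooth patch Fc (\<lambda>z. glue t centre (snd z))"
  unfolding chart_smooth_def
proof
  fix e assume "e \<in> atlas patch"
  then obtain d where e: "d \<in> atlas F" "e = pc d" using atlas_patch by blast
  note ff = fibre_chart_facts[OF t centre_in(2) e(1)]
  have op: "open (ball a R \<times> chart_image d)" by (rule open_Times[OF open_ball wk_atlas_open[OF wkF e(1)]])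
  have "smooth_param Fc (chart_image d) (chart_inv (fcc d))"
    using smooth_param_chart_inv[OF wk_fibre atlas_fibreI[OF t centre_in(2) e(1)]] unfolding ff(4) .
  from smooth_param_compose[OF this findims(3) op fst_snd_smooth(2)]
  have "smooth_param Fc (ball a R \<times> chart_image d) (\<lambda>z. chart_inv (fcc d) (snd z))" by auto
  then show "smooth_param Fc (chart_image e) (\<lambda>x. glue t centre (snd (chart_inv e x)))"
    unfolding e(2) pc_image by (rule smooth_param_cong) (auto simp: pc_inv[OF e(1)] ff(5))
qed

lemma pullback1_to_fibre:
  assumes d: "d \<in> atlas F" and \<beta>: "one_form Fc \<beta>" and z: "z \<in> ball a R \<times> chart_image d"
  shows "pullback1 patch Fc (\<lambda>z. glue t centre (snd z)) \<beta> (pc d) z v = \<beta> (fcc d) (snd z) (snd v)"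
proof -
  note ff = fibre_chart_facts[OF t centre_in(2) d]
  have op: "open (ball a R \<times> chart_image d)" by (rule open_Times[OF open_ball wk_atlas_open[OF wkF d]])
  have fc: "fcc d \<in> atlas Fc" by (rule atlas_fibreI[OF t centre_in(2) d])
  have sz: "snd z \<in> chart_image d" using z by auto
  have "pullback1 patch Fc (\<lambda>z. glue t centre (snd z)) \<beta> (pc d) z = pb1 Fc (\<lambda>z. chart_inv (fcc d) (snd z)) \<beta> z"
    unfolding pullback1_def by (rule pb_cong(1)[OF op z]) (auto simp: pc_inv[OF d] ff(5))
  then have "pullback1 patch Fc (\<lambda>z. glue t centre (snd z)) \<beta> (pc d) z v = pb1 Fc (\<lambda>z. chart_inv (fcc d) (snd z)) \<beta> z v"
    by simp
  also have "\<dots> = pb1 Fc (chart_inv (fcc d)) \<beta> (snd z) (fd snd z v)"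
    by (rule pb_compose(1)[OF smooth_param_chart_inv[OF wk_fibre fc, unfolded ff(4)] fst_snd_smooth(2) _ z]) auto
  also have "\<dots> = \<beta> (fcc d) (snd z) (snd v)"
  proof -
    have "fd (snd :: 'h \<times> 'v \<Rightarrow> 'v) z = snd"
      by (rule frechet_derivativeI[OF bounded_linear_imp_has_derivative[OF bounded_linear_snd]])
    then show ?thesis using pb_chart_inv(1)[OF wk_fibre fc _ \<beta>, of "snd z"] sz ff(4) by simp
  qed
  finally show ?thesis by simp
qed

definition "pulled \<tau> = pullback2 patch M (\<lambda>z. glue t (fst z) (snd z)) \<tau>"

lemma pulled_closed: "closed_two_form M \<tau> \<Longrightarrow> closed_two_form patch (pulled \<tau>)"
  unfolding pulled_def by (rule pullback_forms(3)[OF wk_patch wkM findim_hv findims(1) patch_to_total])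

text \<open>Links the product coordinates with restriction to the fibres, so that the homotopy
  formula can be read on each fibre.\<close>

lemma pulled_vertical:
  assumes d: "d \<in> atlas F" and x: "x \<in> ball a R" and y: "y \<in> chart_image d"
  shows "pulled \<tau> (pc d) (x, y) (0, v) (0, w) = pb2 M (\<lambda>y. glue t (chart_inv cB x) (chart_inv d y)) \<tau> y v w"
proof -
  have op: "open (chart_image d)" by (rule wk_atlas_open[OF wkF d])
  have sp: "smooth_param M (ball a R \<times> chart_image d) (\<lambda>z. glue t (fst (chart_inv (pc d) z)) (snd (chart_inv (pc d) z)))"
  proof -
    have "pc d \<in> atlas patch" using d atlas_patch by blast
    from bspec[OF patch_to_total[unfolded chart_smooth_def] this] show ?thesis unfolding pc_image .
  qed
  have g: "smooth_on (chart_image d) (\<lambda>y. (x, y))" "(\<lambda>y. (x, y)) ` chart_image d \<subseteq> ball a R \<times> chart_image d"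
    using x by (auto intro!: smooth_on_Pair smooth_on_const smooth_on_ident op)
  have D: "fd (\<lambda>y. (x, y)) y = (\<lambda>v. (0, v))"
    by (rule frechet_derivativeI) (auto intro!: derivative_eq_intros)
  have "pb2 M (\<lambda>y. glue t (chart_inv cB x) (chart_inv d y)) \<tau> y =
     pb2 M (\<lambda>y. glue t (fst (chart_inv (pc d) (x, y))) (snd (chart_inv (pc d) (x, y)))) \<tau> y"
    by (rule pb_cong(2)[OF op y]) (use x in \<open>simp add: pc_inv[OF d]\<close>)
  then have "pb2 M (\<lambda>y. glue t (chart_inv cB x) (chart_inv d y)) \<tau> y v w =
     pb2 M (\<lambda>y. glue t (fst (chart_inv (pc d) (x, y))) (snd (chart_inv (pc d) (x, y)))) \<tau> y v w" by simp
  also have "\<dots> = pulled \<tau> (pc d) (x, y) (0, v) (0, w)"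
    unfolding pulled_def pullback2_pb2 using pb_compose(2)[OF sp g y, of \<tau> v w] unfolding D .
  finally show ?thesis by simp
qed

text \<open>The transformation law holds under the integral for each s separately: the derivative of
  a transition map is the identity on the base factor and depends on the fibre coordinate alone, so
  the same linear map serves the entire segment.\<close>

lemma homotopy_one_form:
  assumes \<tau>: "closed_two_form M \<tau>"
  shows "one_form patch (\<lambda>e. homotopy_form a (pulled \<tau> e))"
  unfolding one_form_def
proof (intro conjI ballI allI)
  note tf = closed_two_formD(1)[OF pulled_closed[OF \<tau>]]
  fix e z v assume e0: "e \<in> atlas patch"
  then obtain d where e: "d \<in> atlas F" "e = pc d" using atlas_patch by blast
  have im: "chart_image e = ball a R \<times> chart_image d" unfolding e(2) by (rule pc_image)
  have op: "open (chart_image d)" by (rule wk_atlas_open[OF wkF e(1)])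
  note tfe = two_formD[OF tf e0, unfolded im]
  show "linear (homotopy_form a (pulled \<tau> e) z)" if "z \<in> chart_image e"
    by (rule homotopy_form_linear[OF findims(2,3) op tfe(1,3)]) (use that im in auto)
  show "smooth_on (chart_image e) (\<lambda>z. homotopy_form a (pulled \<tau> e) z v)" unfolding im
    by (rule homotopy_form_smooth[OF findims(2,3) op tfe(1,3)])
  fix e' assume e'0: "e' \<in> atlas patch" and z: "z \<in> snd e ` (fst e \<inter> fst e')"
  then obtain d' where e': "d' \<in> atlas F" "e' = pc d'" using atlas_patch by blast
  have z': "z \<in> ball a R \<times> snd d ` (fst d \<inter> fst d')" using z unfolding e e' pc_overlap(1)[OF e(1) e'(1)] .
  let ?g = "coord_expr d id d'"
  have "pulled \<tau> e (a + s *\<^sub>R (fst z - a), snd z) (fst z - a, 0) (0, snd v) =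
    pulled \<tau> e' (a + s *\<^sub>R (fst z - a), ?g (snd z)) (fst z - a, 0) (0, fd ?g (snd z) (snd v))" if s: "s \<in> {0..1}" for s
  proof -
    let ?z = "(a + s *\<^sub>R (fst z - a), snd z)"
    have zz: "?z \<in> ball a R \<times> snd d ` (fst d \<inter> fst d')" using z' segment_in_ball[of "fst z" a R s] s by (auto simp: mem_Times_iff)
    then have "?z \<in> snd e ` (fst e \<inter> fst e')" unfolding e e' pc_overlap(1)[OF e(1) e'(1)] .
    then obtain w where w: "w \<in> fst e" "w \<in> fst e'" "?z = snd e w" by blast
    have im: "?z \<in> ball a R \<times> chart_image d" using zz by auto
    have ce: "coord_expr e id e' ?z = (a + s *\<^sub>R (fst z - a), ?g (snd z))"
      using pc_overlap(2)[OF e(1) e'(1) im] unfolding e e' by simp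
    have lin: "linear (fd ?g (snd z))"
      by (rule has_derivative_linear[OF smooth_on_has_derivative[OF overlap_transition(2)[OF wkF e(1) e'(1)]]]) (use z' in auto)
    show ?thesis
      using two_formD(4)[OF tf e0 e'0 w(1,2), of "(fst z - a, 0)" "(0, snd v)"]
        pc_overlap_derivative(2)[OF e(1) e'(1) zz, folded e(2) e'(2)] linear_0[OF lin]
      unfolding w(3)[symmetric] ce by simp
  qed
  moreover have "coord_expr e id e' z = (fst z, ?g (snd z))"
    using pc_overlap(2)[OF e(1) e'(1), of z] z' unfolding e e' by auto
  moreover have "fd (coord_expr e id e') z v = (fst v, fd ?g (snd z) (snd v))"
    using pc_overlap_derivative(2)[OF e(1) e'(1) z'] unfolding e e' .
  ultimately show "homotopy_form a (pulled \<tau> e) z v = homotopy_form a (pulled \<tau> e') (coord_expr e id e' z) (fd (coord_expr e id e') z v)"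
    unfolding homotopy_form_def by (simp del: atLeastAtMost_iff) (rule integral_cong)
qed

text \<open>On the fibre over b the homotopy part has exterior derivative \<tau>_b - \<tau>_centre.
  If \<beta> is a primitive of \<tau>_centre - \<omega> on the central fibre, the second part
  contributes just this, and the sum is a primitive of \<tau>_b - \<omega>, the fibres being
  compared through the trivialization.\<close>

definition "primitive \<tau> \<beta> = (\<lambda>e z v. homotopy_form a (pulled \<tau> e) z v + pullback1 patch Fc (\<lambda>z. glue t centre (snd z)) \<beta> e z v)"

lemma primitive_one_form:
  assumes "closed_two_form M \<tau>" "one_form Fc \<beta>"
  shows "one_form patch (primitive \<tau> \<beta>)"
  unfolding primitive_def
  by (rule one_form_add[OF wk_patch homotopy_one_form[OF assms(1)]
      pullback_forms(1)[OF wk_patch wk_fibre findim_hv findims(3) patch_to_fibre assms(2)]])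

lemma primitive_vertical_derivative:
  assumes \<tau>: "closed_two_form M \<tau>" and \<beta>: "one_form Fc \<beta>" and d: "d \<in> atlas F" and b: "b \<in> cell" and y: "y \<in> chart_image d"
    and coh: "\<And>c x v w. c \<in> atlas Fc \<Longrightarrow> x \<in> chart_image c \<Longrightarrow>
      pullback2 Fc M (\<lambda>x. x) \<tau> c x v w = fibre_form M F \<omega>\<^sub>0 p T centre c x v w + ext_d1 \<beta> c x v w"
  shows "fd (\<lambda>y. primitive \<tau> \<beta> (pc d) (snd cB b, y) (0, w)) y v - fd (\<lambda>y. primitive \<tau> \<beta> (pc d) (snd cB b, y) (0, v)) y w =
     pb2 M (\<lambda>y. glue t b (chart_inv d y)) \<tau> y v w - \<omega>\<^sub>0 d y v w"
proof -
  let ?x = "snd cB b"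
  note ff = fibre_chart_facts[OF t centre_in(2) d]
  have x: "?x \<in> ball a R" "chart_inv cB ?x = b" using b cell_iff wk_atlas_inv[OF wkB cB] by auto
  have op: "open (chart_image d)" by (rule wk_atlas_open[OF wkF d])
  have fc: "fcc d \<in> atlas Fc" by (rule atlas_fibreI[OF t centre_in(2) d])
  have pcd: "pc d \<in> atlas patch" using d atlas_patch by blast
  note tf = closed_two_formD(1)[OF pulled_closed[OF \<tau>]]
  note tfe = two_formD[OF tf pcd, unfolded pc_image]
  let ?H = "\<lambda>v y. homotopy_form a (pulled \<tau> (pc d)) (?x, y) (0, v)"
  have hs: "smooth_on (chart_image d) (?H v)" for v
    by (rule smooth_on_compose[OF findim_hv op open_Times[OF open_ball op] _ homotopy_form_smooth[OF findims(2,3) op tfe(1,3)]])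
       (use x in \<open>auto intro!: smooth_on_Pair smooth_on_const smooth_on_ident op\<close>)
  have bs: "smooth_on (chart_image d) (\<lambda>y. \<beta> (fcc d) y v)" for v
    using one_formD(2)[OF \<beta> fc] unfolding ff(4) .
  have D: "fd (\<lambda>y. primitive \<tau> \<beta> (pc d) (?x, y) (0, v)) y = (\<lambda>u. fd (?H v) y u + fd (\<lambda>y. \<beta> (fcc d) y v) y u)" for v
  proof -
    have "fd (\<lambda>y. primitive \<tau> \<beta> (pc d) (?x, y) (0, v)) y = fd (\<lambda>y. ?H v y + \<beta> (fcc d) y v) y"
      by (rule frechet_derivative_cong_open[OF op y]) (use x pullback1_to_fibre[OF d \<beta>] in \<open>auto simp: primitive_def\<close>)
    then show ?thesis using frechet_derivativeI[OF has_derivative_add[OF smooth_on_has_derivative[OF hs y] smooth_on_has_derivative[OF bs y]]]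
      by simp
  qed
  have cl: "fd (\<lambda>z. pulled \<tau> (pc d) z v w) z u - fd (\<lambda>z. pulled \<tau> (pc d) z u w) z v + fd (\<lambda>z. pulled \<tau> (pc d) z u v) z w = 0"
    if "z \<in> ball a R \<times> chart_image d" for z u v w
    using closed_two_formD(2)[OF pulled_closed[OF \<tau>] pcd, of z u v w] that unfolding pc_image ext_d2_def by blast
  have "fd (?H w) y v - fd (?H v) y w = pulled \<tau> (pc d) (?x, y) (0, v) (0, w) - pulled \<tau> (pc d) (a, y) (0, v) (0, w)"
    by (rule homotopy_form_fibre_derivative[OF findims(2,3) op tfe(1,3) cl x(1) y])
  also have "pulled \<tau> (pc d) (?x, y) (0, v) (0, w) = pb2 M (\<lambda>y. glue t b (chart_inv d y)) \<tau> y v w"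
    unfolding pulled_vertical[OF d x(1) y] x(2) ..
  also have "pulled \<tau> (pc d) (a, y) (0, v) (0, w) = pullback2 Fc M (\<lambda>x. x) \<tau> (fcc d) y v w"
    unfolding pulled_vertical[OF d centre_in_ball[THEN iffD2, OF R] y] pullback2_fibre[OF t centre_in(2) d y] by (simp add: centre_def)
  also have "\<dots> = \<omega>\<^sub>0 d y v w + ext_d1 \<beta> (fcc d) y v w"
    unfolding coh[OF fc y[folded ff(4)]] fibre_form_chart[OF t centre_in(2) d y] ..
  finally show ?thesis unfolding D by (simp add: ext_d1_def)
qed

end

section \<open>Correction along the fibres\<close>

definition (in symp_fib) "fibrewise \<tau> b \<longleftrightarrow>
  eq_form2 (fibre M F p T b) (pullback2 (fibre M F p T b) M (\<lambda>x. x) \<tau>) (fibre_form M F \<omega>\<^sub>0 p T b)"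

text \<open>C contains all points of the cell at which the bump function is nonzero. Its closedness
  in B, and not merely in the cell, is what makes extension by zero smooth across the boundary of
  the cell.\<close>

locale symp_bump = symp_patch M B F \<omega>\<^sub>0 p T t cB a R
  for M :: "('m, 'e::real_inner) manifold" and B :: "('b, 'h::real_inner) manifold"
    and F :: "('f, 'v::real_inner) manifold" and \<omega>\<^sub>0 p T t cB and a :: 'h and R :: real +
  fixes h :: "'h \<Rightarrow> real" and C :: "'b set"
  assumes h_smooth: "smooth_on UNIV h" and C: "closedin (mtop B) C"
    and h_zero: "\<And>b. b \<in> cell \<Longrightarrow> b \<notin> C \<Longrightarrow> h (snd cB b) = 0" and C_cell: "C \<subseteq> cell"
begin

definition "cdom c = {x \<in> chart_image c. p (chart_inv c x) \<in> cell}" for c :: "('m, 'e) chart"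

lemma cdom_eq: "c \<in> atlas M \<Longrightarrow> cdom c = snd c ` (fst c \<inter> (points M \<inter> p -` cell))"
proof -
  assume c: "c \<in> atlas M"
  have "fst c \<subseteq> points M" by (rule smooth_atlas_domain(2)[OF atlases(1) c])
  moreover have "\<And>x. x \<in> fst c \<Longrightarrow> chart_inv c (snd c x) = x" by (rule wk_atlas_inv[OF wkM c])
  ultimately show ?thesis unfolding cdom_def by force
qed

lemma cdom_open: "c \<in> atlas M \<Longrightarrow> open (cdom c)"
  using chart_open_image[OF atlases(1) _ base_preimage_open[OF cell_open]] cdom_eq by metis

text \<open>The counterpart of \<open>patch_to_total\<close>: the trivialization as a
  parametrization of the product by the part of a chart of M that lies over the cell. One-forms on
  the product return to M along it.\<close>

lemma cdom_param:
  assumes c: "c \<in> atlas M"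
  shows "smooth_param patch (cdom c) (\<lambda>x. snd t (chart_inv c x))"
  unfolding smooth_param_def
proof (intro conjI ballI cdom_open[OF c])
  fix x assume x: "x \<in> cdom c"
  let ?z = "chart_inv c x"
  have z: "?z \<in> fst c" "p ?z \<in> cell" using x by (auto simp: cdom_def intro: inv_into_into)
  have zt: "?z \<in> tube t" using z smooth_atlas_domain(2)[OF atlases(1) c] cell_sub by auto
  obtain d where d: "d \<in> atlas F" "snd (snd t ?z) \<in> fst d"
    using smooth_atlas_cover[OF atlases(3) triv_in[OF t zt]] by blast
  then have "snd t ?z \<in> fst (pc d)" using z triv_fst'[OF t zt] by (auto simp: pc_def mem_Times_iff)
  then show "\<exists>e\<in>atlas patch. snd t ?z \<in> fst e" using d atlas_patch by blast
next
  fix e assume "e \<in> atlas patch"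
  then obtain d where e: "d \<in> atlas F" "e = pc d" using atlas_patch by blast
  define W where "W = {x \<in> tube t. p x \<in> fst cB \<and> snd (snd t x) \<in> fst d}"
  note tc = triv_chart[OF t c cB e(1), folded W_def]
  have inv: "\<And>x. x \<in> fst c \<Longrightarrow> chart_inv c (snd c x) = x" by (rule wk_atlas_inv[OF wkM c])
  have eq: "cdom c \<inter> (\<lambda>x. snd t (chart_inv c x)) -` fst e = cdom c \<inter> snd c ` (fst c \<inter> W)"
  proof (intro set_eqI iffI)
    fix x assume x: "x \<in> cdom c \<inter> (\<lambda>x. snd t (chart_inv c x)) -` fst e"
    let ?z = "chart_inv c x"
    have z: "?z \<in> fst c" "p ?z \<in> cell" "snd c ?z = x" using x by (auto simp: cdom_def intro: inv_into_into f_inv_into_f)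
    have "?z \<in> W" unfolding W_def using z x smooth_atlas_domain(2)[OF atlases(1) c] cell_sub by (auto simp: e(2) pc_def mem_Times_iff)
    then show "x \<in> cdom c \<inter> snd c ` (fst c \<inter> W)" using x z by (metis IntD1 IntI image_eqI)
  next
    fix x assume x: "x \<in> cdom c \<inter> snd c ` (fst c \<inter> W)"
    then obtain z where z: "z \<in> fst c" "z \<in> W" "x = snd c z" by auto
    then have "p z \<in> cell" "z \<in> tube t" "snd (snd t z) \<in> fst d" using x inv[OF z(1)] by (auto simp: cdom_def W_def)
    then show "x \<in> cdom c \<inter> (\<lambda>x. snd t (chart_inv c x)) -` fst e"
      using x z inv[OF z(1)] triv_fst'[OF t] by (auto simp: e(2) pc_def mem_Times_iff)
  qed
  show op: "open (cdom c \<inter> (\<lambda>x. snd t (chart_inv c x)) -` fst e)"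
    unfolding eq by (intro open_Int cdom_open[OF c] tc)
  have "smooth_on (cdom c \<inter> (\<lambda>x. snd t (chart_inv c x)) -` fst e) (\<lambda>x. (snd cB (p (chart_inv c x)), snd d (snd (snd t (chart_inv c x)))))"
    unfolding eq by (rule smooth_on_subset[OF tc(3)]) auto
  then show "smooth_on (cdom c \<inter> (\<lambda>x. snd t (chart_inv c x)) -` fst e) (\<lambda>x. snd e (snd t (chart_inv c x)))"
  proof (rule smooth_on_cong[OF op])
    fix x assume "x \<in> cdom c \<inter> (\<lambda>x. snd t (chart_inv c x)) -` fst e"
    then obtain z where z: "z \<in> fst c" "z \<in> W" "x = snd c z" unfolding eq by auto
    then have "z \<in> tube t" by (simp add: W_def)
    from triv_fst'[OF t this] inv[OF z(1)]
    show "(snd cB (p (chart_inv c x)), snd d (snd (snd t (chart_inv c x)))) = snd e (snd t (chart_inv c x))"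
      unfolding e(2) pc_def z(3) by (simp add: map_prod_def split_beta)
  qed
qed

text \<open>The sign is built in, so that the corrected form is \<tau> plus the exterior derivative
  of this one-form.\<close>

definition "correction \<alpha> = (\<lambda>c x v. if p (chart_inv c x) \<in> cell
  then - h (snd cB (p (chart_inv c x))) * pb1 patch (\<lambda>x. snd t (chart_inv c x)) \<alpha> x v else 0)"
  for \<alpha> :: "('b \<times> 'f, 'h \<times> 'v) form1"

lemma correction_one_form:
  assumes \<alpha>: "one_form patch \<alpha>"
  shows "one_form M (correction \<alpha>)"
  unfolding one_form_def
proof (intro conjI ballI allI)
  fix c x v assume c: "c \<in> atlas M"
  note pf = pb1_form[OF wk_patch findim_hv cdom_param[OF c] \<alpha>]
  show "linear (correction \<alpha> c x)" if x: "x \<in> chart_image c"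
  proof (cases "p (chart_inv c x) \<in> cell")
    case True
    then have "x \<in> cdom c" using x by (simp add: cdom_def)
    from linear_compose_scale_right[OF pf(1)[OF this], of "- h (snd cB (p (chart_inv c x)))"]
    show ?thesis using True by (simp add: correction_def)
  next
    case False then show ?thesis by (simp add: correction_def linear_iff)
  qed
  show "smooth_on (chart_image c) (\<lambda>x. correction \<alpha> c x v)"
  proof (rule smooth_on_local)
    fix x assume x: "x \<in> chart_image c"
    show "\<exists>U. open U \<and> x \<in> U \<and> smooth_on U (\<lambda>x. correction \<alpha> c x v)"
    proof (cases "x \<in> cdom c")
      case True
      have "smooth_param B (chart_image c) (\<lambda>x. p (chart_inv c x))" using chart_smooth_p c by (simp add: chart_smooth_def)
      note r = chart_rep[OF wkB this cB]
      have "smooth_on (cdom c) (\<lambda>x. snd cB (p (chart_inv c x)))"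
        by (rule smooth_on_subset[OF r(2)]) (use cell_sub in \<open>auto simp: cdom_def\<close>)
      from smooth_on_compose[OF findims(2) cdom_open[OF c] open_UNIV this h_smooth]
      have "smooth_on (cdom c) (\<lambda>x. - h (snd cB (p (chart_inv c x))) * pb1 patch (\<lambda>x. snd t (chart_inv c x)) \<alpha> x v)"
        by (intro smooth_on_mult smooth_on_uminus cdom_open[OF c] pf(2)) auto
      then have "smooth_on (cdom c) (\<lambda>x. correction \<alpha> c x v)"
        by (rule smooth_on_cong[OF cdom_open[OF c]]) (auto simp: correction_def cdom_def)
      then show ?thesis using True cdom_open[OF c] by blast
    next
      case False
      \<comment> \<open>The part of the chart over the complement of C. It is open because C is
        closed in B, and the correction vanishes on it: inside the cell by \<open>h_zero\<close>,
        outside by definition.\<close>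
      let ?U = "snd c ` (fst c \<inter> (points M \<inter> p -` (points B - C)))"
      have op: "open ?U"
        by (rule chart_open_image[OF atlases(1) c base_preimage_open]) (use C in \<open>simp add: closedin_def\<close>)
      obtain z where z: "z \<in> fst c" "x = snd c z" using x by auto
      have inv: "\<And>x. x \<in> fst c \<Longrightarrow> chart_inv c (snd c x) = x" by (rule wk_atlas_inv[OF wkM c])
      have zM: "z \<in> points M" using z smooth_atlas_domain(2)[OF atlases(1) c] by auto
      have "p z \<notin> cell" using False x z inv[OF z(1)] by (auto simp: cdom_def)
      then have xU: "x \<in> ?U" using z zM p_in[OF zM] C_cell by auto
      have "correction \<alpha> c y v = 0" if y: "y \<in> ?U" for y
      proof -
        obtain w where w: "w \<in> fst c" "y = snd c w" "p w \<notin> C" using y by auto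
        then show ?thesis using inv[OF w(1)] h_zero[of "p w"] by (simp add: correction_def)
      qed
      then have "smooth_on ?U (\<lambda>x. correction \<alpha> c x v)"
        using smooth_on_cong[OF op smooth_on_const[of ?U 0]] by metis
      then show ?thesis using op xU by blast
    qed
  qed
  fix c' assume c': "c' \<in> atlas M" and x: "x \<in> snd c ` (fst c \<inter> fst c')"
  note o = overlap_transition[OF wkM c c']
  let ?g = "coord_expr c id c'"
  have i: "chart_inv c' (?g x) = chart_inv c x" by (rule o(4)[OF x])
  show "correction \<alpha> c x v = correction \<alpha> c' (?g x) (fd ?g x v)"
  proof (cases "p (chart_inv c x) \<in> cell")
    case True
    then have "?g x \<in> cdom c'" using i o(3) x by (auto simp: cdom_def)
    from pb_overlap(1)[OF wkM c c' findims(1) cdom_param[OF c'] x this]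
    show ?thesis using True i by (simp add: correction_def)
  next
    case False then show ?thesis using i by (simp add: correction_def)
  qed
qed

text \<open>\<open>p\<close> is constant on the fibre, so the one-form pulls back to zero at all of
  its points at once and can be differentiated there. Fibres over the boundary of the cell are
  included.\<close>

lemma correction_outside:
  assumes s: "s \<in> T" "b \<in> fst s" and b: "b \<notin> cell" and d: "d \<in> atlas F" and y: "y \<in> chart_image d" and \<alpha>: "one_form patch \<alpha>"
  shows "pb2 M (\<lambda>y. glue s b (chart_inv d y)) (ext_d1 (correction \<alpha>)) y v w = 0"
proof -
  let ?\<phi> = "\<lambda>y. glue s b (chart_inv d y)"
  note sp = fibre_param[OF s d]
  have "pb1 M ?\<phi> (correction \<alpha>) y v = 0" if y: "y \<in> chart_image d" for y v
  proof -
    define c where "c = (SOME c. c \<in> atlas M \<and> ?\<phi> y \<in> fst c)"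
    have c: "c \<in> atlas M" "?\<phi> y \<in> fst c" using some_chart[OF sp y] by (auto simp: c_def)
    have "p (?\<phi> y) = b" by (rule glue_in(3)[OF s chart_F_in[OF d y]])
    then show ?thesis unfolding pb1_def Let_def c_def[symmetric] using b wk_atlas_inv[OF wkM c] by (simp add: correction_def)
  qed
  then have "fd (\<lambda>y. pb1 M ?\<phi> (correction \<alpha>) y v) y = fd (\<lambda>y. 0) y" for v
    by (intro frechet_derivative_cong_open[OF wk_atlas_open[OF wkF d] y])
  then show ?thesis
    unfolding pb_ext_d1[OF wkM findims(1) sp correction_one_form[OF \<alpha>] y] by simp
qed

text \<open>The bump function enters through \<open>p\<close>, which is constant on the fibre, so it
  comes out as a scalar. This is why differentiating along the fibre produces no term with the
  derivative of h.\<close>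

lemma correction_inside:
  assumes b: "b \<in> cell" and d: "d \<in> atlas F" and y: "y \<in> chart_image d" and \<alpha>: "one_form patch \<alpha>"
  shows "pb1 M (\<lambda>y. glue t b (chart_inv d y)) (correction \<alpha>) y v = - h (snd cB b) * \<alpha> (pc d) (snd cB b, y) (0, v)"
proof -
  let ?\<phi> = "\<lambda>y. glue t b (chart_inv d y)"
  have bt: "b \<in> fst t" using b cell_sub by auto
  note sp = fibre_param[OF t bt d]
  obtain c where c: "c \<in> atlas M" "?\<phi> y \<in> fst c" using smooth_param_ex[OF sp y] by blast
  note r = chart_rep[OF wkM sp c(1)]
  let ?Y = "chart_image d \<inter> ?\<phi> -` fst c" and ?g = "\<lambda>y. snd c (?\<phi> y)"
  have yY: "y \<in> ?Y" using y c by auto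
  have inv: "chart_inv c (?g y) = ?\<phi> y" if "y \<in> ?Y" for y using wk_atlas_inv[OF wkM c(1)] that by auto
  have p\<phi>: "p (?\<phi> y) = b" "snd t (?\<phi> y) = (b, chart_inv d y)" if "y \<in> chart_image d" for y
    using glue_in(2,3)[OF t bt chart_F_in[OF d that]] by auto
  have g: "?g ` ?Y \<subseteq> cdom c" using inv p\<phi> b by (auto simp: cdom_def)
  let ?\<psi> = "\<lambda>x. snd t (chart_inv c x)"
  have "pb1 M ?\<phi> (correction \<alpha>) y v = correction \<alpha> c (?g y) (fd ?g y v)"
    by (rule pb1_chart[OF wkM sp correction_one_form[OF \<alpha>] c(1) y c(2)])
  also have "\<dots> = - h (snd cB b) * pb1 patch ?\<psi> \<alpha> (?g y) (fd ?g y v)"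
    using inv[OF yY] p\<phi>[OF y] b by (simp add: correction_def)
  also have "pb1 patch ?\<psi> \<alpha> (?g y) (fd ?g y v) = pb1 patch (\<lambda>y. ?\<psi> (?g y)) \<alpha> y v"
    by (rule pb_compose(1)[OF cdom_param[OF c(1)] r(2) g yY, symmetric])
  also have "\<dots> = pb1 patch (\<lambda>y. (b, chart_inv d y)) \<alpha> y v"
    by (rule fun_cong[OF pb_cong(1)[OF r(1) yY]]) (use inv p\<phi> in auto)
  also have "\<dots> = \<alpha> (pc d) (snd (pc d) (b, chart_inv d y)) (fd (\<lambda>y. snd (pc d) (b, chart_inv d y)) y v)"
  proof (rule pb1_chart[OF wk_patch _ \<alpha> _ yY])
    have "smooth_param patch ?Y (\<lambda>y. ?\<psi> (?g y))" by (rule smooth_param_compose[OF cdom_param[OF c(1)] findims(1) r(1,2) g])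
    then show "smooth_param patch ?Y (\<lambda>y. (b, chart_inv d y))" by (rule smooth_param_cong) (use inv p\<phi> in auto)
    show "pc d \<in> atlas patch" using d atlas_patch by blast
    show "(b, chart_inv d y) \<in> fst (pc d)" using b inv_into_into[OF y] by (simp add: pc_def)
  qed
  also have "snd (pc d) (b, chart_inv d y) = (snd cB b, y)" using f_inv_into_f[OF y] by (simp add: pc_def)
  also have "fd (\<lambda>y. snd (pc d) (b, chart_inv d y)) y = fd (\<lambda>y. (snd cB b, y)) y"
    by (rule frechet_derivative_cong_open[OF wk_atlas_open[OF wkF d] y]) (simp add: pc_def f_inv_into_f)
  also have "fd (\<lambda>y. (snd cB b, y)) y = (\<lambda>v. (0, v))"
    by (rule frechet_derivativeI) (auto intro!: derivative_eq_intros)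
  finally show ?thesis .
qed

text \<open>On a fibre over the cell the new form differs from the fibre form by (1 - h) times the
  old difference. The factor vanishes where h = 1, and a zero difference stays zero; on the fibres
  outside the cell nothing changes.\<close>

lemma patch_step:
  assumes \<tau>: "closed_two_form M \<tau>" and coh: "(pullback2 Fc M (\<lambda>x. x) \<tau>, fibre_form M F \<omega>\<^sub>0 p T centre) \<in> cohomologous Fc"
  shows "\<exists>\<tau>'. (\<tau>', \<tau>) \<in> cohomologous M \<and> (\<forall>b\<in>points B.
    (b \<in> cell \<and> h (snd cB b) = 1 \<longrightarrow> fibrewise \<tau>' b) \<and> (fibrewise \<tau> b \<longrightarrow> fibrewise \<tau>' b))"
proof -
  obtain \<beta> where \<beta>: "one_form Fc \<beta>" "\<And>c x v w. c \<in> atlas Fc \<Longrightarrow> x \<in> chart_image c \<Longrightarrow>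
      pullback2 Fc M (\<lambda>x. x) \<tau> c x v w = fibre_form M F \<omega>\<^sub>0 p T centre c x v w + ext_d1 \<beta> c x v w"
    using cohomologousD[OF coh] by blast
  define \<alpha> where "\<alpha> = primitive \<tau> \<beta>"
  have \<alpha>: "one_form patch \<alpha>" unfolding \<alpha>_def by (rule primitive_one_form[OF \<tau> \<beta>(1)])
  let ?\<gamma> = "correction \<alpha>"
  note \<gamma> = correction_one_form[OF \<alpha>]
  have cl\<gamma>: "closed_two_form M (ext_d1 ?\<gamma>)" by (rule ext_d1_closed[OF wkM findims(1) \<gamma>])
  define \<tau>' where "\<tau>' = add_form2 \<tau> (ext_d1 ?\<gamma>)"
  have \<tau>': "closed_two_form M \<tau>'" unfolding \<tau>'_def by (rule closed_two_form_add[OF wkM \<tau> cl\<gamma>])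
  have co: "(\<tau>', \<tau>) \<in> cohomologous M"
    by (rule cohomologousI[OF \<tau>' \<tau> \<gamma>]) (simp add: \<tau>'_def add_form2_def)
  have pb: "pb2 M (\<lambda>y. glue s b (chart_inv d y)) \<tau>' y v w =
     pb2 M (\<lambda>y. glue s b (chart_inv d y)) \<tau> y v w + pb2 M (\<lambda>y. glue s b (chart_inv d y)) (ext_d1 ?\<gamma>) y v w"
    if "s \<in> T" "b \<in> fst s" "d \<in> atlas F" "y \<in> chart_image d" for s b d y v w
    by (rule pb2_add[OF fibre_param[OF that(1-3)] that(4)]) (simp add: \<tau>'_def add_form2_def)
  have inside: "pb2 M (\<lambda>y. glue t b (chart_inv d y)) (ext_d1 ?\<gamma>) y v w =
     - h (snd cB b) * (pb2 M (\<lambda>y. glue t b (chart_inv d y)) \<tau> y v w - \<omega>\<^sub>0 d y v w)"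
    if b: "b \<in> cell" and d: "d \<in> atlas F" and y: "y \<in> chart_image d" for b d y v w
  proof -
    let ?\<phi> = "\<lambda>y. glue t b (chart_inv d y)"
    have bt: "b \<in> fst t" using b cell_sub by auto
    have x: "snd cB b \<in> ball a R" using b cell_iff by auto
    have op: "open (chart_image d)" by (rule wk_atlas_open[OF wkF d])
    have "pc d \<in> atlas patch" using d atlas_patch by blast
    note as = one_formD(2)[OF \<alpha> this, unfolded pc_image]
    have sm: "smooth_on (chart_image d) (\<lambda>y. \<alpha> (pc d) (snd cB b, y) (0, v))" for v
      by (rule smooth_on_compose[OF findim_hv op open_Times[OF open_ball op] _ as])
        (use x in \<open>auto intro!: smooth_on_Pair smooth_on_const smooth_on_ident op\<close>)
    have D: "fd (\<lambda>y. pb1 M ?\<phi> ?\<gamma> y v) y = (\<lambda>u. - h (snd cB b) * fd (\<lambda>y. \<alpha> (pc d) (snd cB b, y) (0, v)) y u)" for v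
    proof -
      have "fd (\<lambda>y. pb1 M ?\<phi> ?\<gamma> y v) y = fd (\<lambda>y. - h (snd cB b) * \<alpha> (pc d) (snd cB b, y) (0, v)) y"
        by (rule frechet_derivative_cong_open[OF op y]) (rule correction_inside[OF b d _ \<alpha>])
      then show ?thesis using frechet_derivativeI[OF has_derivative_mult_right[OF smooth_on_has_derivative[OF sm y], of "- h (snd cB b)"]]
        by simp
    qed
    have pv: "pb2 M ?\<phi> \<tau> y v w - \<omega>\<^sub>0 d y v w =
      fd (\<lambda>y. \<alpha> (pc d) (snd cB b, y) (0, w)) y v - fd (\<lambda>y. \<alpha> (pc d) (snd cB b, y) (0, v)) y w"
      unfolding \<alpha>_def by (rule primitive_vertical_derivative[OF \<tau> \<beta>(1) d b y \<beta>(2), symmetric])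
    show ?thesis
      unfolding pb_ext_d1[OF wkM findims(1) fibre_param[OF t bt d] \<gamma> y] D pv
      by (simp add: algebra_simps)
  qed
  have tf: "two_form (fibre M F p T b) (pullback2 (fibre M F p T b) M (\<lambda>x. x) \<tau>')" for b
    by (rule pullback_forms(2)[OF wk_fibre wkM findims(3,1) fibre_inclusion_smooth closed_two_formD(1)[OF \<tau>']])
  have ok: "fibrewise \<tau>' b" if b: "b \<in> cell" and "h (snd cB b) = 1 \<or> fibrewise \<tau> b" for b
    unfolding fibrewise_def
  proof (rule two_form_fibre_eqI[OF tf closed_two_formD(1)[OF fibre_form_closed] t])
    show bt: "b \<in> fst t" using b cell_sub by auto
    fix d y v w assume d: "d \<in> atlas F" and y: "y \<in> chart_image d"
    have "pb2 M (\<lambda>y. glue t b (chart_inv d y)) \<tau> y v w = \<omega>\<^sub>0 d y v w" if "fibrewise \<tau> b"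
      using that atlas_fibreI[OF t bt d] y
      unfolding fibrewise_def eq_form2_def pullback2_fibre[OF t bt d y, symmetric] fibre_form_chart[OF t bt d y, symmetric]
      unfolding fibre_chart_facts(4)[OF t bt d, symmetric] by blast
    then show "pullback2 (fibre M F p T b) M (\<lambda>x. x) \<tau>' (fibre_chart M p b t d) y v w =
      fibre_form M F \<omega>\<^sub>0 p T b (fibre_chart M p b t d) y v w"
      unfolding pullback2_fibre[OF t bt d y] fibre_form_chart[OF t bt d y] pb[OF t bt d y] inside[OF b d y]
      using that(2) by auto
  qed
  have out: "fibrewise \<tau>' b" if b: "b \<notin> cell" and v: "fibrewise \<tau> b" for b
    unfolding fibrewise_def eq_form2_def
  proof (intro ballI allI)
    fix c x v w assume c0: "c \<in> atlas (fibre M F p T b)" and x: "x \<in> chart_image c"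
    obtain s d where c: "s \<in> T" "b \<in> fst s" "d \<in> atlas F" "c = fibre_chart M p b s d" using c0 by (rule atlas_fibre_cases)
    have y: "x \<in> chart_image d" using x unfolding c(4) fibre_chart_facts(4)[OF c(1-3)] .
    have "pullback2 (fibre M F p T b) M (\<lambda>x. x) \<tau>' c x v w = pullback2 (fibre M F p T b) M (\<lambda>x. x) \<tau> c x v w"
      unfolding c(4) pullback2_fibre[OF c(1-3) y] pb[OF c(1-3) y] correction_outside[OF c(1,2) b c(3) y \<alpha>] by simp
    then show "pullback2 (fibre M F p T b) M (\<lambda>x. x) \<tau>' c x v w = fibre_form M F \<omega>\<^sub>0 p T b c x v w"
      using v c0 x unfolding fibrewise_def eq_form2_def by simp
  qed
  show ?thesis using co ok out by blast
qed

end

section \<open>Finite covers of the compact base\<close>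

locale compact_symp_fib = symp_fib M B F \<omega>\<^sub>0 p T
  for M :: "('m, 'e::real_inner) manifold" and B :: "('b, 'h::euclidean_space) manifold"
    and F :: "('f, 'v::real_inner) manifold" and \<omega>\<^sub>0 p T +
  assumes compactB: "compact_space (mtop B)" and compactF: "compact_space (mtop F)"
begin

lemma patch_exists:
  assumes b: "b \<in> points B"
  obtains t cB r where "symp_patch M B F \<omega>\<^sub>0 p T t cB (snd cB b) (3 * r)" "0 < r" "cB \<in> atlas B" "b \<in> fst cB" "t \<in> T"
    "cball (snd cB b) (2 * r) \<subseteq> snd cB ` (fst cB \<inter> fst t)"
proof -
  obtain t where t: "t \<in> T" "b \<in> fst t" using cover b by blast
  obtain cB where cB: "cB \<in> atlas B" "b \<in> fst cB" using smooth_atlas_cover[OF atlases(2) b] by blast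
  have "open (snd cB ` (fst cB \<inter> fst t))" by (rule chart_open_image[OF atlases(2) cB(1) fst_T(1)[OF t(1)]])
  moreover have "snd cB b \<in> snd cB ` (fst cB \<inter> fst t)" using t cB by auto
  ultimately obtain e where e: "e > 0" "ball (snd cB b) e \<subseteq> snd cB ` (fst cB \<inter> fst t)" by (rule openE)
  \<comment> \<open>Room for three concentric balls: the bump function will be 1 up to radius r and
    0 beyond 2 r, and the cell has radius 3 r, so that the closed ball of radius 2 r is compact
    inside it.\<close>
  define r where "r = e / 3"
  have r: "0 < r" "3 * r = e" using e by (auto simp: r_def)
  have "symp_patch M B F \<omega>\<^sub>0 p T t cB (snd cB b) (3 * r)"
    by unfold_locales (use t cB e r in auto)
  moreover have "cball (snd cB b) (2 * r) \<subseteq> snd cB ` (fst cB \<inter> fst t)"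
    using e(2) r by (intro subset_trans[OF _ e(2)]) auto
  ultimately show ?thesis using that r cB t by blast
qed

lemma compactin_chart_ball:
  assumes "cB \<in> atlas B" "cball a r \<subseteq> chart_image cB"
  shows "compactin (mtop B) (chart_inv cB ` cball a r)"
  by (rule image_compactin[OF _ chart_inv_continuous[OF atlases(2) assms(1)]])
    (use assms(2) in \<open>simp add: compactin_subtopology compactin_euclidean_iff\<close>)

definition "fibre_cohomologous \<tau> \<longleftrightarrow> closed_two_form M \<tau> \<and> (\<forall>b\<in>points B.
  (pullback2 (fibre M F p T b) M (\<lambda>x. x) \<tau>, fibre_form M F \<omega>\<^sub>0 p T b) \<in> cohomologous (fibre M F p T b))"

text \<open>Makes the correction repeatable: a corrected form is again admissible input for the next
  step.\<close>

lemma fibre_cohomologous_cong: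
  assumes "fibre_cohomologous \<tau>" "(\<tau>', \<tau>) \<in> cohomologous M"
  shows "fibre_cohomologous \<tau>'"
  unfolding fibre_cohomologous_def
proof (intro conjI ballI)
  show "closed_two_form M \<tau>'" using assms(2) by (simp add: cohomologous_def)
  fix b assume b: "b \<in> points B"
  have 1: "(pullback2 (fibre M F p T b) M (\<lambda>x. x) \<tau>', pullback2 (fibre M F p T b) M (\<lambda>x. x) \<tau>) \<in> cohomologous (fibre M F p T b)"
    by (rule cohomologous_pullback[OF wk_fibre wkM findims(3,1) fibre_inclusion_smooth assms(2)])
  have 2: "(pullback2 (fibre M F p T b) M (\<lambda>x. x) \<tau>, fibre_form M F \<omega>\<^sub>0 p T b) \<in> cohomologous (fibre M F p T b)"
    using assms(1) b by (simp add: fibre_cohomologous_def)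
  show "(pullback2 (fibre M F p T b) M (\<lambda>x. x) \<tau>', fibre_form M F \<omega>\<^sub>0 p T b) \<in> cohomologous (fibre M F p T b)"
    using cohomologous_equiv[OF wk_fibre] 1 2 by (meson equivE transD)
qed

text \<open>The neighbourhood is chosen before \<tau>, so one finite cover can be fixed although the
  form changes at every step.\<close>

lemma local_correction:
  assumes b: "b \<in> points B"
  shows "\<exists>V. openin (mtop B) V \<and> b \<in> V \<and> (\<forall>\<tau>. fibre_cohomologous \<tau> \<longrightarrow> (\<exists>\<tau>'. (\<tau>', \<tau>) \<in> cohomologous M \<and>
    (\<forall>b'\<in>points B. (b' \<in> V \<longrightarrow> fibrewise \<tau>' b') \<and> (fibrewise \<tau> b' \<longrightarrow> fibrewise \<tau>' b'))))"
proof -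
  obtain t cB r where P: "symp_patch M B F \<omega>\<^sub>0 p T t cB (snd cB b) (3 * r)" and r: "0 < r" and cB: "cB \<in> atlas B" "b \<in> fst cB" and t: "t \<in> T"
    and cb: "cball (snd cB b) (2 * r) \<subseteq> snd cB ` (fst cB \<inter> fst t)" by (rule patch_exists[OF b])
  let ?a = "snd cB b"
  interpret P: symp_patch M B F \<omega>\<^sub>0 p T t cB ?a "3 * r" by (rule P)
  \<comment> \<open>A second cell with the same centre and radius r: there the bump function is 1,
    so it serves as the neighbourhood.\<close>
  interpret V: symp_patch M B F \<omega>\<^sub>0 p T t cB ?a r
  proof unfold_locales
    show "ball ?a r \<subseteq> snd cB ` (fst cB \<inter> fst t)" using cb r by (intro subset_trans[OF _ cb]) auto
  qed (use r t cB in auto)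
  obtain h where h: "smooth_on UNIV h" "\<And>x. x \<in> ball ?a r \<Longrightarrow> h x = (1::real)" "\<And>x. x \<notin> cball ?a (2 * r) \<Longrightarrow> h x = 0"
    using smooth_bump_exists[OF r, of ?a] by blast
  define C where "C = chart_inv cB ` cball ?a (2 * r)"
  have comp: "compactin (mtop B) C" unfolding C_def by (rule compactin_chart_ball[OF cB(1)]) (use cb in auto)
  interpret S: symp_bump M B F \<omega>\<^sub>0 p T t cB ?a "3 * r" h C
  proof unfold_locales
    show "smooth_on UNIV h" by (rule h)
    show "closedin (mtop B) C" using comp manifolds(2) by (intro compactin_imp_closedin) (auto simp: smooth_manifold_def)
    have "cball ?a (2 * r) \<subseteq> ball ?a (3 * r)" using r by auto
    then show "C \<subseteq> P.cell" unfolding C_def P.cell_def by (rule image_mono)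
    fix b' assume b': "b' \<in> P.cell" "b' \<notin> C"
    have "chart_inv cB (snd cB b') = b'" using b' P.cell_sub by (intro wk_atlas_inv[OF wkB cB(1)]) auto
    then have "snd cB b' \<notin> cball ?a (2 * r)" using b'(2) unfolding C_def by (metis image_eqI)
    then show "h (snd cB b') = 0" by (rule h(3))
  qed
  have centre: "P.centre = b" unfolding P.centre_def by (rule wk_atlas_inv[OF wkB cB])
  show ?thesis
  proof (intro exI[of _ V.cell] conjI allI impI V.cell_open)
    show "b \<in> V.cell" unfolding V.cell_iff using cB r by simp
    fix \<tau> assume \<tau>: "fibre_cohomologous \<tau>"
    have "\<exists>\<tau>'. (\<tau>', \<tau>) \<in> cohomologous M \<and> (\<forall>b\<in>points B.
      (b \<in> P.cell \<and> h (snd cB b) = 1 \<longrightarrow> fibrewise \<tau>' b) \<and> (fibrewise \<tau> b \<longrightarrow> fibrewise \<tau>' b))"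
      using S.patch_step[of \<tau>] \<tau> b unfolding centre fibre_cohomologous_def by blast
    moreover have "b' \<in> P.cell \<and> h (snd cB b') = 1" if "b' \<in> V.cell" for b'
      using that r h(2) unfolding V.cell_iff P.cell_iff by auto
    ultimately show "\<exists>\<tau>'. (\<tau>', \<tau>) \<in> cohomologous M \<and>
      (\<forall>b'\<in>points B. (b' \<in> V.cell \<longrightarrow> fibrewise \<tau>' b') \<and> (fibrewise \<tau> b' \<longrightarrow> fibrewise \<tau>' b'))" by meson
  qed
qed

lemma fibrewise_representative:
  assumes \<tau>: "fibre_cohomologous \<tau>"
  shows "\<exists>\<tau>'. (\<tau>', \<tau>) \<in> cohomologous M \<and> (\<forall>b\<in>points B. fibrewise \<tau>' b)"
proof -
  define good where "good = (\<lambda>V. openin (mtop B) V \<and> (\<forall>\<tau>. fibre_cohomologous \<tau> \<longrightarrow> (\<exists>\<tau>'. (\<tau>', \<tau>) \<in> cohomologous M \<and>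
    (\<forall>b'\<in>points B. (b' \<in> V \<longrightarrow> fibrewise \<tau>' b') \<and> (fibrewise \<tau> b' \<longrightarrow> fibrewise \<tau>' b')))))"
  have "points B \<subseteq> \<Union>(Collect good)" using local_correction unfolding good_def by fast
  moreover have "\<forall>V\<in>Collect good. openin (mtop B) V" by (simp add: good_def)
  ultimately obtain \<V> where \<V>: "finite \<V>" "\<V> \<subseteq> Collect good" "points B \<subseteq> \<Union>\<V>"
    using compactB unfolding compact_space_def compactin_def by meson
  have "\<exists>\<tau>'. (\<tau>', \<tau>) \<in> cohomologous M \<and> (\<forall>b\<in>points B. b \<in> \<Union>\<V> \<longrightarrow> fibrewise \<tau>' b)"
    using \<V>(1,2)
  proof (induction \<V> rule: finite_induct)
    case empty
    show ?case using \<tau> cohomologous_refl by (auto simp: fibre_cohomologous_def)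
  next
    case (insert V \<V>)
    then obtain \<tau>1 where 1: "(\<tau>1, \<tau>) \<in> cohomologous M" "\<forall>b\<in>points B. b \<in> \<Union>\<V> \<longrightarrow> fibrewise \<tau>1 b" by auto
    have "good V" using insert by simp
    then obtain \<tau>2 where 2: "(\<tau>2, \<tau>1) \<in> cohomologous M"
      "\<forall>b'\<in>points B. (b' \<in> V \<longrightarrow> fibrewise \<tau>2 b') \<and> (fibrewise \<tau>1 b' \<longrightarrow> fibrewise \<tau>2 b')"
      using fibre_cohomologous_cong[OF \<tau> 1(1)] unfolding good_def by blast
    have "(\<tau>2, \<tau>) \<in> cohomologous M" using cohomologous_equiv[OF wkM] 1(1) 2(1) by (meson equivE transD)
    then show ?case using 1(2) 2(2) by blast
  qed
  then obtain \<tau>' where "(\<tau>', \<tau>) \<in> cohomologous M" "\<forall>b\<in>points B. b \<in> \<Union>\<V> \<longrightarrow> fibrewise \<tau>' b" by (elim exE conjE)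
  then show ?thesis using \<V>(3) by (intro exI[of _ \<tau>'] conjI ballI) (assumption, metis subsetD)
qed

text \<open>Over a closed coordinate ball inside a trivializing set, the total space is the image of
  a compact product with F. Finitely many such balls cover the base, and their preimages exhaust
  M.\<close>

lemma compact_total: "compact_space (mtop M)"
proof -
  define good where "good = (\<lambda>V. openin (mtop B) V \<and> (\<exists>C. V \<subseteq> C \<and> compactin (mtop M) (points M \<inter> p -` C)))"
  have "\<exists>V. good V \<and> b \<in> V" if b: "b \<in> points B" for b
  proof -
    obtain t cB r where P: "symp_patch M B F \<omega>\<^sub>0 p T t cB (snd cB b) (3 * r)" and r: "0 < r" and cB: "cB \<in> atlas B" "b \<in> fst cB" and t: "t \<in> T"
      and cb: "cball (snd cB b) (2 * r) \<subseteq> snd cB ` (fst cB \<inter> fst t)" by (rule patch_exists[OF b])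
    let ?a = "snd cB b"
    interpret V: symp_patch M B F \<omega>\<^sub>0 p T t cB ?a r
    proof unfold_locales
      show "ball ?a r \<subseteq> snd cB ` (fst cB \<inter> fst t)" using cb r by (intro subset_trans[OF _ cb]) auto
    qed (use r t cB in auto)
    define C where "C = chart_inv cB ` cball ?a (2 * r)"
    have comp: "compactin (mtop B) C" unfolding C_def by (rule compactin_chart_ball[OF cB(1)]) (use cb in auto)
    have Ct: "C \<subseteq> fst t" unfolding C_def using base_chart_inv[OF cB(1), of _ "fst t"] cb by auto
    obtain q where q: "smooth_map (product_manifold (open_submanifold B (fst t)) F) (open_submanifold M (tube t)) q"
      "\<And>x. x \<in> tube t \<Longrightarrow> q (snd t x) = x" "\<And>z. z \<in> fst t \<times> points F \<Longrightarrow> snd t (q z) = z \<and> q z \<in> tube t"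
      using triv_smooth(2)[OF t] by blast
    have contq: "continuous_map (prod_topology (subtopology (mtop B) (fst t)) (mtop F)) (mtop M) q"
      using q(1) by (simp add: smooth_map_def product_manifold_def open_submanifold_def continuous_map_in_subtopology)
    have "compactin (prod_topology (subtopology (mtop B) (fst t)) (mtop F)) (C \<times> points F)"
      using comp Ct compactF by (auto simp: compactin_Times compactin_subtopology compact_space_def)
    from image_compactin[OF this contq] have "compactin (mtop M) (q ` (C \<times> points F))" .
    moreover have "q ` (C \<times> points F) = points M \<inter> p -` C"
    proof
      show "q ` (C \<times> points F) \<subseteq> points M \<inter> p -` C"
      proof
        fix x assume "x \<in> q ` (C \<times> points F)"
        then obtain b y where "b \<in> C" "y \<in> points F" "x = q (b, y)" by auto
        then show "x \<in> points M \<inter> p -` C" using q(3)[of "(b, y)"] triv_fst'[OF t, of x] Ct by auto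
      qed
      show "points M \<inter> p -` C \<subseteq> q ` (C \<times> points F)"
      proof
        fix x assume x: "x \<in> points M \<inter> p -` C"
        then have xt: "x \<in> tube t" using Ct by auto
        have "snd t x \<in> C \<times> points F" using x triv_fst'[OF t xt] triv_in[OF t xt] by (auto simp: mem_Times_iff)
        then show "x \<in> q ` (C \<times> points F)" using q(2)[OF xt] by (metis image_eqI)
      qed
    qed
    moreover have "V.cell \<subseteq> C" unfolding V.cell_def C_def using r by (intro image_mono) auto
    moreover have "b \<in> V.cell" unfolding V.cell_iff using cB r by simp
    ultimately show ?thesis using V.cell_open unfolding good_def by metis
  qed
  then have "points B \<subseteq> \<Union>(Collect good)" by blast
  moreover have "\<forall>V\<in>Collect good. openin (mtop B) V" by (simp add: good_def)
  ultimately obtain \<V> where \<V>: "finite \<V>" "\<V> \<subseteq> Collect good" "points B \<subseteq> \<Union>\<V>"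
    using compactB unfolding compact_space_def compactin_def by meson
  obtain C where C: "\<And>V. V \<in> \<V> \<Longrightarrow> V \<subseteq> C V" "\<And>V. V \<in> \<V> \<Longrightarrow> compactin (mtop M) (points M \<inter> p -` C V)"
  proof -
    have "\<forall>V\<in>\<V>. \<exists>C. V \<subseteq> C \<and> compactin (mtop M) (points M \<inter> p -` C)" using \<V>(2) unfolding good_def by auto
    from bchoice[OF this] show ?thesis using that by blast
  qed
  have "compactin (mtop M) (\<Union>((\<lambda>V. points M \<inter> p -` C V) ` \<V>))"
    by (rule compactin_Union) (use \<V>(1) C(2) in auto)
  moreover have "\<Union>((\<lambda>V. points M \<inter> p -` C V) ` \<V>) = points M"
  proof
    show "points M \<subseteq> \<Union>((\<lambda>V. points M \<inter> p -` C V) ` \<V>)"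
    proof
      fix x assume x: "x \<in> points M"
      then obtain V where "V \<in> \<V>" "p x \<in> V" using p_in[OF x] \<V>(3) by auto
      then show "x \<in> \<Union>((\<lambda>V. points M \<inter> p -` C V) ` \<V>)" using C(1) x by blast
    qed
  qed auto
  ultimately show ?thesis by (simp add: compact_space_def)
qed

end

section \<open>Radicals of alternating forms\<close>

definition form_radical :: "('a \<Rightarrow> 'a \<Rightarrow> real) \<Rightarrow> 'a set" where
  "form_radical b = {v. \<forall>u. b v u = 0}"

lemma subspace_form_radical: "bilinear b \<Longrightarrow> subspace (form_radical b)"
  by (auto simp: form_radical_def subspace_def bilinear_lzero bilinear_ladd bilinear_lmul)

lemma dim_le_1_dependent:
  fixes S :: "'a::euclidean_space set"
  assumes "dim S \<le> 1" "v \<in> S" "w \<in> S"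
  shows "\<exists>\<alpha> \<beta>. (\<alpha> \<noteq> 0 \<or> \<beta> \<noteq> 0) \<and> \<alpha> *\<^sub>R v + \<beta> *\<^sub>R w = 0"
proof (cases "v = 0")
  case True then show ?thesis by (intro exI[of _ 1] exI[of _ 0]) simp
next
  case False
  then have "S \<subseteq> span {v}" using assms by (intro card_ge_dim_independent) auto
  then obtain k where "w = k *\<^sub>R v" using assms by (auto simp: span_singleton)
  then show ?thesis by (intro exI[of _ k] exI[of _ "-1"]) simp
qed

lemma dim_ge_2_orthonormal:
  fixes S :: "'a::euclidean_space set"
  assumes "subspace S" "\<not> dim S \<le> 1"
  shows "\<exists>v\<in>S. \<exists>w\<in>S. norm v = 1 \<and> norm w = 1 \<and> v \<bullet> w = 0"
proof -
  obtain E where E: "E \<subseteq> S" "pairwise orthogonal E" "\<And>x. x \<in> E \<Longrightarrow> norm x = 1" "independent E" "card E = dim S" "span E = S"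
    using orthonormal_basis_subspace[OF assms(1)] by metis
  obtain v w where "v \<in> E" "w \<in> E" "v \<noteq> w"
    using assms(2) E(5) by (metis One_nat_def card_le_Suc0_iff_eq E(4) independent_imp_finite)
  then show ?thesis using E unfolding pairwise_def orthogonal_def by blast
qed

text \<open>The radical is the orthogonal complement of the row space of the Gram matrix, so this is
  the dimension formula for complements.\<close>

lemma dim_radical_rank:
  fixes b :: "real^'n \<Rightarrow> real^'n \<Rightarrow> real"
  assumes bil: "bilinear b" and alt: "\<And>v. b v v = 0"
  shows "dim (form_radical b) + rank (\<chi> i j. b (axis i 1) (axis j 1)) = CARD('n)"
proof -
  let ?A = "\<chi> i j. b (axis i 1) (axis j 1)"
  have sk: "b v w = - b w v" for v w by (rule bilinear_alternating_skew[OF bil alt])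
  have lin: "linear (b v)" for v using bil by (simp add: bilinear_def)
  have lin': "linear (\<lambda>v. b v w)" for w using bil by (simp add: bilinear_def)
  have ex: "f x = (\<Sum>j\<in>UNIV. x $ j * f (axis j 1))" if "linear f" for f :: "real^'n \<Rightarrow> real" and x
  proof -
    have "f x = f (\<Sum>j\<in>UNIV. x $ j *\<^sub>R axis j 1)" by (simp add: basis_expansion scalar_mult_eq_scaleR[symmetric])
    also have "\<dots> = (\<Sum>j\<in>UNIV. x $ j * f (axis j 1))" using that by (simp add: linear_sum linear_scale)
    finally show ?thesis .
  qed
  have r: "orthogonal (row i ?A) x \<longleftrightarrow> b (axis i 1) x = 0" for i x
    using ex[OF lin, of "axis i 1" x] by (simp add: orthogonal_def row_def inner_vec_def mult.commute)
  have "form_radical b = {x. \<forall>i. b (axis i 1) x = 0}"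
  proof (intro set_eqI iffI)
    fix x assume "x \<in> form_radical b"
    then have "b (axis i 1) x = 0" for i using sk[of "axis i 1" x] by (simp add: form_radical_def)
    then show "x \<in> {x. \<forall>i. b (axis i 1) x = 0}" by simp
  next
    fix x assume "x \<in> {x. \<forall>i. b (axis i 1) x = 0}"
    then have "b u x = 0" for u using ex[OF lin'[of x], of u] by simp
    then have "b x u = 0" for u using sk[of x u] by simp
    then show "x \<in> form_radical b" by (simp add: form_radical_def)
  qed
  also have "\<dots> = {y \<in> UNIV. \<forall>x\<in>span (rows ?A). orthogonal x y}"
  proof (intro set_eqI iffI; simp)
    fix x assume "\<forall>i. b (axis i 1) x = 0"
    then have "\<forall>w\<in>rows ?A. orthogonal w x" using r by (auto simp: rows_def)
    then have "\<And>w. w \<in> rows ?A \<Longrightarrow> orthogonal x w" by (simp add: orthogonal_commute)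
    then have "\<And>w. w \<in> span (rows ?A) \<Longrightarrow> orthogonal x w" using orthogonal_to_span by blast
    then show "\<forall>w\<in>span (rows ?A). orthogonal w x" by (simp add: orthogonal_commute)
  next
    fix x assume "\<forall>w\<in>span (rows ?A). orthogonal w x"
    then have "orthogonal (row i ?A) x" for i by (auto simp: rows_def intro: span_base)
    then show "\<forall>i. b (axis i 1) x = 0" using r by simp
  qed
  also have "dim \<dots> + dim (span (rows ?A)) = dim (UNIV :: (real^'n) set)"
    by (rule dim_subspace_orthogonal_to_vectors) auto
  finally show ?thesis by (simp add: row_rank_def dim_span)
qed

text \<open>The Gram matrix A satisfies A^T = -A, hence det A = (-1)^n det A, which forces det A = 0
  for odd n. The rank is then below n and the radical nonzero.\<close>

lemma odd_radical:
  fixes b :: "real^'n \<Rightarrow> real^'n \<Rightarrow> real"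
  assumes bil: "bilinear b" and alt: "\<And>v. b v v = 0" and odd: "odd CARD('n)"
  shows "dim (form_radical b) \<ge> 1"
proof -
  let ?A = "\<chi> i j. b (axis i 1) (axis j 1)"
  have "transpose ?A = (\<chi> i. (-1) *s (?A $ i))"
  proof (intro iffD2[OF vec_eq_iff] allI)
    fix i j
    show "transpose ?A $ i $ j = (\<chi> i. (-1) *s (?A $ i)) $ i $ j"
      using bilinear_alternating_skew[OF bil alt, of "axis j 1" "axis i 1"] by (simp add: transpose_def)
  qed
  then have "det ?A = det (\<chi> i. (-1) *s (?A $ i))" by (metis det_transpose)
  also have "\<dots> = (-1) ^ CARD('n) * det ?A" by (subst det_rows_mul) simp
  finally have "det ?A = 0" using odd by simp
  then have "rank ?A \<noteq> CARD('n)"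
    by (metis full_rank_injective invertible_det_nz invertible_left_inverse matrix_left_invertible_injective)
  then show ?thesis using dim_radical_rank[OF bil alt] by linarith
qed

text \<open>Continuity is given for fixed vectors only; a basis expansion upgrades it to points and
  vectors that converge together.\<close>

lemma tendsto_bilinear_param:
  fixes \<theta> :: "'a::t2_space \<Rightarrow> 'e::euclidean_space \<Rightarrow> 'e \<Rightarrow> real"
  assumes bil: "\<And>x. x \<in> X \<Longrightarrow> bilinear (\<theta> x)" and X: "open X" "x0 \<in> X" and cont: "\<And>v w. continuous_on X (\<lambda>x. \<theta> x v w)"
    and lim: "x \<longlonglongrightarrow> x0" "v \<longlonglongrightarrow> v0" "w \<longlonglongrightarrow> w0" and xX: "\<And>n. x n \<in> X"
  shows "(\<lambda>n. \<theta> (x n) (v n) (w n)) \<longlonglongrightarrow> \<theta> x0 v0 w0"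
proof -
  obtain E :: "'e set" where E: "onb E" using onb_exists[OF findim_euclidean] .
  have e: "(\<lambda>n. \<theta> (x n) a b) \<longlonglongrightarrow> \<theta> x0 a b" for a b
  proof -
    have "isCont (\<lambda>x. \<theta> x a b) x0" using cont[of a b] X continuous_on_eq_continuous_at by blast
    from isCont_tendsto_compose[OF this lim(1)] show ?thesis .
  qed
  have "(\<lambda>n. \<Sum>e\<in>E. \<Sum>e'\<in>E. (v n \<bullet> e) * (w n \<bullet> e') * \<theta> (x n) e e') \<longlonglongrightarrow> (\<Sum>e\<in>E. \<Sum>e'\<in>E. (v0 \<bullet> e) * (w0 \<bullet> e') * \<theta> x0 e e')"
    by (intro tendsto_intros lim e)
  then show ?thesis
    unfolding bilinear_onb[OF E E bil[OF X(2)], symmetric] bilinear_onb[OF E E bil[OF xX], symmetric] .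
qed

text \<open>A limit of orthonormal pairs in the radicals of \<open>\<theta> + K \<sigma>\<close> as \<open>K \<rightarrow> \<infinity>\<close> spans a plane in the
  form_radical of \<open>\<sigma>\<close> that is \<open>\<theta>\<close>-orthogonal to the vertical space; it would meet the vertical space, on
  which \<open>\<theta>\<close> is nondegenerate.\<close>

lemma pencil_radical:
  fixes \<theta> \<sigma> :: "'a::metric_space \<Rightarrow> 'e::euclidean_space \<Rightarrow> 'e \<Rightarrow> real" and Z :: "'v \<Rightarrow> 'a \<Rightarrow> 'e"
  assumes X: "open X" "x0 \<in> X"
    and bil: "\<And>x. x \<in> X \<Longrightarrow> bilinear (\<theta> x)" "\<And>x. x \<in> X \<Longrightarrow> bilinear (\<sigma> x)"
    and cont: "\<And>v w. continuous_on X (\<lambda>x. \<theta> x v w)" "\<And>v w. continuous_on X (\<lambda>x. \<sigma> x v w)" "\<And>y. continuous_on X (Z y)"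
    and vert: "\<And>x v y. x \<in> X \<Longrightarrow> \<sigma> x v (Z y x) = 0"
    and nondeg: "\<And>y. (\<And>y'. \<theta> x0 (Z y x0) (Z y' x0) = 0) \<Longrightarrow> Z y x0 = 0"
    and rad: "\<And>v w. v \<in> form_radical (\<sigma> x0) \<Longrightarrow> w \<in> form_radical (\<sigma> x0) \<Longrightarrow>
       \<exists>\<alpha> \<beta> y. (\<alpha> \<noteq> 0 \<or> \<beta> \<noteq> 0) \<and> \<alpha> *\<^sub>R v + \<beta> *\<^sub>R w = Z y x0"
  shows "\<exists>r>0. \<exists>K0. \<forall>x\<in>X. \<forall>K\<ge>K0. dist x x0 < r \<longrightarrow> dim (form_radical (\<lambda>v u. \<theta> x v u + K * \<sigma> x v u)) \<le> 1"
proof (rule ccontr)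
  assume "\<not> ?thesis"
  then have neg: "\<forall>r>0. \<forall>K0. \<exists>x\<in>X. \<exists>K\<ge>K0. dist x x0 < r \<and> \<not> dim (form_radical (\<lambda>v u. \<theta> x v u + K * \<sigma> x v u)) \<le> 1" by blast
  have "\<exists>x K. x \<in> X \<and> K \<ge> real (Suc n) \<and> dist x x0 < inverse (real (Suc n)) \<and> \<not> dim (form_radical (\<lambda>v u. \<theta> x v u + K * \<sigma> x v u)) \<le> 1" for n
    using neg[rule_format, of "inverse (real (Suc n))" "real (Suc n)"] by (simp del: of_nat_Suc) blast
  then have "\<forall>n. \<exists>q. fst q \<in> X \<and> snd q \<ge> real (Suc n) \<and> dist (fst q) x0 < inverse (real (Suc n)) \<and>
      \<not> dim (form_radical (\<lambda>v u. \<theta> (fst q) v u + snd q * \<sigma> (fst q) v u)) \<le> 1" by simp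
  from choice[OF this] obtain q where q: "\<And>n. fst (q n) \<in> X \<and> snd (q n) \<ge> real (Suc n) \<and> dist (fst (q n)) x0 < inverse (real (Suc n)) \<and>
      \<not> dim (form_radical (\<lambda>v u. \<theta> (fst (q n)) v u + snd (q n) * \<sigma> (fst (q n)) v u)) \<le> 1" by blast
  define x K where "x = fst \<circ> q" and "K = snd \<circ> q"
  have xK: "\<And>n. x n \<in> X" "\<And>n. K n \<ge> real (Suc n)" "\<And>n. dist (x n) x0 < inverse (real (Suc n))"
    "\<And>n. \<not> dim (form_radical (\<lambda>v u. \<theta> (x n) v u + K n * \<sigma> (x n) v u)) \<le> 1" using q by (simp_all add: x_def K_def)
  have bilK: "bilinear (\<lambda>v u. \<theta> (x n) v u + K n * \<sigma> (x n) v u)" for n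
    using bil[OF xK(1)[of n]] by (auto simp: bilinear_def linear_iff algebra_simps)
  have "\<exists>q. fst q \<in> form_radical (\<lambda>v u. \<theta> (x n) v u + K n * \<sigma> (x n) v u) \<and> snd q \<in> form_radical (\<lambda>v u. \<theta> (x n) v u + K n * \<sigma> (x n) v u)
     \<and> norm (fst q) = 1 \<and> norm (snd q) = 1 \<and> fst q \<bullet> snd q = 0" for n
  proof -
    obtain v w where "v \<in> form_radical (\<lambda>v u. \<theta> (x n) v u + K n * \<sigma> (x n) v u)" "w \<in> form_radical (\<lambda>v u. \<theta> (x n) v u + K n * \<sigma> (x n) v u)"
      "norm v = 1" "norm w = 1" "v \<bullet> w = 0"
      using dim_ge_2_orthonormal[OF subspace_form_radical[OF bilK] xK(4)] by blast
    then show ?thesis by (intro exI[of _ "(v, w)"]) simp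
  qed
  then have "\<forall>n. \<exists>q. fst q \<in> form_radical (\<lambda>v u. \<theta> (x n) v u + K n * \<sigma> (x n) v u) \<and> snd q \<in> form_radical (\<lambda>v u. \<theta> (x n) v u + K n * \<sigma> (x n) v u)
     \<and> norm (fst q) = 1 \<and> norm (snd q) = 1 \<and> fst q \<bullet> snd q = 0" ..
  from choice[OF this] obtain q' where q': "\<And>n. fst (q' n) \<in> form_radical (\<lambda>v u. \<theta> (x n) v u + K n * \<sigma> (x n) v u) \<and>
     snd (q' n) \<in> form_radical (\<lambda>v u. \<theta> (x n) v u + K n * \<sigma> (x n) v u)
     \<and> norm (fst (q' n)) = 1 \<and> norm (snd (q' n)) = 1 \<and> fst (q' n) \<bullet> snd (q' n) = 0" by blast
  define v w where "v = fst \<circ> q'" and "w = snd \<circ> q'"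
  have vw: "\<And>n u. \<theta> (x n) (v n) u + K n * \<sigma> (x n) (v n) u = 0" "\<And>n u. \<theta> (x n) (w n) u + K n * \<sigma> (x n) (w n) u = 0"
    "\<And>n. norm (v n) = 1" "\<And>n. norm (w n) = 1" "\<And>n. v n \<bullet> w n = 0"
    using q' by (simp_all add: v_def w_def form_radical_def)
  \<comment> \<open>One subsequence serves both unit vectors. Their orthonormality survives the
    limit and gives the contradiction at the end.\<close>
  have "compact (sphere (0::'e) 1 \<times> sphere (0::'e) 1)" by (intro compact_Times compact_sphere)
  moreover have "\<forall>n. (v n, w n) \<in> sphere 0 1 \<times> sphere 0 1" using vw(3,4) by simp
  ultimately obtain l s where ls: "l \<in> sphere (0::'e) 1 \<times> sphere (0::'e) 1" "strict_mono s" "((\<lambda>n. (v n, w n)) \<circ> s) \<longlonglongrightarrow> l"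
    unfolding compact_def by meson
  obtain v0 w0 where l: "l = (v0, w0)" by (cases l)
  have lim: "(\<lambda>n. v (s n)) \<longlonglongrightarrow> v0" "(\<lambda>n. w (s n)) \<longlonglongrightarrow> w0"
    using tendsto_fst[OF ls(3)] tendsto_snd[OF ls(3)] by (simp_all add: l o_def)
  have "x \<longlonglongrightarrow> x0"
  proof (rule metric_tendsto_imp_tendsto[OF LIMSEQ_inverse_real_of_nat])
    show "\<forall>\<^sub>F n in sequentially. dist (x n) x0 \<le> dist (inverse (real (Suc n))) 0"
      using xK(3) by (intro always_eventually allI) (simp add: less_imp_le dist_real_def)
  qed
  then have limx: "(\<lambda>n. x (s n)) \<longlonglongrightarrow> x0" using LIMSEQ_subseq_LIMSEQ[OF _ ls(2)] by (simp add: o_def)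
  have "filterlim K at_top sequentially"
  proof (rule filterlim_at_top_mono[OF filterlim_real_sequentially always_eventually], rule allI)
    show "real n \<le> K n" for n using xK(2)[of n] by simp
  qed
  then have "filterlim (\<lambda>n. K (s n)) at_top sequentially" by (rule filterlim_compose[OF _ filterlim_subseq[OF ls(2)]])
  then have limK: "(\<lambda>n. inverse (K (s n))) \<longlonglongrightarrow> 0" by (rule filterlim_compose[OF tendsto_inverse_0_at_top[OF filterlim_ident]])
  \<comment> \<open>A radical vector z of \<theta> + K \<sigma> satisfies \<sigma>(z, u) = -
    \<theta>(z, u) / K, which tends to 0. On vertical u the form \<sigma> vanishes, so there
    \<theta>(z, u) = 0 already before the limit.\<close>
  have main: "z0 \<in> form_radical (\<sigma> x0) \<and> (\<forall>y. \<theta> x0 z0 (Z y x0) = 0)"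
    if z: "\<And>n u. \<theta> (x n) (z n) u + K n * \<sigma> (x n) (z n) u = 0" and limz: "(\<lambda>n. z (s n)) \<longlonglongrightarrow> z0" for z z0
  proof
    have "\<sigma> x0 z0 u = 0" for u
    proof -
      have eq: "\<sigma> (x (s n)) (z (s n)) u = - (inverse (K (s n)) * \<theta> (x (s n)) (z (s n)) u)" for n
      proof -
        have "K (s n) > 0" using xK(2)[of "s n"] by linarith
        then show ?thesis using z[of "s n" u] by (simp add: field_simps)
      qed
      have "(\<lambda>n. \<sigma> (x (s n)) (z (s n)) u) \<longlonglongrightarrow> - (0 * \<theta> x0 z0 u)"
        unfolding eq by (intro tendsto_intros limK tendsto_bilinear_param[OF bil(1) X cont(1) limx limz _ xK(1)])
      moreover have "(\<lambda>n. \<sigma> (x (s n)) (z (s n)) u) \<longlonglongrightarrow> \<sigma> x0 z0 u"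
        by (intro tendsto_bilinear_param[OF bil(2) X cont(2) limx limz _ xK(1)] tendsto_const)
      ultimately show ?thesis using LIMSEQ_unique by fastforce
    qed
    then show "z0 \<in> form_radical (\<sigma> x0)" by (simp add: form_radical_def)
    show "\<forall>y. \<theta> x0 z0 (Z y x0) = 0"
    proof
      fix y
      have "(\<lambda>n. Z y (x (s n))) \<longlonglongrightarrow> Z y x0"
      proof -
        have "isCont (Z y) x0" using cont(3)[of y] X continuous_on_eq_continuous_at by blast
        from isCont_tendsto_compose[OF this limx] show ?thesis .
      qed
      from tendsto_bilinear_param[OF bil(1) X cont(1) limx limz this xK(1)]
      have "(\<lambda>n. \<theta> (x (s n)) (z (s n)) (Z y (x (s n)))) \<longlonglongrightarrow> \<theta> x0 z0 (Z y x0)" .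
      moreover have "\<theta> (x (s n)) (z (s n)) (Z y (x (s n))) = 0" for n
        using z[of "s n" "Z y (x (s n))"] vert[OF xK(1)] by simp
      ultimately show "\<theta> x0 z0 (Z y x0) = 0" using LIMSEQ_unique[OF _ tendsto_const] by fastforce
    qed
  qed
  note mv = main[OF vw(1) lim(1)] and mw = main[OF vw(2) lim(2)]
  obtain \<alpha> \<beta> y where y: "\<alpha> \<noteq> 0 \<or> \<beta> \<noteq> 0" "\<alpha> *\<^sub>R v0 + \<beta> *\<^sub>R w0 = Z y x0" using rad[OF conjunct1[OF mv] conjunct1[OF mw]] by blast
  have "\<theta> x0 (Z y x0) (Z y' x0) = 0" for y'
    using mv mw bil(1)[OF X(2)] unfolding y(2)[symmetric] by (simp add: bilinear_ladd bilinear_lmul)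
  then have "\<alpha> *\<^sub>R v0 + \<beta> *\<^sub>R w0 = 0" unfolding y(2) by (rule nondeg)
  then have z: "(\<alpha> *\<^sub>R v0 + \<beta> *\<^sub>R w0) \<bullet> v0 = 0" "(\<alpha> *\<^sub>R v0 + \<beta> *\<^sub>R w0) \<bullet> w0 = 0" by simp_all
  have "v0 \<bullet> w0 = 0" using tendsto_inner[OF lim] by (simp add: vw(5) LIMSEQ_const_iff)
  moreover from this have "w0 \<bullet> v0 = 0" by (simp add: inner_commute)
  moreover have "v0 \<bullet> v0 = 1" "w0 \<bullet> w0 = 1" using ls(1) l by (auto simp: dot_square_norm)
  ultimately have "\<alpha> = 0" "\<beta> = 0" using z by (simp_all add: inner_add_left)
  then show False using y(1) by simp
qed

section \<open>Thurston's construction\<close>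

lemma transition_inverse:
  fixes M :: "('a, 'e::real_inner) manifold"
  assumes w: "wk_atlas (atlas M)" and c: "c \<in> atlas M" "d \<in> atlas M" and x: "x \<in> snd c ` (fst c \<inter> fst d)"
  shows "fd (coord_expr d id c) (coord_expr c id d x) (fd (coord_expr c id d) x v) = v"
    "coord_expr c id d x \<in> snd d ` (fst d \<inter> fst c)" "coord_expr d id c (coord_expr c id d x) = x"
proof -
  note o = overlap_transition[OF w c] and o' = overlap_transition[OF w c(2,1)]
  have m: "coord_expr c id d x \<in> snd d ` (fst d \<inter> fst c)" if "x \<in> snd c ` (fst c \<inter> fst d)" for x
    using that wk_atlas_inv[OF w c(1)] by (auto simp: coord_expr_def)
  then show m': "coord_expr c id d x \<in> snd d ` (fst d \<inter> fst c)" using x .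
  have e: "coord_expr d id c (coord_expr c id d x) = x" if "x \<in> snd c ` (fst c \<inter> fst d)" for x
    using that wk_atlas_inv[OF w c(1)] wk_atlas_inv[OF w c(2)] by (auto simp: coord_expr_def)
  then show "coord_expr d id c (coord_expr c id d x) = x" using x .
  have "((\<lambda>x. coord_expr d id c (coord_expr c id d x)) has_derivative
     (\<lambda>v. fd (coord_expr d id c) (coord_expr c id d x) (fd (coord_expr c id d) x v))) (at x)"
    by (rule has_derivative_compose[OF smooth_on_has_derivative[OF o(2) x] smooth_on_has_derivative[OF o'(2) m']])
  from frechet_derivativeI[OF this]
  have "(\<lambda>v. fd (coord_expr d id c) (coord_expr c id d x) (fd (coord_expr c id d) x v)) = fd (\<lambda>x. coord_expr d id c (coord_expr c id d x)) x" by simp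
  also have "\<dots> = fd (\<lambda>x. x) x" by (rule frechet_derivative_cong_open[OF o(1) x e])
  finally show "fd (coord_expr d id c) (coord_expr c id d x) (fd (coord_expr c id d) x v) = v"
    by (simp add: fun_eq_iff)
qed

lemma chart_preimage_open:
  assumes "smooth_atlas X A" "c \<in> A" "open U"
  shows "openin X {x \<in> fst c. snd c x \<in> U}"
proof -
  have c: "homeomorphic_map (subtopology X (fst c)) (top_of_set (chart_image c)) (snd c)"
    using assms unfolding smooth_atlas_def by auto
  have sub: "fst c \<subseteq> topspace X" by (rule smooth_atlas_domain(2)[OF assms(1,2)])
  have "openin (top_of_set (chart_image c)) (chart_image c \<inter> U)" using assms(3) by blast
  from openin_continuous_map_preimage[OF homeomorphic_imp_continuous_map[OF c] this]
  have "openin (subtopology X (fst c)) {x \<in> fst c. snd c x \<in> U}"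
  proof (rule back_subst[where P = "openin (subtopology X (fst c))"])
    show "{x \<in> topspace (subtopology X (fst c)). snd c x \<in> chart_image c \<inter> U} = {x \<in> fst c. snd c x \<in> U}"
      using sub by auto
  qed
  then show ?thesis using smooth_atlas_domain(1)[OF assms(1,2)] openin_trans_full by blast
qed

text \<open>The derivative of a transition map is injective and carries one radical into the other.
  The inequality is enough to transport an upper bound from one chart around a point to all
  others.\<close>

lemma radical_chart_independent:
  fixes M :: "('a, 'e::euclidean_space) manifold"
  assumes w: "wk_atlas (atlas M)" and \<omega>: "two_form M \<omega>" and c: "c \<in> atlas M" "d \<in> atlas M" and z: "z \<in> fst c" "z \<in> fst d"
  shows "dim (form_radical (\<omega> c (snd c z))) \<le> dim (form_radical (\<omega> d (snd d z)))"
proof -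
  let ?x = "snd c z" and ?g = "coord_expr c id d"
  let ?D = "fd ?g ?x"
  have x: "?x \<in> snd c ` (fst c \<inter> fst d)" using z by auto
  have gx: "?g ?x = snd d z" using wk_atlas_inv[OF w c(1) z(1)] by (simp add: coord_expr_def)
  note ti = transition_inverse[OF w c x]
  have x': "snd d z \<in> snd d ` (fst d \<inter> fst c)" using z by auto
  have gx': "coord_expr d id c (snd d z) = ?x" using wk_atlas_inv[OF w c(2) z(2)] by (simp add: coord_expr_def)
  have surj: "?D (fd (coord_expr d id c) (snd d z) u) = u" for u
    using transition_inverse(1)[OF w c(2,1) x', of u] unfolding gx' .
  have lin: "linear ?D" by (rule has_derivative_linear[OF smooth_on_has_derivative[OF overlap_transition(2)[OF w c] x]])
  have inj: "inj ?D" using ti(1) by (metis injI)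
  have "?D v \<in> form_radical (\<omega> d (snd d z))" if "v \<in> form_radical (\<omega> c ?x)" for v
  proof -
    have "\<omega> d (snd d z) (?D v) u = 0" for u
      using two_formD(4)[OF \<omega> c z, of v "fd (coord_expr d id c) (snd d z) u"] that
      unfolding surj gx by (simp add: form_radical_def)
    then show ?thesis by (simp add: form_radical_def)
  qed
  then have "?D ` form_radical (\<omega> c ?x) \<subseteq> form_radical (\<omega> d (snd d z))" by auto
  then have "dim (?D ` form_radical (\<omega> c ?x)) \<le> dim (form_radical (\<omega> d (snd d z)))" by (rule dim_subset)
  moreover have "dim (?D ` form_radical (\<omega> c ?x)) = dim (form_radical (\<omega> c ?x))"
    by (rule dim_image_eq[OF lin]) (rule inj_on_subset[OF inj subset_UNIV])
  ultimately show ?thesis by simp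
qed

locale thurston = compact_symp_fib M B F \<omega>\<^sub>0 p T
  for M :: "('m, 'e::euclidean_space) manifold" and B :: "('b, 'h::euclidean_space) manifold"
    and F :: "('f, 'v::real_inner) manifold" and \<omega>\<^sub>0 p T +
  fixes \<omega>B :: "('b, 'h) form2"
  assumes \<omega>B: "closed_two_form B \<omega>B"
    and radB: "\<And>c x. c \<in> atlas B \<Longrightarrow> x \<in> chart_image c \<Longrightarrow> dim (form_radical (\<omega>B c x)) \<le> 1"
begin

definition "\<sigma> = pullback2 M B p \<omega>B"

lemma \<sigma>_closed: "closed_two_form M \<sigma>"
  unfolding \<sigma>_def by (rule pullback_forms(3)[OF wkM wkB findims(1,2) chart_smooth_p \<omega>B])

text \<open>\<open>p\<close> composed with the parametrization of a fibre is constant, so its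
  derivative annihilates every vector.\<close>

lemma \<sigma>_vertical:
  assumes t: "t \<in> T" "b \<in> fst t" and d: "d \<in> atlas F" and y: "y \<in> chart_image d"
  shows "pb2 M (\<lambda>y. glue t b (chart_inv d y)) \<sigma> y v w = 0"
proof -
  let ?\<phi> = "\<lambda>y. glue t b (chart_inv d y)"
  note sp = fibre_param[OF t d]
  obtain c where c: "c \<in> atlas M" "?\<phi> y \<in> fst c" using smooth_param_ex[OF sp y] by blast
  note r = chart_rep[OF wkM sp c(1)]
  let ?Y = "chart_image d \<inter> ?\<phi> -` fst c" and ?g = "\<lambda>y. snd c (?\<phi> y)"
  have yY: "y \<in> ?Y" using y c by auto
  have spB: "smooth_param B (chart_image c) (\<lambda>x. p (chart_inv c x))" using chart_smooth_p c by (simp add: chart_smooth_def)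
  have e: "p (chart_inv c (?g y)) = b" if "y \<in> ?Y" for y
    using glue_in(3)[OF t chart_F_in[OF d, of y]] wk_atlas_inv[OF wkM c(1), of "?\<phi> y"] that by auto
  obtain cB where cB: "cB \<in> atlas B" "b \<in> fst cB" using smooth_atlas_cover[OF atlases(2)] fst_T(2)[OF t(1)] t(2) by blast
  have "pb2 M ?\<phi> \<sigma> y v w = \<sigma> c (?g y) (fd ?g y v) (fd ?g y w)"
    by (rule pb2_chart[OF wkM sp closed_two_formD(1)[OF \<sigma>_closed] c(1) y c(2)])
  also have "\<dots> = pb2 B (\<lambda>y. p (chart_inv c (?g y))) \<omega>B y v w"
    unfolding \<sigma>_def pullback2_pb2 by (rule pb_compose(2)[OF spB r(2,3) yY, symmetric])
  also have "\<dots> = pb2 B (\<lambda>y. b) \<omega>B y v w"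
    by (rule fun_cong[OF fun_cong[OF pb_cong(2)[OF r(1) yY e]]])
  also have "\<dots> = \<omega>B cB (snd cB b) (fd (\<lambda>y::'v. snd cB b) y v) (fd (\<lambda>y. snd cB b) y w)"
  proof (rule pb2_chart[OF wkB _ closed_two_formD(1)[OF \<omega>B] cB(1) yY cB(2)])
    have "smooth_param B ?Y (\<lambda>y. p (chart_inv c (?g y)))" by (rule smooth_param_compose[OF spB findims(1) r(1,2,3)])
    then show "smooth_param B ?Y (\<lambda>y. b)" by (rule smooth_param_cong) (rule e)
  qed
  also have "\<dots> = 0" using bilinear_lzero[OF two_formD(1)[OF closed_two_formD(1)[OF \<omega>B] cB(1)]] cB(2) by simp
  finally show ?thesis .
qed

text \<open>Prepares \<open>pencil_radical\<close> in one chart c of M. The estimate takes place in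
  the model space of M, where unit spheres are compact; product coordinates serve to describe the
  vertical vectors and the projection to the base.\<close>

lemma local_rank:
  assumes \<tau>: "closed_two_form M \<tau>" and fw: "\<And>b. b \<in> points B \<Longrightarrow> fibrewise \<tau> b" and z: "z \<in> points M"
  shows "\<exists>N K0. openin (mtop M) N \<and> z \<in> N \<and> (\<forall>K\<ge>K0. \<forall>c\<in>atlas M. \<forall>x\<in>chart_image c. chart_inv c x \<in> N \<longrightarrow>
    dim (form_radical (add_form2 \<tau> (scale_form2 K \<sigma>) c x)) \<le> 1)"
proof -
  let ?b = "p z"
  have bB: "?b \<in> points B" by (rule p_in[OF z])
  obtain t where t: "t \<in> T" "?b \<in> fst t" using cover bB by blast
  have zt: "z \<in> tube t" using z t by auto
  obtain cB where cB: "cB \<in> atlas B" "?b \<in> fst cB" using smooth_atlas_cover[OF atlases(2) bB] by blast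
  obtain d where d: "d \<in> atlas F" "snd (snd t z) \<in> fst d" using smooth_atlas_cover[OF atlases(3) triv_in[OF t(1) zt]] by blast
  obtain c where c: "c \<in> atlas M" "z \<in> fst c" using smooth_atlas_cover[OF atlases(1) z] by blast
  define W where "W = {x \<in> tube t. p x \<in> fst cB \<and> snd (snd t x) \<in> fst d}"
  define X where "X = snd c ` (fst c \<inter> W)"
  define P where "P = (\<lambda>x. snd cB (p (chart_inv c x)))"
  define \<Phi> where "\<Phi> = (\<lambda>x. (P x, snd d (snd (snd t (chart_inv c x)))))"
  note tc = triv_chart[OF t(1) c(1) cB(1) d(1), folded W_def, folded P_def, folded X_def, folded P_def \<Phi>_def]
  have \<Phi>s: "smooth_on X \<Phi>" using tc(3) by (simp add: \<Phi>_def P_def)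
  have Xop: "open X" by (rule tc(2))
  define x0 where "x0 = snd c z"
  have zW: "z \<in> W" using zt cB d by (simp add: W_def)
  have x0: "x0 \<in> X" "chart_inv c x0 = z" using c zW wk_atlas_inv[OF wkM c] by (auto simp: X_def x0_def)
  define G where "G = glue_chart t cB d"
  define Q where "Q = (snd cB ` (fst cB \<inter> fst t)) \<times> chart_image d"
  have sp: "smooth_param M Q G" unfolding Q_def G_def by (rule glue_chart_param[OF t(1) cB(1) d(1)])
  note r = chart_rep[OF wkM sp c(1)]
  define Y where "Y = Q \<inter> G -` fst c"
  define f where "f = (\<lambda>q. snd c (G q))"
  have Yop: "open Y" and fs: "smooth_on Y f" using r by (auto simp: Y_def f_def)
  have fhv: "findim TYPE('h \<times> 'v)" by (rule findim_prod[OF findims(2,3)])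
  have Xw: "\<exists>w. w \<in> fst c \<and> w \<in> W \<and> x = snd c w \<and> chart_inv c x = w" if "x \<in> X" for x
    using that wk_atlas_inv[OF wkM c(1)] by (auto simp: X_def)
  have \<Phi>Y: "\<Phi> x \<in> Y" and f\<Phi>: "f (\<Phi> x) = x" and PB: "p (chart_inv c x) \<in> fst cB" if x: "x \<in> X" for x
  proof -
    obtain w where w: "w \<in> fst c" "w \<in> W" "x = snd c w" "chart_inv c x = w" using Xw[OF x] by blast
    then show "p (chart_inv c x) \<in> fst cB" by (simp add: W_def)
    have wt: "w \<in> tube t" "p w \<in> fst cB" "p w \<in> fst t" "snd (snd t w) \<in> fst d" using w by (auto simp: W_def)
    have G: "G (\<Phi> x) = w" unfolding G_def glue_chart_def \<Phi>_def P_def w(4) fst_conv snd_conv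
      wk_atlas_inv[OF wkB cB(1) wt(2)] wk_atlas_inv[OF wkF d(1) wt(4)] by (rule glue_triv[OF t(1) wt(1)])
    then show "f (\<Phi> x) = x" using w by (simp add: f_def)
    show "\<Phi> x \<in> Y" using G w wt by (auto simp: Y_def Q_def \<Phi>_def P_def)
  qed
  have pG: "snd cB (p (G q)) = fst q" if "q \<in> Q" for q
  proof -
    have 1: "chart_inv cB (fst q) \<in> fst cB \<inter> fst t" "snd cB (chart_inv cB (fst q)) = fst q" "chart_inv d (snd q) \<in> points F"
      using base_chart_inv[OF cB(1), of "fst q" "fst t"] chart_F_in[OF d(1), of "snd q"] that by (auto simp: Q_def)
    then show ?thesis using glue_in(3)[OF t(1), of "chart_inv cB (fst q)" "chart_inv d (snd q)"] by (simp add: G_def glue_chart_def)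
  qed
  have Pf: "P (f q) = fst q" if "q \<in> Y" for q
    using that pG wk_atlas_inv[OF wkM c(1), of "G q"] by (simp add: P_def f_def Y_def)
  have Ps: "smooth_on X P"
    using smooth_on_linear_compose[OF Xop bounded_linear_fst \<Phi>s] by (simp add: \<Phi>_def)
  have DP: "(P has_derivative fd P x) (at x)" if "x \<in> X" for x by (rule smooth_on_has_derivative[OF Ps that])
  have D\<Phi>: "(\<Phi> has_derivative fd \<Phi> x) (at x)" if "x \<in> X" for x by (rule smooth_on_has_derivative[OF \<Phi>s that])
  have Df: "(f has_derivative fd f q) (at q)" if "q \<in> Y" for q by (rule smooth_on_has_derivative[OF fs that])
  have linf: "linear (fd f q)" if "q \<in> Y" for q by (rule has_derivative_linear[OF Df[OF that]])
  have linP: "linear (fd P x)" if "x \<in> X" for x by (rule has_derivative_linear[OF DP[OF that]])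
  \<comment> \<open>f inverts \<Phi> and P reads off the base coordinate, so the composite of P
    after f is the first projection.\<close>
  have DPf: "fd P x (fd f (\<Phi> x) q) = fst q" if x: "x \<in> X" for x q
  proof -
    have "(P has_derivative fd P x) (at (f (\<Phi> x)))" using DP[OF x] f\<Phi>[OF x] by simp
    from frechet_derivativeI[OF has_derivative_compose[OF Df[OF \<Phi>Y[OF x]] this]]
    have "(\<lambda>q. fd P x (fd f (\<Phi> x) q)) = fd (\<lambda>q. P (f q)) (\<Phi> x)" by simp
    also have "\<dots> = fd fst (\<Phi> x)" by (rule frechet_derivative_cong_open[OF Yop \<Phi>Y[OF x] Pf])
    also have "\<dots> = fst" by (rule frechet_derivativeI[OF bounded_linear_imp_has_derivative[OF bounded_linear_fst]])
    finally show ?thesis by (rule fun_cong)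
  qed
  have Df\<Phi>: "fd f (\<Phi> x) (fd \<Phi> x v) = v" if x: "x \<in> X" for x v
  proof -
    from frechet_derivativeI[OF has_derivative_compose[OF D\<Phi>[OF x] Df[OF \<Phi>Y[OF x]]]]
    have "(\<lambda>v. fd f (\<Phi> x) (fd \<Phi> x v)) = fd (\<lambda>x. f (\<Phi> x)) x" by simp
    also have "\<dots> = fd (\<lambda>x. x) x" by (rule frechet_derivative_cong_open[OF Xop x f\<Phi>])
    finally show ?thesis by (simp add: fun_eq_iff)
  qed
  have DP\<Phi>: "fst (fd \<Phi> x v) = fd P x v" if x: "x \<in> X" for x v
    using DPf[OF x, of "fd \<Phi> x v"] Df\<Phi>[OF x, of v] by simp
  \<comment> \<open>Parametrizes the vertical space, the kernel of the derivative of P, continuously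
    in x.\<close>
  define Z where "Z = (\<lambda>(y::'v) x. fd f (\<Phi> x) (0, y))"
  note \<tau>2 = closed_two_formD(1)[OF \<tau>] and \<sigma>2 = closed_two_formD(1)[OF \<sigma>_closed] and B2 = closed_two_formD(1)[OF \<omega>B]
  have Xim: "X \<subseteq> chart_image c" by (auto simp: X_def)
  have spB: "smooth_param B (chart_image c) (\<lambda>x. p (chart_inv c x))" using chart_smooth_p c by (simp add: chart_smooth_def)
  have \<sigma>e: "\<sigma> c x v u = \<omega>B cB (P x) (fd P x v) (fd P x u)" if x: "x \<in> X" for x v u
    unfolding \<sigma>_def pullback2_pb2 P_def
    by (rule pb2_chart[OF wkB spB B2 cB(1) subsetD[OF Xim x] PB[OF x]])
  have Pim: "P x \<in> chart_image cB" if "x \<in> X" for x using PB[OF that] by (auto simp: P_def)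
  define y0 where "y0 = snd (\<Phi> x0)"
  have \<Phi>0: "\<Phi> x0 = (snd cB ?b, y0)" by (simp add: y0_def \<Phi>_def P_def x0)
  have y0: "y0 \<in> chart_image d" "chart_inv d y0 = snd (snd t z)" using d wk_atlas_inv[OF wkF d] by (auto simp: y0_def \<Phi>_def x0)
  have vertical: "\<tau> c x0 (Z v x0) (Z w x0) = \<omega>\<^sub>0 d y0 v w" for v w
  proof -
    let ?\<phi> = "\<lambda>y. glue t ?b (chart_inv d y)"
    have \<phi>0: "?\<phi> y0 = z" unfolding y0(2) by (rule glue_triv[OF t(1) zt])
    have \<phi>c: "?\<phi> y0 \<in> fst c" unfolding \<phi>0 by (rule c(2))
    have "(\<lambda>y. snd c (?\<phi> y)) = (\<lambda>y. f (snd cB ?b, y))"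
      by (simp add: f_def G_def glue_chart_def wk_atlas_inv[OF wkB cB])
    moreover have "((\<lambda>y. f (snd cB ?b, y)) has_derivative (\<lambda>v. fd f (\<Phi> x0) (0, v))) (at y0)"
    proof -
      have "((\<lambda>y. (snd cB ?b, y)) has_derivative (\<lambda>v. (0, v))) (at y0)" by (auto intro!: derivative_eq_intros)
      from has_derivative_compose[OF this] show ?thesis using Df[OF \<Phi>Y[OF x0(1)]] \<Phi>0 by simp
    qed
    ultimately have D: "fd (\<lambda>y. snd c (?\<phi> y)) y0 = (\<lambda>v. Z v x0)" by (simp add: Z_def frechet_derivativeI)
    have "pb2 M ?\<phi> \<tau> y0 v w = \<tau> c x0 (Z v x0) (Z w x0)"
      using pb2_chart[OF wkM fibre_param[OF t d(1)] \<tau>2 c(1) y0(1) \<phi>c, of v w] unfolding D \<phi>0 x0_def .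
    moreover have "pb2 M ?\<phi> \<tau> y0 v w = \<omega>\<^sub>0 d y0 v w"
    proof -
      have im: "y0 \<in> chart_image (fibre_chart M p ?b t d)" unfolding fibre_chart_facts(4)[OF t d(1)] by (rule y0(1))
      have "pullback2 (fibre M F p T ?b) M (\<lambda>x. x) \<tau> (fibre_chart M p ?b t d) y0 v w = fibre_form M F \<omega>\<^sub>0 p T ?b (fibre_chart M p ?b t d) y0 v w"
        using fw[OF bB] atlas_fibreI[OF t d(1)] im unfolding fibrewise_def eq_form2_def by blast
      then show ?thesis unfolding pullback2_fibre[OF t d(1) y0(1)] fibre_form_chart[OF t d(1) y0(1)] .
    qed
    ultimately show ?thesis by simp
  qed
  have "\<exists>r>0. \<exists>K0. \<forall>x\<in>X. \<forall>K\<ge>K0. dist x x0 < r \<longrightarrow> dim (form_radical (\<lambda>v u. \<tau> c x v u + K * \<sigma> c x v u)) \<le> 1"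
  proof (rule pencil_radical[OF Xop x0(1), where Z = Z])
    show "bilinear (\<tau> c x)" "bilinear (\<sigma> c x)" if "x \<in> X" for x
      using two_formD(1)[OF \<tau>2 c(1)] two_formD(1)[OF \<sigma>2 c(1)] Xim that by blast+
    show "continuous_on X (\<lambda>x. \<tau> c x v w)" "continuous_on X (\<lambda>x. \<sigma> c x v w)" for v w
      by (rule continuous_on_subset[OF smooth_on_continuous[OF two_formD(3)[OF \<tau>2 c(1)]] Xim],
          rule continuous_on_subset[OF smooth_on_continuous[OF two_formD(3)[OF \<sigma>2 c(1)]] Xim])
    show "continuous_on X (Z y)" for y unfolding Z_def
      by (rule smooth_on_continuous, rule smooth_on_compose[OF fhv Xop Yop \<Phi>s smooth_on_frechet_derivative[OF fs]]) (use \<Phi>Y in auto)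
    show "\<sigma> c x v (Z y x) = 0" if x: "x \<in> X" for x v y
      unfolding \<sigma>e[OF x] Z_def DPf[OF x] using bilinear_rzero[OF two_formD(1)[OF B2 cB(1) Pim[OF x]]] by simp
    show "Z y x0 = 0" if 0: "\<And>y'. \<tau> c x0 (Z y x0) (Z y' x0) = 0" for y
    proof -
      \<comment> \<open>Nondegeneracy of \<open>\<omega>\<^sub>0\<close> enters here: by
        \<open>vertical\<close>, \<tau> on vertical vectors is
        \<open>\<omega>\<^sub>0\<close>.\<close>
      have "y = 0" using 0 y0(1) d(1) symp unfolding vertical symplectic_form_def by blast
      then show ?thesis using linear_0[OF linf[OF \<Phi>Y[OF x0(1)]]] by (simp add: Z_def zero_prod_def[symmetric])
    qed
    show "\<exists>\<alpha> \<beta> y. (\<alpha> \<noteq> 0 \<or> \<beta> \<noteq> 0) \<and> \<alpha> *\<^sub>R v + \<beta> *\<^sub>R w = Z y x0"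
      if vw: "v \<in> form_radical (\<sigma> c x0)" "w \<in> form_radical (\<sigma> c x0)" for v w
    proof -
      \<comment> \<open>The derivative of P is onto, so radical vectors of \<sigma> project to
        radical vectors of the base form. That radical is at most a line, hence some nontrivial
        combination of any two projects to 0 and is vertical.\<close>
      have rd: "fd P x0 v \<in> form_radical (\<omega>B cB (P x0))" if "v \<in> form_radical (\<sigma> c x0)" for v
      proof -
        have "\<omega>B cB (P x0) (fd P x0 v) \<xi> = 0" for \<xi>
          using that \<sigma>e[OF x0(1), of v "fd f (\<Phi> x0) (\<xi>, 0)"] DPf[OF x0(1), of "(\<xi>, 0)"] by (simp add: form_radical_def)
        then show ?thesis by (simp add: form_radical_def)
      qed
      obtain \<alpha> \<beta> where ab: "\<alpha> \<noteq> 0 \<or> \<beta> \<noteq> 0" "\<alpha> *\<^sub>R fd P x0 v + \<beta> *\<^sub>R fd P x0 w = 0"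
        using dim_le_1_dependent[OF radB[OF cB(1) Pim[OF x0(1)]] rd[OF vw(1)] rd[OF vw(2)]] by blast
      let ?u = "\<alpha> *\<^sub>R v + \<beta> *\<^sub>R w"
      have "fd P x0 ?u = 0" using ab(2) linP[OF x0(1)] by (simp add: linear_add linear_scale)
      then have "fd \<Phi> x0 ?u = (0, snd (fd \<Phi> x0 ?u))" using DP\<Phi>[OF x0(1), of ?u] by (simp add: prod_eq_iff)
      then have "?u = Z (snd (fd \<Phi> x0 ?u)) x0" using Df\<Phi>[OF x0(1), of ?u] by (simp add: Z_def)
      then show ?thesis using ab(1) by blast
    qed
  qed
  then obtain r K0 where rK: "0 < r" "\<And>x K. x \<in> X \<Longrightarrow> K \<ge> K0 \<Longrightarrow> dist x x0 < r \<Longrightarrow>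
     dim (form_radical (\<lambda>v u. \<tau> c x v u + K * \<sigma> c x v u)) \<le> 1" by blast
  define N where "N = {x \<in> fst c. snd c x \<in> X \<inter> ball x0 r}"
  show ?thesis
  proof (intro exI[of _ N] exI[of _ K0] conjI allI impI ballI)
    show "openin (mtop M) N" unfolding N_def by (rule chart_preimage_open[OF atlases(1) c(1)]) (use Xop in auto)
    show "z \<in> N" using c x0 rK(1) by (auto simp: N_def x0_def)
    fix K c' x assume K: "K0 \<le> K" and c': "c' \<in> atlas M" and x: "x \<in> chart_image c'" and N: "chart_inv c' x \<in> N"
    let ?w = "chart_inv c' x" and ?\<omega> = "add_form2 \<tau> (scale_form2 K \<sigma>)"
    have w: "?w \<in> fst c'" "snd c' ?w = x" using x by (auto intro: inv_into_into f_inv_into_f)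
    have wc: "?w \<in> fst c" "snd c ?w \<in> X" "dist (snd c ?w) x0 < r" using N by (auto simp: N_def dist_commute)
    have "two_form M ?\<omega>"
      by (rule closed_two_formD(1)[OF closed_two_form_add[OF wkM \<tau> closed_two_form_scale[OF wkM \<sigma>_closed]]])
    from radical_chart_independent[OF wkM this c' c(1) w(1) wc(1)]
    have "dim (form_radical (?\<omega> c' x)) \<le> dim (form_radical (?\<omega> c (snd c ?w)))" unfolding w(2) .
    also have "\<dots> \<le> 1" using rK(2)[OF wc(2) K wc(3)] by (simp add: add_form2_def scale_form2_def)
    finally show "dim (form_radical (?\<omega> c' x)) \<le> 1" .
  qed
qed

lemma global_rank:
  assumes \<tau>: "closed_two_form M \<tau>" and fw: "\<And>b. b \<in> points B \<Longrightarrow> fibrewise \<tau> b"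
  shows "\<exists>K>0. \<forall>c\<in>atlas M. \<forall>x\<in>chart_image c. dim (form_radical (add_form2 \<tau> (scale_form2 K \<sigma>) c x)) \<le> 1"
proof -
  define good where "good = (\<lambda>N K0. \<forall>K\<ge>K0. \<forall>c\<in>atlas M. \<forall>x\<in>chart_image c. chart_inv c x \<in> N \<longrightarrow>
    dim (form_radical (add_form2 \<tau> (scale_form2 K \<sigma>) c x)) \<le> 1)"
  define \<U> where "\<U> = {N. openin (mtop M) N \<and> (\<exists>K0. good N K0)}"
  have "points M \<subseteq> \<Union>\<U>"
  proof
    fix z assume z: "z \<in> points M"
    have "\<exists>N K0. openin (mtop M) N \<and> z \<in> N \<and> good N K0"
      unfolding good_def by (rule local_rank[OF \<tau> fw z])
    then obtain N K0 where "openin (mtop M) N" "z \<in> N" "good N K0" by (elim exE conjE)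
    then show "z \<in> \<Union>\<U>" unfolding \<U>_def by (intro UnionI[of N]) auto
  qed
  moreover have "\<forall>N\<in>\<U>. openin (mtop M) N" by (simp add: \<U>_def)
  ultimately obtain \<V> where \<V>: "finite \<V>" "\<V> \<subseteq> \<U>" "points M \<subseteq> \<Union>\<V>"
    using compact_total unfolding compact_space_def compactin_def by meson
  have "\<forall>N\<in>\<V>. \<exists>K0. good N K0" using \<V>(2) by (auto simp: \<U>_def)
  from bchoice[OF this] obtain k where k: "\<forall>N\<in>\<V>. good N (k N)" by blast
  \<comment> \<open>Dominates every threshold of the finite cover and is positive even for an empty
    one. A common K is possible because each local bound holds for all K beyond its
    threshold.\<close>
  define K where "K = 1 + (\<Sum>N\<in>\<V>. \<bar>k N\<bar>)"
  have "K > 0" unfolding K_def by (simp add: add_pos_nonneg sum_nonneg)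
  moreover have "dim (form_radical (add_form2 \<tau> (scale_form2 K \<sigma>) c x)) \<le> 1" if c: "c \<in> atlas M" and x: "x \<in> chart_image c" for c x
  proof -
    have "chart_inv c x \<in> points M" using smooth_atlas_domain(2)[OF atlases(1) c] inv_into_into[OF x] by auto
    then obtain N where N: "N \<in> \<V>" "chart_inv c x \<in> N" using \<V>(3) by auto
    have "\<bar>k N\<bar> \<le> (\<Sum>N\<in>\<V>. \<bar>k N\<bar>)" by (rule member_le_sum[OF N(1)]) (use \<V>(1) in auto)
    then have "k N \<le> K" by (simp add: K_def)
    moreover have "good N (k N)" using k N(1) by blast
    ultimately show ?thesis using c x N(2) unfolding good_def by blast
  qed
  ultimately show ?thesis by blast
qed

lemma fibrewise_add_\<sigma>:
  assumes \<tau>: "closed_two_form M \<tau>" and fw: "fibrewise \<tau> b"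
  shows "fibrewise (add_form2 \<tau> (scale_form2 K \<sigma>)) b"
  unfolding fibrewise_def eq_form2_def
proof (intro ballI allI)
  fix c x v w assume c0: "c \<in> atlas (fibre M F p T b)" and x: "x \<in> chart_image c"
  obtain s d where c: "s \<in> T" "b \<in> fst s" "d \<in> atlas F" "c = fibre_chart M p b s d" using c0 by (rule atlas_fibre_cases)
  have y: "x \<in> chart_image d" using x unfolding c(4) fibre_chart_facts(4)[OF c(1-3)] .
  let ?\<phi> = "\<lambda>y. glue s b (chart_inv d y)"
  note sp = fibre_param[OF c(1-3)]
  have "pb2 M ?\<phi> (scale_form2 K \<sigma>) x v w = K * pb2 M ?\<phi> \<sigma> x v w"
    by (simp add: pb2_def scale_form2_def Let_def)
  then have "pb2 M ?\<phi> (add_form2 \<tau> (scale_form2 K \<sigma>)) x v w = pb2 M ?\<phi> \<tau> x v w"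
    using pb2_add[OF sp y, of "add_form2 \<tau> (scale_form2 K \<sigma>)" \<tau> "scale_form2 K \<sigma>" v w] \<sigma>_vertical[OF c(1-3) y, of v w]
    by (simp add: add_form2_def)
  then have "pullback2 (fibre M F p T b) M (\<lambda>x. x) (add_form2 \<tau> (scale_form2 K \<sigma>)) c x v w = pullback2 (fibre M F p T b) M (\<lambda>x. x) \<tau> c x v w"
    unfolding c(4) pullback2_fibre[OF c(1-3) y] .
  then show "pullback2 (fibre M F p T b) M (\<lambda>x. x) (add_form2 \<tau> (scale_form2 K \<sigma>)) c x v w = fibre_form M F \<omega>\<^sub>0 p T b c x v w"
    using fw c0 x unfolding fibrewise_def eq_form2_def by simp
qed

end

theorem theorem7p1:
  fixes M :: "('m, real^'k) manifold"
    and B :: "('b, real^'n) manifold"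
    and F :: "('f, 'v::real_inner) manifold"
    and \<omega>\<^sub>0 :: "('f, 'v) form2"
    and p :: "'m \<Rightarrow> 'b"
    and T :: "('b set \<times> ('m \<Rightarrow> 'b \<times> 'f)) set"
    and OrB :: "('b, real^'n) chart set"
    and \<omega>B :: "('b, real^'n) form2"
    and u :: "('m, real^'k) form2 set"
  assumes "compact_symplectic_fibration M B F \<omega>\<^sub>0 p T"
    and "presymplectic_manifold B OrB \<omega>B"
    and "u \<in> H2 M"
    and "\<forall>b\<in>points B. pullback_class (fibre M F p T b) M (\<lambda>x. x) u
           = coh_class (fibre M F p T b) (fibre_form M F \<omega>\<^sub>0 p T b)"
  shows "\<exists>K>0. \<exists>\<omega>. presymplectic_form M \<omega> \<and>
     (\<forall>b\<in>points B. eq_form2 (fibre M F p T b)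
        (pullback2 (fibre M F p T b) M (\<lambda>x. x) \<omega>) (fibre_form M F \<omega>\<^sub>0 p T b)) \<and>
     coh_class M \<omega> = add_class M u (scale_class M K (pullback_class M B p (coh_class B \<omega>B)))"
proof -
  have fib: "symplectic_fibration M B F \<omega>\<^sub>0 p T" and cpt: "compact_space (mtop B)" "compact_space (mtop F)"
    using assms(1) by (auto simp: compact_symplectic_fibration_def compact_manifold_def)
  have psB: "presymplectic_form B \<omega>B" using assms(2) by (simp add: presymplectic_manifold_def)
  then obtain m where m: "CARD('n) = 2 * m + 1"
    "\<And>c x. c \<in> atlas B \<Longrightarrow> x \<in> chart_image c \<Longrightarrow> rank (\<chi> i j. \<omega>B c x (axis i 1) (axis j 1)) = 2 * m"
    and clB: "closed_two_form B \<omega>B" unfolding presymplectic_form_def by blast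
  interpret thurston M B F \<omega>\<^sub>0 p T \<omega>B
  proof unfold_locales
    fix c x assume c: "c \<in> atlas B" and x: "x \<in> chart_image c"
    note tB = two_formD[OF closed_two_formD(1)[OF clB] c]
    \<comment> \<open>The dimension is CARD('n) minus the rank, that is (2 m + 1) - 2 m = 1.\<close>
    show "dim (form_radical (\<omega>B c x)) \<le> 1"
      using dim_radical_rank[OF tB(1)[OF x] tB(2)[OF x]] m(1) m(2)[OF c x] by linarith
  qed (use fib cpt clB in auto)
  obtain \<tau>0 where \<tau>0: "closed_two_form M \<tau>0" "u = coh_class M \<tau>0"
    using assms(3) unfolding H2_def quotient_def coh_class_def by blast
  have "fibre_cohomologous \<tau>0"
    unfolding fibre_cohomologous_def
  proof (intro conjI ballI \<tau>0(1))
    fix b assume "b \<in> points B"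
    then obtain \<omega>1 where 1: "\<omega>1 \<in> u"
      "(pullback2 (fibre M F p T b) M (\<lambda>x. x) \<omega>1, fibre_form M F \<omega>\<^sub>0 p T b) \<in> cohomologous (fibre M F p T b)"
      using fibre_cohomology assms(4) by blast
    \<comment> \<open>The member of u obtained from the hypothesis depends on b. It is cohomologous
      to the fixed \<open>\<tau>0\<close>, and this relation restricts to the fibre.\<close>
    have "(\<tau>0, \<omega>1) \<in> cohomologous M" using 1(1) by (simp add: \<tau>0(2) coh_class_def)
    from cohomologous_pullback[OF wk_fibre wkM findims(3,1) fibre_inclusion_smooth this]
    show "(pullback2 (fibre M F p T b) M (\<lambda>x. x) \<tau>0, fibre_form M F \<omega>\<^sub>0 p T b) \<in> cohomologous (fibre M F p T b)"
      using cohomologous_equiv[OF wk_fibre] 1(2) by (meson equivE transD)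
  qed
  from fibrewise_representative[OF this] obtain \<tau> where \<tau>: "(\<tau>, \<tau>0) \<in> cohomologous M" "\<And>b. b \<in> points B \<Longrightarrow> fibrewise \<tau> b" by blast
  have cl: "closed_two_form M \<tau>" using \<tau>(1) by (simp add: cohomologous_def)
  obtain K where K: "K > 0" "\<And>c x. c \<in> atlas M \<Longrightarrow> x \<in> chart_image c \<Longrightarrow> dim (form_radical (add_form2 \<tau> (scale_form2 K \<sigma>) c x)) \<le> 1"
    using global_rank[OF cl \<tau>(2)] by blast
  let ?\<omega> = "add_form2 \<tau> (scale_form2 K \<sigma>)"
  have cl\<sigma>: "closed_two_form M (scale_form2 K \<sigma>)" by (rule closed_two_form_scale[OF wkM \<sigma>_closed])
  have cl\<omega>: "closed_two_form M ?\<omega>" by (rule closed_two_form_add[OF wkM cl cl\<sigma>])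
  have "presymplectic_form M ?\<omega>"
  proof -
    have "dim (UNIV :: (real^'k) set) = dim (UNIV :: (real^'n) set) + dim (UNIV :: 'v set)" "even (dim (UNIV :: 'v set))"
      using fib by (auto simp: symplectic_fibration_def symplectic_form_def)
    \<comment> \<open>The odd dimension of the base plus the even dimension of the fibre.\<close>
    then have "odd CARD('k)" using m(1) by simp
    then obtain l where l: "CARD('k) = 2 * l + 1" by (rule oddE)
    have "rank (\<chi> i j. ?\<omega> c x (axis i 1) (axis j 1)) = 2 * l" if c: "c \<in> atlas M" and x: "x \<in> chart_image c" for c x
    proof -
      note tM = two_formD[OF closed_two_formD(1)[OF cl\<omega>] c]
      \<comment> \<open>Odd dimension forces a nonzero radical. Together with the upper bound the
        radical is a line and the rank exactly 2 l.\<close>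
      have "dim (form_radical (?\<omega> c x)) \<ge> 1" by (rule odd_radical[OF tM(1)[OF x] tM(2)[OF x] \<open>odd CARD('k)\<close>])
      then show ?thesis using K(2)[OF c x] dim_radical_rank[OF tM(1)[OF x] tM(2)[OF x]] l by linarith
    qed
    then show ?thesis unfolding presymplectic_form_def using cl\<omega> l by blast
  qed
  moreover have "eq_form2 (fibre M F p T b) (pullback2 (fibre M F p T b) M (\<lambda>x. x) ?\<omega>) (fibre_form M F \<omega>\<^sub>0 p T b)"
    if "b \<in> points B" for b
    using fibrewise_add_\<sigma>[OF cl \<tau>(2)[OF that]] by (simp add: fibrewise_def)
  moreover have "coh_class M ?\<omega> = add_class M u (scale_class M K (pullback_class M B p (coh_class B \<omega>B)))"
  proof -
    have "coh_class M ?\<omega> = coh_class M (add_form2 \<tau>0 (scale_form2 K \<sigma>))"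
      unfolding coh_class_def
      by (rule equiv_class_eq[OF cohomologous_equiv[OF wkM] cohomologous_add[OF wkM \<tau>(1) cohomologous_refl[OF cl\<sigma>]]])
    also have "\<dots> = add_class M u (scale_class M K (pullback_class M B p (coh_class B \<omega>B)))"
      unfolding \<tau>0(2) \<sigma>_def by (rule class_arithmetic[OF wkM wkB findims(1,2) chart_smooth_p \<tau>0(1) clB, symmetric])
    finally show ?thesis .
  qed
  ultimately show ?thesis using K(1) by blast
qed

end
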